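(* There is a universal constant $C>0$ such that the following holds. For any $\varepsilon\in(0,1)$, under the condition $$\kappa\le d\le\eta\log n\quad\text{and}\quad p_{\max}\le n^{-1+\eta},$$ with high probability both $$\max_{k\in[n^{1-\varepsilon}]}\Bigl|\lambda_k(\underline A)-\sqrt{D_k^{\downarrow}}\Bigr|\le C\sqrt{n\,p_{\max}}+\varepsilon\sqrt{L_1}$$ and $$\max_{k\in[n^{1-\varepsilon}]}\Bigl|\lambda_{n+1-k}(\underline A)+\sqrt{D_k^{\downarrow}}\Bigr|\le C\sqrt{n\,p_{\max}}+\varepsilon\sqrt{L_1}.$$
   Context: Setting: $G$ is a random undirected graph on the vertex set $\{1,\dots,n\}$ (loops allowed) in which each edge $\{i,j\}$ (including $i=j$) is present with probability $p_{ij}=p_{ji}\in[0,1]$, independently of the others; $A$ is its adjacency matrix, $(\mathbb E A)_{ij}=p_{ij}$, and $\underline A=A-\mathbb E A$. Set $p_{\max}=\max_{i\ne j}p_{ij}$, $d_i=\sum_j p_{ij}$, $d=\max_i d_i$. The degree of $i$ is $D_i=\sum_j A_{ij}$, and $D_1^{\downarrow}\ge\dots\ge D_n^{\downarrow}$ are the degrees in decreasing order. For a Hermitian $n\times n$ matrix $H$, $\lambda_1(H)\ge\dots\ge\lambda_n(H)$ are its eigenvalues. For $x>0$, $[x]=\{1,2,\dots,\lfloor x\rfloor\}$. For $k\in[n]$, $$L_k=\frac{\log(n/k)}{\log((\log n)/d)}.$$ Parameters: $\kappa>0$ and $\eta\in(0,1)$. An admissible error function is a function $\psi(n,\kappa,\eta)$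 such that for every $\kappa>0$, $\psi(n,\kappa,\eta)\to0$ as $n\to\infty$ and $\eta\to0$ (joint limit). "Under a condition $\mathcal A$ on the parameters $\kappa,\eta,(p_{ij})$, an event $E$ holds with high probability" means: there is an admissible error function $\psi$ with $\mathbb P(E)\ge1-\psi(n,\kappa,\eta)$ for all $n,\kappa,\eta,(p_{ij})_{i,j\in[n]}$ satisfying $\mathcal A$ ($\psi$ may depend on $\varepsilon$, but not on $(p_{ij})$). *)

theory Defs
  imports "HOL-Probability.Product_PMF" "Jordan_Normal_Form.Char_Poly"
begin

text \<open>
  The vertex set is \<open>{0, \<dots>, n - 1}\<close>, so that vertices are matrix indices. Eigenvalues, ordered
  degrees and \<open>L\<^sub>k\<close> are numbered from \<open>k = 1\<close>.
\<close>

definition edges :: "nat \<Rightarrow> nat set set" where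
  "edges n = {{i, j} | i j. i < n \<and> j < n}"

definition random_graph :: "nat \<Rightarrow> (nat \<Rightarrow> nat \<Rightarrow> real) \<Rightarrow> (nat set \<Rightarrow> bool) pmf" where
  "random_graph n p = Pi_pmf (edges n) False (\<lambda>e. bernoulli_pmf (p (Min e) (Max e)))"

definition edge_probabilities :: "nat \<Rightarrow> (nat \<Rightarrow> nat \<Rightarrow> real) \<Rightarrow> bool" where
  "edge_probabilities n p \<longleftrightarrow> (\<forall>i<n. \<forall>j<n. 0 \<le> p i j \<and> p i j \<le> 1 \<and> p i j = p j i)"

definition adj_mat :: "nat \<Rightarrow> (nat set \<Rightarrow> bool) \<Rightarrow> real mat" where
  "adj_mat n G = mat n n (\<lambda>(i, j). of_bool (G {i, j}))"

definition centered_adj_mat :: "nat \<Rightarrow> (nat \<Rightarrow> nat \<Rightarrow> real) \<Rightarrow> (nat set \<Rightarrow> bool) \<Rightarrow> real mat" where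
  "centered_adj_mat n p G = adj_mat n G - mat n n (\<lambda>(i, j). p i j)"

text \<open>The maximum is over a nonempty set only for \<open>n \<ge> 2\<close>.\<close>

definition p_max :: "nat \<Rightarrow> (nat \<Rightarrow> nat \<Rightarrow> real) \<Rightarrow> real" where
  "p_max n p = Max {p i j | i j. i < n \<and> j < n \<and> i \<noteq> j}"

definition max_mean_degree :: "nat \<Rightarrow> (nat \<Rightarrow> nat \<Rightarrow> real) \<Rightarrow> real" where
  "max_mean_degree n p = (MAX i\<in>{..<n}. \<Sum>j<n. p i j)"

text \<open>A loop contributes one to the degree.\<close>

definition degree_of :: "nat \<Rightarrow> (nat set \<Rightarrow> bool) \<Rightarrow> nat \<Rightarrow> real" where
  "degree_of n G i = (\<Sum>j<n. adj_mat n G $$ (i, j))"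

definition ordered_degree :: "nat \<Rightarrow> (nat set \<Rightarrow> bool) \<Rightarrow> nat \<Rightarrow> real" where
  "ordered_degree n G k = rev (sort (map (degree_of n G) [0..<n])) ! (k - 1)"

text \<open>
  The \<open>k\<close>-th largest eigenvalue, counted with multiplicity. For a symmetric real matrix all
  roots of the characteristic polynomial are real, so \<open>proots\<close> has as many elements as the
  matrix has rows.
\<close>

definition eigenvalue_nth :: "real mat \<Rightarrow> nat \<Rightarrow> real" where
  "eigenvalue_nth H k = rev (sorted_list_of_multiset (proots (char_poly H))) ! (k - 1)"

definition L_param :: "nat \<Rightarrow> real \<Rightarrow> nat \<Rightarrow> real" where
  "L_param n d k = ln (real n / real k) / ln (ln (real n) / d)"

definition bracket :: "real \<Rightarrow> nat set" where
  "bracket x = {1..nat \<lfloor>x\<rfloor>}"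

definition admissible_error :: "(nat \<Rightarrow> real \<Rightarrow> real \<Rightarrow> real) \<Rightarrow> bool" where
  "admissible_error \<psi> \<longleftrightarrow>
     (\<forall>\<kappa>>0. ((\<lambda>(n, \<eta>). \<psi> n \<kappa> \<eta>) \<longlongrightarrow> 0) (sequentially \<times>\<^sub>F at_right 0))"

end

theory Submission
  imports Defs "HOL-Real_Asymp.Real_Asymp"
begin

text \<open>
  Put \<open>L = L_param n d 1\<close> and call a vertex a hub if its degree is at least \<open>\<delta> * L\<close>, with \<open>\<delta>\<close> of
  order \<open>\<epsilon>\<^sup>2\<close>. Degrees have Poisson tails with mean at most \<open>d\<close>, so a given vertex is a hub with
  probability about \<open>n powr (- \<delta>)\<close>. A union bound over a fixed number of configurations then shows
  that around each hub all but a bounded number of edges belong to pairwise disjoint stars. A star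
  with \<open>D\<close> leaves has eigenvalues \<open>\<plusminus> sqrt D\<close>, which produces the main term by the min-max principle.

  Off the hubs all degrees are at most \<open>\<delta> * L\<close>, and the argument of Kahn-Szemeredi and Feige-Ofek
  bounds the centered matrix there by a constant times \<open>s = sqrt (max (n * p_max) (\<delta> * L))\<close>: test
  vectors are rounded to a dyadic net, pairs of entries with product at most \<open>s\<close> are controlled by
  an exponential moment bound and a union bound over the net, and the other pairs by a discrepancy
  property of the edge counts between all pairs of vertex sets. The mean of the removed part is
  negligible because there are few hubs.

  If \<open>n * p_max \<ge> L\<close>, the threshold \<open>4 * L\<close> leaves no hubs, and everything is absorbed
  into the term \<open>C * sqrt (n * p_max)\<close>.
\<close>

section \<open>The spectral theorem for real symmetric matrices\<close>

text \<open>The noise level is \<open>sqrt (n * p_max)\<close>, but degrees fluctuate on the scale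
  \<open>L\<close>, which may be much larger, while the net argument tolerates only degrees up to
  \<open>s\<^sup>2\<close>. This is why hubs are removed and treated by hand. The case distinction
  comes from the counting. A configuration with r hubs costs about
  \<open>n powr (- \<delta> * r / 2)\<close>, and this wins once \<open>\<delta> * r >= 4\<close>,
  provided the number of ways to attach its edges is polylogarithmic. The inequality
  \<open>n * P <= L\<close> guarantees that. If it fails there is no such control, but then every
  degree lies below the noise up to a constant factor. Since r depends only on \<epsilon>, errors of
  order r are swallowed by \<open>\<epsilon> * sqrt L\<close>, because L tends to infinity. The
  universal constant arises in the case \<open>L <= n * P\<close>: there
  \<open>s = 2 * sqrt (n * P)\<close>, the form bound contributes 2661 * 2 and the degree threshold
  \<open>4 * L\<close> contributes 2, in total 5324. The same number fixes \<delta> in the other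
  case.\<close>

lemma symmetric_matD:
  assumes "H \<in> carrier_mat n n" "H\<^sup>T = H" "i < n" "j < n"
  shows "H $$ (i, j) = H $$ (j, i)"
  using assms by (metis carrier_matD index_transpose_mat(1))

text \<open>The fundamental theorem of algebra gives a complex eigenpair. The form \<open>X\<close>
  equals its own conjugate, so the eigenvalue is real; then the real and the imaginary part of the
  eigenvector both solve the equation, and one of them is nonzero.\<close>

lemma symmetric_real_eigenvector:
  fixes H :: "real mat"
  assumes H: "H \<in> carrier_mat n n" and n: "n > 0" and sym: "H\<^sup>T = H"
  obtains v :: "nat \<Rightarrow> real" and e :: real
  where "(\<Sum>i<n. (v i)\<^sup>2) = 1" "\<And>i. i < n \<Longrightarrow> (\<Sum>j<n. H $$ (i, j) * v j) = e * v i"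
proof -
  let ?C = "map_mat complex_of_real H"
  have C: "?C \<in> carrier_mat n n" using H by simp
  have "degree (char_poly ?C) = n" using degree_monic_char_poly[OF C] by simp
  then have "\<not> constant (poly (char_poly ?C))"
    using n by (simp add: constant_degree)
  then obtain \<mu> where "poly (char_poly ?C) \<mu> = 0"
    using fundamental_theorem_of_algebra by blast
  then have "eigenvalue ?C \<mu>" using eigenvalue_root_char_poly[OF C] by simp
  then obtain z where z: "z \<in> carrier_vec n" "z \<noteq> 0\<^sub>v n" "?C *\<^sub>v z = \<mu> \<cdot>\<^sub>v z"
    using C unfolding eigenvalue_def eigenvector_def by auto
  have ev: "(\<Sum>j<n. complex_of_real (H $$ (i, j)) * vec_index z j) = \<mu> * vec_index z i" if "i < n" for i
  proof -
    have "vec_index (?C *\<^sub>v z) i = (\<Sum>j<n. complex_of_real (H $$ (i, j)) * vec_index z j)"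
      using that H z(1) by (simp add: scalar_prod_def atLeast0LessThan)
    then show ?thesis using z that by simp
  qed
  define S where "S = (\<Sum>i<n. (cmod (vec_index z i))\<^sup>2)"
  define X where "X = (\<Sum>i<n. cnj (vec_index z i) * (\<Sum>j<n. complex_of_real (H $$ (i, j)) * vec_index z j))"
  have X1: "X = \<mu> * complex_of_real S"
  proof -
    have "X = (\<Sum>i<n. cnj (vec_index z i) * (\<mu> * vec_index z i))"
      unfolding X_def by (intro sum.cong refl) (simp add: ev)
    also have "\<dots> = (\<Sum>i<n. \<mu> * complex_of_real ((cmod (vec_index z i))\<^sup>2))"
      by (intro sum.cong refl) (simp only: complex_norm_square mult_ac)
    finally show ?thesis by (simp only: S_def sum_distrib_left of_real_sum)
  qed
  have "cnj X = X"
  proof -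
    have "cnj X = (\<Sum>i<n. \<Sum>j<n. vec_index z i * (complex_of_real (H $$ (i, j)) * cnj (vec_index z j)))"
      unfolding X_def by (simp add: sum_distrib_left)
    also have "\<dots> = (\<Sum>j<n. \<Sum>i<n. vec_index z i * (complex_of_real (H $$ (i, j)) * cnj (vec_index z j)))"
      by (rule sum.swap)
    also have "\<dots> = X"
      unfolding X_def sum_distrib_left
      by (intro sum.cong refl) (simp add: symmetric_matD[OF H sym] mult_ac)
    finally show ?thesis .
  qed
  moreover have S0: "S > 0"
  proof -
    obtain i where i: "i < n" "vec_index z i \<noteq> 0"
      using z(1,2) by (metis eq_vecI carrier_vecD index_zero_vec)
    show ?thesis unfolding S_def
      by (rule sum_pos2[of _ i]) (use i in auto)
  qed
  ultimately have "cnj \<mu> = \<mu>" unfolding X1 by simp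
  then obtain e where e: "\<mu> = complex_of_real e" by (metis Reals_cnj_iff Reals_cases)
  have re: "(\<Sum>j<n. H $$ (i, j) * Re (vec_index z j)) = e * Re (vec_index z i)" 
    and im: "(\<Sum>j<n. H $$ (i, j) * Im (vec_index z j)) = e * Im (vec_index z i)" if "i < n" for i
    using arg_cong[OF ev[OF that], of Re] arg_cong[OF ev[OF that], of Im] by (simp_all add: e)
  have "S = (\<Sum>i<n. (Re (vec_index z i))\<^sup>2) + (\<Sum>i<n. (Im (vec_index z i))\<^sup>2)"
    unfolding S_def by (simp add: cmod_power2 sum.distrib)
  then obtain u where u: "(\<Sum>i<n. (u i)\<^sup>2) \<noteq> 0" 
    "\<And>i. i < n \<Longrightarrow> (\<Sum>j<n. H $$ (i, j) * u j) = e * u i"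
    using S0 re im by (metis add.right_neutral less_irrefl)
  define N where "N = (\<Sum>i<n. (u i)\<^sup>2)"
  have N: "N > 0" using u(1) unfolding N_def by (simp add: less_le sum_nonneg)
  show thesis
  proof (rule that[of "\<lambda>i. u i / sqrt N" e])
    have "(\<Sum>i<n. (u i / sqrt N)\<^sup>2) = (\<Sum>i<n. (u i)\<^sup>2) / N"
      using N by (simp add: power_divide sum_divide_distrib)
    then show "(\<Sum>i<n. (u i / sqrt N)\<^sup>2) = 1" using N by (simp add: N_def[symmetric])
    show "(\<Sum>j<n. H $$ (i, j) * (u j / sqrt N)) = e * (u i / sqrt N)" if "i < n" for i
      using u(2)[OF that] by (simp add: sum_divide_distrib[symmetric])
  qed
qed

text \<open>With w the difference of \<open>v\<close> and the first basis vector, \<open>W\<close>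
  is the reflection in the hyperplane orthogonal to w; it exchanges the two vectors, and the squared
  norm of w is \<open>2 * (1 - v 0)\<close>. If \<open>v 0 = 1\<close>, division by zero gives 0 and
  \<open>W\<close> is the identity, which is correct because \<open>v\<close> then is the first
  basis vector.\<close>

lemma householder_reflection:
  fixes v :: "nat \<Rightarrow> real"
  assumes v: "(\<Sum>i<Suc n. (v i)\<^sup>2) = 1"
  obtains W where "W \<in> carrier_mat (Suc n) (Suc n)" "W\<^sup>T = W" "W * W = 1\<^sub>m (Suc n)"
    "\<And>i. i < Suc n \<Longrightarrow> W $$ (i, 0) = v i"
proof -
  define w where "w i = v i - of_bool (i = 0)" for i :: nat
  define W where "W = mat (Suc n) (Suc n) (\<lambda>(i, j). of_bool (i = j) - w i * w j / (1 - v 0))"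
  have v0: "(\<Sum>i<n. (v (Suc i))\<^sup>2) = 1 - (v 0)\<^sup>2"
    using v by (simp add: sum.lessThan_Suc_shift del: sum.lessThan_Suc)
  have w2: "(\<Sum>i<Suc n. (w i)\<^sup>2) = 2 * (1 - v 0)"
    using v0 by (simp add: w_def sum.lessThan_Suc_shift power2_eq_square algebra_simps 
        del: sum.lessThan_Suc)
  have tail: "v i = 0" if "v 0 = 1" "i < Suc n" "i \<noteq> 0" for i
  proof -
    have "(\<Sum>i<n. (v (Suc i))\<^sup>2) = 0" using v0 that by simp
    then have "\<forall>i<n. (v (Suc i))\<^sup>2 = 0" by (subst (asm) sum_nonneg_eq_0_iff) auto
    then show ?thesis using that by (cases i) auto
  qed
  show thesis
  proof (rule that[of W])
    show "W \<in> carrier_mat (Suc n) (Suc n)" by (simp add: W_def)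
    show "W\<^sup>T = W" by (rule eq_matI) (auto simp: W_def mult_ac)
    show "W $$ (i, 0) = v i" if "i < Suc n" for i
    proof (cases "v 0 = 1")
      case True
      then show ?thesis using that tail[of i] by (auto simp: W_def)
    next
      case False
      then have "w i * w 0 / (1 - v 0) = - w i" by (simp add: w_def field_simps)
      then show ?thesis using that by (simp add: W_def w_def)
    qed
    show "W * W = 1\<^sub>m (Suc n)"
    proof (rule eq_matI)
      fix i j assume "i < dim_row (1\<^sub>m (Suc n))" "j < dim_col (1\<^sub>m (Suc n))"
      then have ij: "i < Suc n" "j < Suc n" by auto
      let ?c = "1 - v 0"
      have "(W * W) $$ (i, j) = (\<Sum>l<Suc n. (of_bool (i = l) - w i * w l / ?c) * (of_bool (l = j) - w l * w j / ?c))"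
        using ij by (simp add: W_def scalar_prod_def atLeast0LessThan del: sum.lessThan_Suc)
      also have "\<dots> = (\<Sum>l<Suc n. of_bool (l = i) * of_bool (l = j) - of_bool (l = i) * (w l * w j / ?c)
          - of_bool (l = j) * (w i * w l / ?c) + (w l)\<^sup>2 * (w i * w j / ?c\<^sup>2))"
        by (intro sum.cong refl) (auto simp: algebra_simps power2_eq_square)
      also have "\<dots> = of_bool (i = j) - w i * w j / ?c - w i * w j / ?c + 2 * ?c * (w i * w j / ?c\<^sup>2)"
      proof -
        have d: "(\<Sum>l<Suc n. of_bool (l = t) * F l) = F t" if "t < Suc n" for t and F :: "nat \<Rightarrow> real"
        proof -
          have "(\<Sum>l<Suc n. of_bool (l = t) * F l) = (\<Sum>l<Suc n. if l = t then F l else 0)"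
            by (intro sum.cong) auto
          then show ?thesis using that by (simp del: sum.lessThan_Suc)
        qed
        show ?thesis
          unfolding sum.distrib sum_subtractf sum_distrib_right[symmetric] w2
            d[OF ij(1), of "\<lambda>l. of_bool (l = j)"] d[OF ij(1), of "\<lambda>l. w l * w j / ?c"]
            d[OF ij(2), of "\<lambda>l. w i * w l / ?c"] ..
      qed
      also have "2 * c * (x / c\<^sup>2) = x / c + x / c" for c x :: real
        by (cases "c = 0") (simp_all add: power2_eq_square)
      finally have "(W * W) $$ (i, j) = of_bool (i = j)" by simp
      then show "(W * W) $$ (i, j) = 1\<^sub>m (Suc n) $$ (i, j)" using ij by simp
    qed (auto simp: W_def)
  qed
qed

text \<open>Deflation: conjugating with a reflection that moves a unit eigenvector to the first
  coordinate clears the first column off the diagonal. Symmetry clears the first row as well, and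
  induction handles the remaining block.\<close>

lemma symmetric_mat_diagonalization:
  fixes H :: "real mat"
  assumes "H \<in> carrier_mat n n" "H\<^sup>T = H"
  shows "\<exists>Q D. Q \<in> carrier_mat n n \<and> D \<in> carrier_mat n n \<and> diagonal_mat D \<and>
    Q\<^sup>T * Q = 1\<^sub>m n \<and> Q * Q\<^sup>T = 1\<^sub>m n \<and> H = Q * D * Q\<^sup>T"
  using assms
proof (induction n arbitrary: H)
  case 0
  then show ?case
    by (intro exI[of _ "1\<^sub>m 0"]) (auto simp: diagonal_mat_def)
next
  case (Suc n)
  note H = Suc.prems(1) and sym = Suc.prems(2)
  obtain v e where v: "(\<Sum>i<Suc n. (v i)\<^sup>2) = 1"
    and ev: "\<And>i. i < Suc n \<Longrightarrow> (\<Sum>j<Suc n. H $$ (i, j) * v j) = e * v i"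
    using symmetric_real_eigenvector[OF H _ sym] by blast
  obtain W where W: "W \<in> carrier_mat (Suc n) (Suc n)" "W\<^sup>T = W" "W * W = 1\<^sub>m (Suc n)"
    "\<And>i. i < Suc n \<Longrightarrow> W $$ (i, 0) = v i"
    using householder_reflection[OF v] by blast
  define K where "K = W * (H * W)"
  have K: "K \<in> carrier_mat (Suc n) (Suc n)" using W H by (simp add: K_def)
  have HW: "H * W \<in> carrier_mat (Suc n) (Suc n)" using W H by simp
  have symK: "K\<^sup>T = K"
    unfolding K_def
    using W H sym transpose_mult[OF W(1) HW] transpose_mult[OF H W(1)] assoc_mult_mat[OF W(1) H W(1)]
    by simp
  have K0: "K $$ (i, 0) = e * of_bool (i = 0)" if i: "i < Suc n" for i
  proof -
    have HW0: "(H * W) $$ (j, 0) = e * W $$ (j, 0)" if "j < Suc n" for j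
    proof -
      have "(H * W) $$ (j, 0) = (\<Sum>l<Suc n. H $$ (j, l) * W $$ (l, 0))"
        using that H W(1) by (simp add: scalar_prod_def atLeast0LessThan del: sum.lessThan_Suc)
      also have "\<dots> = (\<Sum>l<Suc n. H $$ (j, l) * v l)" using W(4) by (intro sum.cong) auto
      finally show ?thesis using ev[OF that] W(4)[OF that] by simp
    qed
    have "K $$ (i, 0) = row W i \<bullet> col (H * W) 0"
      unfolding K_def by (rule index_mult_mat(1)) (use i HW W(1) in auto)
    also have "\<dots> = (\<Sum>l<Suc n. W $$ (i, l) * (H * W) $$ (l, 0))"
      using i HW W(1)
      by (auto simp: scalar_prod_def atLeast0LessThan simp del: index_mult_mat(1) sum.lessThan_Suc
          intro!: sum.cong)
    also have "\<dots> = e * (\<Sum>l<Suc n. W $$ (i, l) * W $$ (l, 0))"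
      unfolding sum_distrib_left using HW0 by (intro sum.cong) auto
    also have "(\<Sum>l<Suc n. W $$ (i, l) * W $$ (l, 0)) = (W * W) $$ (i, 0)"
      using i W(1) by (simp add: scalar_prod_def atLeast0LessThan del: sum.lessThan_Suc)
    finally show ?thesis using i W(3) by simp
  qed
  define B where "B = mat n n (\<lambda>(i, j). K $$ (Suc i, Suc j))"
  have B: "B \<in> carrier_mat n n" by (simp add: B_def)
  have symB: "B\<^sup>T = B"
    by (rule eq_matI) (auto simp: B_def symmetric_matD[OF K symK])
  let ?e = "mat 1 1 (\<lambda>_. e)"
  have Kb: "K = four_block_mat ?e (0\<^sub>m 1 n) (0\<^sub>m n 1) B"
  proof (rule eq_matI)
    fix i j assume "i < dim_row (four_block_mat ?e (0\<^sub>m 1 n) (0\<^sub>m n 1) B)"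
      "j < dim_col (four_block_mat ?e (0\<^sub>m 1 n) (0\<^sub>m n 1) B)"
    then have ij: "i < Suc n" "j < Suc n" using B by auto
    show "K $$ (i, j) = four_block_mat ?e (0\<^sub>m 1 n) (0\<^sub>m n 1) B $$ (i, j)"
      using ij K0[of i] K0[of j] symmetric_matD[OF K symK, of 0 j] B
      by (cases i; cases j) (auto simp: B_def)
  qed (use K B in auto)
  obtain Q D where Q: "Q \<in> carrier_mat n n" "D \<in> carrier_mat n n" "diagonal_mat D"
    "Q\<^sup>T * Q = 1\<^sub>m n" "Q * Q\<^sup>T = 1\<^sub>m n" "B = Q * D * Q\<^sup>T"
    using Suc.IH[OF B symB] by blast
  let ?P = "four_block_mat (1\<^sub>m 1) (0\<^sub>m 1 n) (0\<^sub>m n 1) Q"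
  let ?D = "four_block_mat ?e (0\<^sub>m 1 n) (0\<^sub>m n 1) D"
  have e1: "?e \<in> carrier_mat 1 1" by simp
  have QT: "Q\<^sup>T \<in> carrier_mat n n" using Q(1) by simp
  have P: "?P \<in> carrier_mat (Suc n) (Suc n)" using Q(1) by auto
  have PT: "?P\<^sup>T = four_block_mat (1\<^sub>m 1) (0\<^sub>m 1 n) (0\<^sub>m n 1) Q\<^sup>T"
    by (subst transpose_four_block_mat[of _ 1 1 _ n _ n]) (use Q(1) in auto)
  have PT': "?P\<^sup>T \<in> carrier_mat (Suc n) (Suc n)" using P by simp
  have D': "?D \<in> carrier_mat (Suc n) (Suc n)" using Q(2) by auto
  have oneb: "four_block_mat (1\<^sub>m 1) (0\<^sub>m 1 n) (0\<^sub>m n 1) (1\<^sub>m n) = (1\<^sub>m (Suc n) :: real mat)"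
    by (rule eq_matI) auto
  have bm: "four_block_mat a (0\<^sub>m 1 n) (0\<^sub>m n 1) X * four_block_mat b (0\<^sub>m 1 n) (0\<^sub>m n 1) Y =
      four_block_mat (a * b) (0\<^sub>m 1 n) (0\<^sub>m n 1) (X * Y)"
    if "a \<in> carrier_mat 1 1" "b \<in> carrier_mat 1 1" "X \<in> carrier_mat n n" "Y \<in> carrier_mat n n" 
    for a b X Y :: "real mat"
    by (subst mult_four_block_mat[of _ 1 1 _ n _ n _ _ 1 _ n]) (use that in auto)
  have PPT: "?P\<^sup>T * ?P = 1\<^sub>m (Suc n)" "?P * ?P\<^sup>T = 1\<^sub>m (Suc n)"
    unfolding PT using Q(1,4,5) QT bm[of "1\<^sub>m 1" "1\<^sub>m 1"] oneb by auto
  have PDP: "?P * ?D * ?P\<^sup>T = K"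
    unfolding PT Kb using Q(1,2,6) QT bm[of "1\<^sub>m 1" ?e Q D] bm[of ?e "1\<^sub>m 1" "Q * D" "Q\<^sup>T"] by simp
  have H_eq: "H = W * K * W"
  proof -
    have "W * K = (W * W) * (H * W)"
      unfolding K_def by (rule assoc_mult_mat[OF W(1) W(1) HW, symmetric])
    then have "W * K = H * W" unfolding W(3) left_mult_one_mat[OF HW] .
    then have "W * K * W = H * (W * W)" using assoc_mult_mat[OF H W(1) W(1)] by simp
    then show ?thesis using W(3) H by simp
  qed
  have WP: "W * ?P \<in> carrier_mat (Suc n) (Suc n)" using W(1) P by (rule mult_carrier_mat)
  have WPT: "(W * ?P)\<^sup>T = ?P\<^sup>T * W" using transpose_mult[OF W(1) P] W(2) by simp
  have inv1: "(W * ?P) * (?P\<^sup>T * W) = 1\<^sub>m (Suc n)"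
  proof -
    have "(W * ?P) * (?P\<^sup>T * W) = W * ((?P * ?P\<^sup>T) * W)"
      using W(1) P PT' by (simp add: assoc_mult_mat[of _ "Suc n" "Suc n" _ "Suc n" _ "Suc n"])
    then show ?thesis using PPT(2) W by simp
  qed
  have inv2: "(?P\<^sup>T * W) * (W * ?P) = 1\<^sub>m (Suc n)"
    using mat_mult_left_right_inverse[OF WP _ inv1] W(1) PT' by auto
  have "W * ?P * ?D * (?P\<^sup>T * W) = W * (?P * ?D * ?P\<^sup>T) * W"
    using W(1) P PT' D' by (simp add: assoc_mult_mat[of _ "Suc n" "Suc n" _ "Suc n" _ "Suc n"])
  then have "H = W * ?P * ?D * (W * ?P)\<^sup>T" using PDP H_eq WPT by simp
  moreover have "diagonal_mat ?D"
    using Q(2,3) unfolding diagonal_mat_def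
    by (auto simp: nth_Cons' less_Suc_eq_0_disj) metis
  ultimately show ?case
    using WP D' inv1 inv2 WPT by (intro exI[of _ "W * ?P"] exI[of _ ?D]) simp
qed

section \<open>Eigenvalue bounds from test subspaces\<close>

lemma sum_quadratic_diagonal:
  fixes M :: "nat \<Rightarrow> nat \<Rightarrow> real"
  assumes "\<And>i j. i < n \<Longrightarrow> j < n \<Longrightarrow> M i j = (\<Sum>l<n. d l * q l i * q l j)"
  shows "(\<Sum>i<n. \<Sum>j<n. M i j * f i * f j) = (\<Sum>l<n. d l * (\<Sum>i<n. q l i * f i)\<^sup>2)"
proof -
  have "(\<Sum>i<n. \<Sum>j<n. M i j * f i * f j) = (\<Sum>i<n. \<Sum>j<n. \<Sum>l<n. d l * ((q l i * f i) * (q l j * f j)))"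
    by (intro sum.cong refl) (auto simp: assms sum_distrib_right sum_distrib_left mult_ac intro!: sum.cong)
  also have "\<dots> = (\<Sum>i<n. \<Sum>l<n. \<Sum>j<n. d l * ((q l i * f i) * (q l j * f j)))"
    by (intro sum.cong refl sum.swap)
  also have "\<dots> = (\<Sum>l<n. \<Sum>i<n. \<Sum>j<n. d l * ((q l i * f i) * (q l j * f j)))"
    by (rule sum.swap)
  finally show ?thesis
    unfolding power2_eq_square sum_product by (simp only: sum_distrib_left)
qed

text \<open>The interface to matrices for the min-max argument: the roots \<open>d l\<close>, the
  form in the eigenbasis \<open>q l\<close>, and Parseval's identity.\<close>

lemma symmetric_mat_spectral_form:
  fixes H :: "real mat"
  assumes H: "H \<in> carrier_mat n n" and sym: "H\<^sup>T = H"
  obtains q :: "nat \<Rightarrow> nat \<Rightarrow> real" and d :: "nat \<Rightarrow> real"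
  where "proots (char_poly H) = mset (map d [0..<n])"
    "\<And>f. (\<Sum>i<n. \<Sum>j<n. H $$ (i, j) * f i * f j) = (\<Sum>l<n. d l * (\<Sum>i<n. q l i * f i)\<^sup>2)"
    "\<And>f. (\<Sum>i<n. (f i)\<^sup>2) = (\<Sum>l<n. (\<Sum>i<n. q l i * f i)\<^sup>2)"
proof -
  obtain Q D where Q: "Q \<in> carrier_mat n n" and D: "D \<in> carrier_mat n n" and diag: "diagonal_mat D"
    and QQ: "Q\<^sup>T * Q = 1\<^sub>m n" "Q * Q\<^sup>T = 1\<^sub>m n" and HQ: "H = Q * D * Q\<^sup>T"
    using symmetric_mat_diagonalization[OF assms] by blast
  let ?d = "\<lambda>l. D $$ (l, l)" and ?q = "\<lambda>l i. Q $$ (i, l)"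
  have one: "of_bool (i = j) = (\<Sum>l<n. 1 * ?q l i * ?q l j)" if "i < n" "j < n" for i j
  proof -
    have "(Q * Q\<^sup>T) $$ (i, j) = (\<Sum>l<n. Q $$ (i, l) * Q $$ (j, l))"
      using that Q by (simp add: scalar_prod_def atLeast0LessThan)
    then show ?thesis unfolding QQ using that by auto
  qed
  have QD: "(Q * D) $$ (i, l) = ?d l * Q $$ (i, l)" if "i < n" "l < n" for i l
  proof -
    have "(Q * D) $$ (i, l) = (\<Sum>m<n. Q $$ (i, m) * D $$ (m, l))"
      using that Q D by (simp add: scalar_prod_def atLeast0LessThan)
    also have "\<dots> = (\<Sum>m<n. if m = l then ?d l * Q $$ (i, l) else 0)"
      using diag D that by (intro sum.cong) (auto simp: diagonal_mat_def)
    finally show ?thesis using that by simp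
  qed
  have Hij: "H $$ (i, j) = (\<Sum>l<n. ?d l * ?q l i * ?q l j)" if "i < n" "j < n" for i j
  proof -
    define E where "E = Q * D"
    have E: "E \<in> carrier_mat n n" using Q D by (simp add: E_def)
    have "H $$ (i, j) = (\<Sum>l<n. E $$ (i, l) * Q $$ (j, l))"
      unfolding HQ E_def[symmetric] using that Q E by (simp add: scalar_prod_def atLeast0LessThan)
    then show ?thesis using that by (simp add: E_def QD)
  qed
  have "similar_mat H D"
    unfolding similar_mat_def similar_mat_wit_def Let_def using H Q D QQ HQ
    by (intro exI[of _ Q] exI[of _ "Q\<^sup>T"]) (simp del: assoc_mult_mat)
  then have "char_poly H = (\<Prod>a\<leftarrow>diag_mat D. [:- a, 1:])"
    using char_poly_similar[of H D] char_poly_upper_triangular[OF D] diag D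
    unfolding diagonal_mat_def upper_triangular_def by auto
  also have "diag_mat D = map ?d [0..<n]" using D by (simp add: diag_mat_def)
  finally have "char_poly H = prod_list (map (\<lambda>l. [:- ?d l, 1:]) [0..<n])" by (simp add: o_def)
  moreover have "proots (prod_list ps) = sum_list (map proots ps)" if "0 \<notin> set ps" for ps :: "real poly list"
    using proots_prod_list[OF that] by simp
  ultimately have "proots (char_poly H) = sum_list (map proots (map (\<lambda>l. [:- ?d l, 1:]) [0..<n]))"
    by (simp add: image_iff)
  also have "\<dots> = mset (map ?d [0..<n])"
    by (simp add: o_def)
  finally have roots: "proots (char_poly H) = mset (map ?d [0..<n])" .
  have form1: "(\<Sum>i<n. (f i)\<^sup>2) = (\<Sum>l<n. (\<Sum>i<n. ?q l i * f i)\<^sup>2)" for f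
  proof -
    have "(\<Sum>i<n. (f i)\<^sup>2) = (\<Sum>i<n. \<Sum>j<n. if j = i then f i * f i else 0)"
      by (simp add: power2_eq_square)
    also have "\<dots> = (\<Sum>i<n. \<Sum>j<n. of_bool (i = j) * f i * f j)"
      by (intro sum.cong refl) auto
    finally show ?thesis using sum_quadratic_diagonal[OF one, where f = f] by simp
  qed
  show thesis
    by (rule that[of ?d ?q, OF roots sum_quadratic_diagonal[OF Hij] form1])
qed

text \<open>Gaussian elimination by induction on the equations: an equation with a nonzero
  coefficient at \<open>y\<close> is solved for \<open>c y\<close>, and substitution leaves one
  unknown and one equation less.\<close>

lemma homogeneous_system_nontrivial:
  fixes a :: "'i \<Rightarrow> 'x \<Rightarrow> real"
  assumes "finite I" "finite X" "card I < card X"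
  shows "\<exists>c. (\<exists>x\<in>X. c x \<noteq> 0) \<and> (\<forall>i\<in>I. (\<Sum>x\<in>X. a i x * c x) = 0)"
  using assms
proof (induction I arbitrary: X a rule: finite_induct)
  case empty
  then obtain x where "x \<in> X" by fastforce
  then show ?case by (intro exI[of _ "\<lambda>_. 1"]) auto
next
  case (insert i I)
  show ?case
  proof (cases "\<forall>x\<in>X. a i x = 0")
    case True
    obtain c where "\<exists>x\<in>X. c x \<noteq> 0" "\<forall>i\<in>I. (\<Sum>x\<in>X. a i x * c x) = 0"
      using insert.IH[of X a] insert.prems insert.hyps by auto
    then show ?thesis using True by (intro exI[of _ c]) auto
  next
    case False
    then obtain y where y: "y \<in> X" "a i y \<noteq> 0" by blast
    let ?X = "X - {y}"
    have "card I < card ?X" using insert.prems insert.hyps y(1) by simp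
    from insert.IH[OF _ this, of "\<lambda>k x. a k x - a k y * a i x / a i y"] insert.prems
    obtain c where c: "\<exists>x\<in>?X. c x \<noteq> 0"
      "\<forall>k\<in>I. (\<Sum>x\<in>?X. (a k x - a k y * a i x / a i y) * c x) = 0" by auto
    define s where "s = (\<Sum>x\<in>?X. a i x * c x) / a i y"
    let ?c = "c(y := - s)"
    have split: "(\<Sum>x\<in>X. a k x * ?c x) = (\<Sum>x\<in>?X. a k x * c x) - a k y * s" for k
      using insert.prems(1) y(1) by (simp add: sum.remove[of X y])
    have "(\<Sum>x\<in>X. a k x * ?c x) = 0" if "k \<in> I" for k
    proof -
      have "(\<Sum>x\<in>?X. (a k x - a k y * a i x / a i y) * c x)
          = (\<Sum>x\<in>?X. a k x * c x) - a k y * s"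
        unfolding s_def sum_distrib_left sum_divide_distrib sum_subtractf[symmetric]
        by (intro sum.cong refl) (simp add: algebra_simps)
      then show ?thesis using c(2) that split by simp
    qed
    moreover have "(\<Sum>x\<in>X. a i x * ?c x) = 0"
      unfolding split using y(2) by (simp add: s_def)
    moreover have "\<exists>x\<in>X. ?c x \<noteq> 0" using c(1) by auto
    ultimately show ?thesis by (intro exI[of _ ?c]) blast
  qed
qed

text \<open>The dimension count behind min-max. If fewer \<open>d l\<close> reached \<open>t\<close>
  than there are vectors \<open>v x\<close>, some nontrivial combination would be orthogonal to
  every eigenvector with \<open>t <= d l\<close>, and on it the form stays strictly below
  \<open>t\<close> times the squared norm. The nonvanishing required in \<open>pos\<close> encodes
  linear independence.\<close>

lemma spectral_count:
  fixes q v :: "_ \<Rightarrow> nat \<Rightarrow> real" and d :: "nat \<Rightarrow> real"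
  assumes X: "finite X"
    and pos: "\<And>c. \<exists>x\<in>X. c x \<noteq> 0 \<Longrightarrow>
        (\<exists>i<n. (\<Sum>x\<in>X. c x * v x i) \<noteq> 0) \<and>
        t * (\<Sum>l<n. (\<Sum>i<n. q l i * (\<Sum>x\<in>X. c x * v x i))\<^sup>2)
          \<le> (\<Sum>l<n. d l * (\<Sum>i<n. q l i * (\<Sum>x\<in>X. c x * v x i))\<^sup>2)"
    and norm: "\<And>f. (\<Sum>i<n. (f i)\<^sup>2) = (\<Sum>l<n. (\<Sum>i<n. q l i * f i)\<^sup>2)"
  shows "card X \<le> card {l. l < n \<and> t \<le> d l}"
proof (rule ccontr)
  let ?I = "{l. l < n \<and> t \<le> d l}"
  assume "\<not> ?thesis"
  then obtain c where c: "\<exists>x\<in>X. c x \<noteq> 0"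
    "\<forall>l\<in>?I. (\<Sum>x\<in>X. (\<Sum>i<n. q l i * v x i) * c x) = 0"
    using homogeneous_system_nontrivial[of ?I X "\<lambda>l x. \<Sum>i<n. q l i * v x i"] X by auto
  define f where "f i = (\<Sum>x\<in>X. c x * v x i)" for i
  have z: "(\<Sum>i<n. q l i * f i) = 0" if "l < n" "t \<le> d l" for l
  proof -
    have "(\<Sum>i<n. q l i * f i) = (\<Sum>x\<in>X. \<Sum>i<n. q l i * (c x * v x i))"
      unfolding f_def sum_distrib_left by (rule sum.swap)
    also have "\<dots> = (\<Sum>x\<in>X. (\<Sum>i<n. q l i * v x i) * c x)"
      by (auto simp: sum_distrib_right sum_distrib_left mult_ac intro!: sum.cong)
    finally show ?thesis using c(2) that by simp
  qed
  have f0: "\<exists>i<n. f i \<noteq> 0" and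
    ge: "t * (\<Sum>l<n. (\<Sum>i<n. q l i * f i)\<^sup>2) \<le> (\<Sum>l<n. d l * (\<Sum>i<n. q l i * f i)\<^sup>2)"
    using pos[OF c(1)] unfolding f_def[symmetric] by auto
  have "(\<Sum>i<n. (f i)\<^sup>2) > 0" using f0 by (auto intro!: sum_pos2)
  then have "(\<Sum>l<n. (\<Sum>i<n. q l i * f i)\<^sup>2) \<noteq> 0" using norm by auto
  then obtain l0 where l0: "l0 < n" "(\<Sum>i<n. q l0 i * f i) \<noteq> 0"
    by (auto elim: sum.not_neutral_contains_not_neutral)
  have "(\<Sum>l<n. d l * (\<Sum>i<n. q l i * f i)\<^sup>2) < (\<Sum>l<n. t * (\<Sum>i<n. q l i * f i)\<^sup>2)"
  proof (rule sum_strict_mono_ex1)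
    show "\<forall>l\<in>{..<n}. d l * (\<Sum>i<n. q l i * f i)\<^sup>2 \<le> t * (\<Sum>i<n. q l i * f i)\<^sup>2"
    proof
      fix l assume "l \<in> {..<n}"
      then show "d l * (\<Sum>i<n. q l i * f i)\<^sup>2 \<le> t * (\<Sum>i<n. q l i * f i)\<^sup>2"
        using z[of l] by (cases "t \<le> d l") (auto intro!: mult_right_mono)
    qed
    show "\<exists>l\<in>{..<n}. d l * (\<Sum>i<n. q l i * f i)\<^sup>2 < t * (\<Sum>i<n. q l i * f i)\<^sup>2"
      using l0 z[of l0] by (intro bexI[of _ l0]) (auto simp: not_le[symmetric])
  qed auto
  then show False using ge by (simp add: sum_distrib_left)
qed

section \<open>Order statistics and counting\<close>

lemma length_filter_map_upt:
  "length (filter P (map g [0..<n])) = card {x. x < n \<and> P (g x)}"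
  unfolding length_filter_conv_card by (intro arg_cong[of _ _ card]) auto

lemma length_filter_sort: "length (filter P (sort xs)) = length (filter P xs)"
  by (metis mset_filter mset_sort size_mset)

lemma sorted_filter_ge_nth:
  assumes "sorted ys" "1 \<le> k" "k \<le> length (filter (\<lambda>y. t \<le> y) ys)"
  shows "t \<le> rev ys ! (k - 1)"
proof (rule ccontr)
  assume "\<not> ?thesis"
  moreover have k: "k \<le> length ys" using assms(3) length_filter_le le_trans by blast
  ultimately have lt: "ys ! (length ys - k) < t" using assms(2) by (simp add: rev_nth not_le)
  have "{i. i < length ys \<and> t \<le> ys ! i} \<subseteq> {length ys - k<..<length ys}"
  proof safe
    fix i assume "i < length ys" "t \<le> ys ! i"
    moreover have "length ys - k < length ys" using k assms(2) \<open>i < length ys\<close> by simp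
    ultimately have "\<not> i \<le> length ys - k"
      using lt assms(1,2) k sorted_nth_mono[of ys i "length ys - k"] \<open>t \<le> ys ! i\<close>
      by auto
    then show "i \<in> {length ys - k<..<length ys}" using \<open>i < length ys\<close> by auto
  qed
  then have "card {i. i < length ys \<and> t \<le> ys ! i} \<le> k - 1"
    using card_mono[of "{length ys - k<..<length ys}"] k assms(2) by fastforce
  then show False using assms(2,3) by (simp add: length_filter_conv_card)
qed

lemma sorted_filter_le_nth:
  assumes "sorted ys" "1 \<le> k" "k \<le> length (filter (\<lambda>y. y \<le> t) ys)"
  shows "ys ! (k - 1) \<le> t"
proof (rule ccontr)
  assume "\<not> ?thesis"
  then have lt: "t < ys ! (k - 1)" by simp
  have "{i. i < length ys \<and> ys ! i \<le> t} \<subseteq> {..<k - 1}"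
  proof
    fix i assume i: "i \<in> {i. i < length ys \<and> ys ! i \<le> t}"
    then have "\<not> k - 1 \<le> i" using lt sorted_nth_mono[OF assms(1), of "k - 1" i] by auto
    then show "i \<in> {..<k - 1}" by simp
  qed
  then have "card {i. i < length ys \<and> ys ! i \<le> t} \<le> k - 1"
    using card_mono[of "{..<k - 1}"] by fastforce
  then show False using assms(2,3) by (simp add: length_filter_conv_card)
qed

lemma eigenvalue_nth_ge:
  fixes H :: "real mat" and v :: "'x \<Rightarrow> nat \<Rightarrow> real"
  assumes H: "H \<in> carrier_mat n n" "H\<^sup>T = H" and X: "finite X" "1 \<le> k" "k \<le> card X"
    and pos: "\<And>c f. \<exists>x\<in>X. c x \<noteq> 0 \<Longrightarrow> f = (\<lambda>i. \<Sum>x\<in>X. c x * v x i) \<Longrightarrow>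
        (\<exists>i<n. f i \<noteq> 0) \<and> t * (\<Sum>i<n. (f i)\<^sup>2) \<le> (\<Sum>i<n. \<Sum>j<n. H $$ (i, j) * f i * f j)"
  shows "t \<le> eigenvalue_nth H k"
proof -
  obtain q d where d: "proots (char_poly H) = mset (map d [0..<n])"
    and form: "\<And>f. (\<Sum>i<n. \<Sum>j<n. H $$ (i, j) * f i * f j) = (\<Sum>l<n. d l * (\<Sum>i<n. q l i * f i)\<^sup>2)"
    and norm: "\<And>f. (\<Sum>i<n. (f i)\<^sup>2) = (\<Sum>l<n. (\<Sum>i<n. q l i * f i)\<^sup>2)"
    by (rule symmetric_mat_spectral_form[OF H]) (rule that)
  have "card X \<le> card {l. l < n \<and> t \<le> d l}"
  proof (rule spectral_count[where v = v and q = q, OF X(1) _ norm])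
    fix c :: "'x \<Rightarrow> real" assume "\<exists>x\<in>X. c x \<noteq> 0"
    from pos[OF this refl] show "(\<exists>i<n. (\<Sum>x\<in>X. c x * v x i) \<noteq> 0) \<and>
        t * (\<Sum>l<n. (\<Sum>i<n. q l i * (\<Sum>x\<in>X. c x * v x i))\<^sup>2)
          \<le> (\<Sum>l<n. d l * (\<Sum>i<n. q l i * (\<Sum>x\<in>X. c x * v x i))\<^sup>2)"
      by (simp only: norm[symmetric] form[symmetric])
  qed
  then have "t \<le> rev (sort (map d [0..<n])) ! (k - 1)"
    using X sorted_filter_ge_nth[of "sort (map d [0..<n])" k t, unfolded length_filter_sort length_filter_map_upt]
    by simp
  then show ?thesis unfolding eigenvalue_nth_def d sorted_list_of_multiset_mset .
qed

text \<open>\<open>spectral_count\<close> for the negated form. The k-th root from below is number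
  \<open>n + 1 - k\<close> from above; translating the index with \<open>rev_nth\<close> is where
  \<open>k <= n\<close> enters.\<close>

lemma eigenvalue_nth_le:
  fixes H :: "real mat" and v :: "'x \<Rightarrow> nat \<Rightarrow> real"
  assumes H: "H \<in> carrier_mat n n" "H\<^sup>T = H" and X: "finite X" "1 \<le> k" "k \<le> card X"
    and neg: "\<And>c f. \<exists>x\<in>X. c x \<noteq> 0 \<Longrightarrow> f = (\<lambda>i. \<Sum>x\<in>X. c x * v x i) \<Longrightarrow>
        (\<exists>i<n. f i \<noteq> 0) \<and> (\<Sum>i<n. \<Sum>j<n. H $$ (i, j) * f i * f j) \<le> t * (\<Sum>i<n. (f i)\<^sup>2)"
  shows "eigenvalue_nth H (n + 1 - k) \<le> t"
proof -
  obtain q d where d: "proots (char_poly H) = mset (map d [0..<n])"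
    and form: "\<And>f. (\<Sum>i<n. \<Sum>j<n. H $$ (i, j) * f i * f j) = (\<Sum>l<n. d l * (\<Sum>i<n. q l i * f i)\<^sup>2)"
    and norm: "\<And>f. (\<Sum>i<n. (f i)\<^sup>2) = (\<Sum>l<n. (\<Sum>i<n. q l i * f i)\<^sup>2)"
    by (rule symmetric_mat_spectral_form[OF H]) (rule that)
  have "card X \<le> card {l. l < n \<and> - t \<le> - d l}"
  proof (rule spectral_count[where v = v and q = q and d = "\<lambda>l. - d l", OF X(1) _ norm])
    fix c :: "'x \<Rightarrow> real" assume "\<exists>x\<in>X. c x \<noteq> 0"
    from neg[OF this refl] show "(\<exists>i<n. (\<Sum>x\<in>X. c x * v x i) \<noteq> 0) \<and>
        - t * (\<Sum>l<n. (\<Sum>i<n. q l i * (\<Sum>x\<in>X. c x * v x i))\<^sup>2)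
          \<le> (\<Sum>l<n. - d l * (\<Sum>i<n. q l i * (\<Sum>x\<in>X. c x * v x i))\<^sup>2)"
      by (simp only: norm[symmetric] form[symmetric] minus_mult_left[symmetric] sum_negf neg_le_iff_le)
  qed
  then have cX: "card X \<le> card {l. l < n \<and> d l \<le> t}" by simp
  also have "\<dots> \<le> card {..<n}" by (intro card_mono) auto
  finally have "k \<le> n" using X by simp
  moreover have "sort (map d [0..<n]) ! (k - 1) \<le> t"
    using X cX sorted_filter_le_nth[of "sort (map d [0..<n])" k t, unfolded length_filter_sort length_filter_map_upt]
    by simp
  ultimately show ?thesis
    unfolding eigenvalue_nth_def d sorted_list_of_multiset_mset using X(2) by (simp add: rev_nth)
qed

text \<open>The k-th entry satisfies both inequalities, so the two counts add up to at least n + 1.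
  This overlap gives both test spaces for the k-th eigenvalue exactly the dimension that min-max
  asks for.\<close>

lemma ordered_nth_count:
  fixes g :: "nat \<Rightarrow> real"
  assumes "1 \<le> k" "k \<le> n" and t: "t = rev (sort (map g [0..<n])) ! (k - 1)"
  shows "k \<le> card {x. x < n \<and> t \<le> g x}" "n + 1 - k \<le> card {x. x < n \<and> g x \<le> t}"
proof -
  let ?ys = "sort (map g [0..<n])"
  have t': "t = ?ys ! (n - k)" using assms by (simp add: rev_nth)
  have "{n - k..<n} \<subseteq> {i. i < n \<and> t \<le> ?ys ! i}"
    unfolding t' using assms(1,2) by (auto intro!: sorted_nth_mono)
  then have "k \<le> card {i. i < n \<and> t \<le> ?ys ! i}"
    using card_mono[of "{i. i < n \<and> t \<le> ?ys ! i}" "{n - k..<n}"] assms by auto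
  also have "\<dots> = length (filter (\<lambda>y. t \<le> y) ?ys)" by (simp add: length_filter_conv_card)
  finally show "k \<le> card {x. x < n \<and> t \<le> g x}"
    by (simp only: length_filter_sort length_filter_map_upt)
  have "{..n - k} \<subseteq> {i. i < n \<and> ?ys ! i \<le> t}"
    unfolding t' using assms(1,2) by (auto intro!: sorted_nth_mono)
  then have "n + 1 - k \<le> card {i. i < n \<and> ?ys ! i \<le> t}"
    using card_mono[of "{i. i < n \<and> ?ys ! i \<le> t}" "{..n - k}"] assms by auto
  also have "\<dots> = length (filter (\<lambda>y. y \<le> t) ?ys)" by (simp add: length_filter_conv_card)
  finally show "n + 1 - k \<le> card {x. x < n \<and> g x \<le> t}"
    by (simp only: length_filter_sort length_filter_map_upt)
qed

section \<open>Random graphs: exponential moments and light pairs\<close>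

definition edge_prob :: "(nat \<Rightarrow> nat \<Rightarrow> real) \<Rightarrow> nat set \<Rightarrow> real" where
  "edge_prob p e = p (Min e) (Max e)"

lemma finite_edges [simp]: "finite (edges n)"
  by (rule finite_subset[of _ "Pow {..<n}"]) (auto simp: edges_def)

lemma mem_edges [simp]: "i < n \<Longrightarrow> j < n \<Longrightarrow> {i, j} \<in> edges n"
  by (auto simp: edges_def)

lemma edge_prob_insert:
  assumes "edge_probabilities n p" "i < n" "j < n"
  shows "edge_prob p {i, j} = p i j"
proof -
  have "p j i = p i j" using assms unfolding edge_probabilities_def by blast
  then show ?thesis by (cases "i \<le> j") (simp_all add: edge_prob_def min_def max_def)
qed

lemma edge_prob_bounds:
  assumes "edge_probabilities n p" "e \<in> edges n"
  shows "0 \<le> edge_prob p e" "edge_prob p e \<le> 1"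
proof -
  obtain i j where e: "e = {i, j}" "i < n" "j < n" using assms(2) by (auto simp: edges_def)
  have "0 \<le> p i j \<and> p i j \<le> 1" using assms(1) e unfolding edge_probabilities_def by blast
  then show "0 \<le> edge_prob p e" "edge_prob p e \<le> 1"
    using edge_prob_insert[OF assms(1) e(2,3)] e(1) by simp_all
qed

lemma finite_set_pmf_bernoulli: "finite (set_pmf (bernoulli_pmf r))"
  by (rule finite_subset[of _ UNIV]) auto

lemma finite_set_pmf_random_graph: "finite (set_pmf (random_graph n p))"
  unfolding random_graph_def
  by (subst set_Pi_pmf) (auto intro!: finite_PiE_dflt finite_set_pmf_bernoulli)

lemma prob_random_graph_le_expectation:
  assumes "\<And>G. 0 \<le> f G" "\<And>G. G \<in> S \<Longrightarrow> 1 \<le> f G"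
  shows "measure_pmf.prob (random_graph n p) S \<le> measure_pmf.expectation (random_graph n p) f"
proof -
  have "measure_pmf.prob (random_graph n p) S = measure_pmf.expectation (random_graph n p) (indicator S)"
    by simp
  also have "\<dots> \<le> measure_pmf.expectation (random_graph n p) f"
  proof (rule integral_mono)
    show "indicator S G \<le> f G" for G using assms by (simp add: indicator_def)
  qed (rule integrable_measure_pmf_finite, rule finite_set_pmf_random_graph)+
  finally show ?thesis .
qed

text \<open>The common source of the tail bounds. By independence the expectation is a product over
  edges: edges in \<open>F\<close> are forced to be present, and each other factor
  \<open>1 + x\<close> is at most \<open>exp x\<close>. With empty \<open>F\<close> this is the
  usual exponential moment; nonempty \<open>F\<close> serves the union bounds over
  configurations.\<close>

lemma expectation_random_graph_exp:
  assumes p: "edge_probabilities n p" and F: "F \<subseteq> edges n"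
  shows "measure_pmf.expectation (random_graph n p)
      (\<lambda>G. of_bool (\<forall>e\<in>F. G e) * exp (\<Sum>e\<in>edges n. c e * of_bool (G e)))
    \<le> (\<Prod>e\<in>F. edge_prob p e * exp (c e)) * exp (\<Sum>e\<in>edges n - F. edge_prob p e * (exp (c e) - 1))"
proof -
  define f where "f e b = (if e \<in> F then of_bool b else 1) * exp (c e * of_bool b)" for e and b :: bool
  have F': "finite F" using F by (rule finite_subset) simp
  have split: "of_bool (\<forall>e\<in>F. G e) * exp (\<Sum>e\<in>edges n. c e * of_bool (G e)) = (\<Prod>e\<in>edges n. f e (G e))" for G
  proof -
    have "(\<Prod>e\<in>edges n. if e \<in> F then of_bool (G e) else 1 :: real) = (\<Prod>e\<in>F. of_bool (G e))"
      using F by (simp add: prod.If_cases Int_absorb1)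
    also have "\<dots> = of_bool (\<forall>e\<in>F. G e)"
      using F' by (induction F rule: finite_induct) auto
    finally show ?thesis
      unfolding f_def prod.distrib exp_sum[OF finite_edges] by (rule arg_cong[OF sym])
  qed
  have "measure_pmf.expectation (random_graph n p)
      (\<lambda>G. of_bool (\<forall>e\<in>F. G e) * exp (\<Sum>e\<in>edges n. c e * of_bool (G e)))
    = (\<Prod>e\<in>edges n. measure_pmf.expectation (bernoulli_pmf (edge_prob p e)) (f e))"
    unfolding split random_graph_def edge_prob_def
    by (rule expectation_prod_Pi_pmf)
      (auto simp: f_def intro!: integrable_measure_pmf_finite finite_set_pmf_bernoulli)
  also have "\<dots> = (\<Prod>e\<in>edges n. f e True * edge_prob p e + f e False * (1 - edge_prob p e))"
    using edge_prob_bounds[OF p] by (intro prod.cong refl) simp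
  also have "\<dots> = (\<Prod>e\<in>F. edge_prob p e * exp (c e)) * (\<Prod>e\<in>edges n - F. 1 + edge_prob p e * (exp (c e) - 1))"
  proof -
    have "(\<Prod>e\<in>edges n. f e True * edge_prob p e + f e False * (1 - edge_prob p e))
      = (\<Prod>e\<in>edges n - F. f e True * edge_prob p e + f e False * (1 - edge_prob p e)) *
        (\<Prod>e\<in>F. f e True * edge_prob p e + f e False * (1 - edge_prob p e))"
      by (rule prod.subset_diff[OF F]) simp
    moreover have "(\<Prod>e\<in>edges n - F. f e True * edge_prob p e + f e False * (1 - edge_prob p e))
      = (\<Prod>e\<in>edges n - F. 1 + edge_prob p e * (exp (c e) - 1))"
      by (intro prod.cong refl) (simp add: f_def algebra_simps)
    moreover have "(\<Prod>e\<in>F. f e True * edge_prob p e + f e False * (1 - edge_prob p e))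
      = (\<Prod>e\<in>F. edge_prob p e * exp (c e))"
      by (intro prod.cong refl) (simp add: f_def)
    ultimately show ?thesis by simp
  qed
  also have "\<dots> \<le> (\<Prod>e\<in>F. edge_prob p e * exp (c e)) * exp (\<Sum>e\<in>edges n - F. edge_prob p e * (exp (c e) - 1))"
  proof (intro mult_left_mono)
    have "0 \<le> 1 + edge_prob p e * (exp (c e) - 1)" if "e \<in> edges n" for e
    proof -
      have "0 \<le> edge_prob p e * exp (c e)" using edge_prob_bounds[OF p that] by simp
      then show ?thesis using edge_prob_bounds[OF p that] unfolding right_diff_distrib mult_1_right by linarith
    qed
    then have "(\<Prod>e\<in>edges n - F. 1 + edge_prob p e * (exp (c e) - 1))
        \<le> (\<Prod>e\<in>edges n - F. exp (edge_prob p e * (exp (c e) - 1)))"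
      by (intro prod_mono) (auto intro: exp_ge_add_one_self)
    then show "(\<Prod>e\<in>edges n - F. 1 + edge_prob p e * (exp (c e) - 1))
        \<le> exp (\<Sum>e\<in>edges n - F. edge_prob p e * (exp (c e) - 1))"
      by (simp add: exp_sum)
    show "0 \<le> (\<Prod>e\<in>F. edge_prob p e * exp (c e))"
      using F edge_prob_bounds[OF p] by (intro prod_nonneg) auto
  qed
  finally show ?thesis .
qed

text \<open>Chernoff's bound while some edges are forced. \<open>F\<close> and \<open>E\<close> may
  overlap, so a forced edge may also help to reach the count; the factor \<open>exp lam\<close> per
  forced edge pays for that.\<close>

lemma prob_edges_present_and_count:
  assumes p: "edge_probabilities n p" and F: "F \<subseteq> edges n" and E: "E \<subseteq> edges n" and lam: "0 \<le> lam"
  shows "measure_pmf.prob (random_graph n p) {G. (\<forall>e\<in>F. G e) \<and> t \<le> real (card {e \<in> E. G e})}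
    \<le> (\<Prod>e\<in>F. edge_prob p e * exp lam) * exp (exp lam * (\<Sum>e\<in>E. edge_prob p e) - lam * t)"
proof -
  let ?c = "\<lambda>e. lam * of_bool (e \<in> E)"
  let ?f = "\<lambda>G. of_bool (\<forall>e\<in>F. G e) * exp (\<Sum>e\<in>edges n. ?c e * of_bool (G e))"
  have fin: "finite E" "finite F" using finite_subset[OF E] finite_subset[OF F] by simp_all
  have cnt: "(\<Sum>e\<in>edges n. ?c e * of_bool (G e)) = lam * card {e \<in> E. G e}" for G
  proof -
    have "(\<Sum>e\<in>edges n. ?c e * of_bool (G e)) = (\<Sum>e\<in>{e \<in> E. G e}. lam)"
      using E by (intro sum.mono_neutral_cong_right) auto
    then show ?thesis by simp
  qed
  have "measure_pmf.prob (random_graph n p) {G. (\<forall>e\<in>F. G e) \<and> t \<le> real (card {e \<in> E. G e})}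
      \<le> measure_pmf.expectation (random_graph n p) (\<lambda>G. ?f G * exp (- (lam * t)))"
  proof (rule prob_random_graph_le_expectation)
    fix G assume G: "G \<in> {G. (\<forall>e\<in>F. G e) \<and> t \<le> real (card {e \<in> E. G e})}"
    then have "lam * t \<le> lam * real (card {e \<in> E. G e})" using lam by (intro mult_left_mono) auto
    then have "1 \<le> exp (lam * real (card {e \<in> E. G e})) * exp (- (lam * t))"
      by (simp add: exp_add[symmetric] del: exp_minus)
    then show "1 \<le> ?f G * exp (- (lam * t))" unfolding cnt using G by simp
  qed simp
  also have "\<dots> = measure_pmf.expectation (random_graph n p) ?f * exp (- (lam * t))" by simp
  also have "\<dots> \<le> ((\<Prod>e\<in>F. edge_prob p e * exp (?c e)) *
      exp (\<Sum>e\<in>edges n - F. edge_prob p e * (exp (?c e) - 1))) * exp (- (lam * t))"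
    by (intro mult_right_mono expectation_random_graph_exp[OF p F]) auto
  also have "\<dots> \<le> ((\<Prod>e\<in>F. edge_prob p e * exp lam) * exp (exp lam * (\<Sum>e\<in>E. edge_prob p e))) * exp (- (lam * t))"
  proof (intro mult_right_mono mult_mono)
    show "(\<Prod>e\<in>F. edge_prob p e * exp (?c e)) \<le> (\<Prod>e\<in>F. edge_prob p e * exp lam)"
      using F lam edge_prob_bounds[OF p] by (intro prod_mono conjI mult_left_mono) auto
    have "(\<Sum>e\<in>edges n - F. edge_prob p e * (exp (?c e) - 1)) \<le> (\<Sum>e\<in>edges n. edge_prob p e * (exp (?c e) - 1))"
      using lam edge_prob_bounds[OF p] by (intro sum_mono2) auto
    also have "\<dots> \<le> (\<Sum>e\<in>edges n. edge_prob p e * (of_bool (e \<in> E) * exp lam))"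
      using lam edge_prob_bounds[OF p] by (intro sum_mono mult_left_mono) auto
    also have "\<dots> = (\<Sum>e\<in>E. edge_prob p e * exp lam)"
      using E by (intro sum.mono_neutral_cong_right) auto
    finally show "exp (\<Sum>e\<in>edges n - F. edge_prob p e * (exp (?c e) - 1)) \<le> exp (exp lam * (\<Sum>e\<in>E. edge_prob p e))"
      by (simp add: sum_distrib_left mult.commute)
    show "0 \<le> (\<Prod>e\<in>F. edge_prob p e * exp lam)"
      using F edge_prob_bounds[OF p] by (intro prod_nonneg) auto
  qed auto
  finally show ?thesis by (simp only: diff_conv_add_uminus exp_add mult.assoc)
qed

lemma exp_le_quadratic:
  fixes x :: real assumes "\<bar>x\<bar> \<le> 1" shows "exp x \<le> 1 + x + x\<^sup>2"
proof (cases "0 \<le> x")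
  case True then show ?thesis using exp_bound assms by auto
next
  case False
  have "1 - x \<le> exp (- x)" using exp_ge_add_one_self[of "- x"] by simp
  moreover have "1 \<le> (1 - x) * (1 + x + x\<^sup>2)"
  proof -
    have "(1 - x) * (1 + x + x\<^sup>2) = 1 - x * x\<^sup>2" by (simp add: algebra_simps power2_eq_square)
    moreover have "x * x\<^sup>2 \<le> 0" using False by (simp add: mult_nonpos_nonneg)
    ultimately show ?thesis by simp
  qed
  moreover have "0 < 1 + x + x\<^sup>2" using assms False zero_less_power2[of x] by linarith
  ultimately have "1 \<le> exp (- x) * (1 + x + x\<^sup>2)"
    using mult_right_mono[of "1 - x" "exp (- x)" "1 + x + x\<^sup>2"] by linarith
  then show ?thesis by (simp add: exp_minus field_simps)
qed

text \<open>Chernoff's bound at the fixed parameter 1; scaling is left to the caller, through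
  \<open>c\<close>. The bound on \<open>c\<close> is the range of
  \<open>exp_le_quadratic\<close>.\<close>

lemma prob_centered_edge_sum:
  assumes p: "edge_probabilities n p" and c: "\<And>e. e \<in> edges n \<Longrightarrow> \<bar>c e\<bar> \<le> 1"
  shows "measure_pmf.prob (random_graph n p)
      {G. t \<le> (\<Sum>e\<in>edges n. c e * (of_bool (G e) - edge_prob p e))}
    \<le> exp ((\<Sum>e\<in>edges n. edge_prob p e * (c e)\<^sup>2) - t)"
proof -
  let ?m = "\<Sum>e\<in>edges n. c e * edge_prob p e"
  let ?f = "\<lambda>G. of_bool (\<forall>e\<in>{}. G e) * exp (\<Sum>e\<in>edges n. c e * of_bool (G e))"
  have "measure_pmf.prob (random_graph n p)
      {G. t \<le> (\<Sum>e\<in>edges n. c e * (of_bool (G e) - edge_prob p e))}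
     \<le> measure_pmf.expectation (random_graph n p) (\<lambda>G. ?f G * exp (- (t + ?m)))"
    by (intro prob_random_graph_le_expectation)
      (auto simp: right_diff_distrib sum_subtractf exp_add[symmetric] simp del: exp_minus)
  also have "\<dots> = measure_pmf.expectation (random_graph n p) ?f * exp (- (t + ?m))" by simp
  also have "\<dots> \<le> exp (\<Sum>e\<in>edges n. edge_prob p e * (exp (c e) - 1)) * exp (- (t + ?m))"
    using expectation_random_graph_exp[OF p, of "{}" c] by (intro mult_right_mono) auto
  also have "\<dots> = exp ((\<Sum>e\<in>edges n. edge_prob p e * (exp (c e) - 1 - c e)) - t)"
    unfolding exp_add[symmetric] by (simp add: algebra_simps sum_subtractf sum.distrib)
  also have "\<dots> \<le> exp ((\<Sum>e\<in>edges n. edge_prob p e * (c e)\<^sup>2) - t)"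
  proof -
    have "edge_prob p e * (exp (c e) - 1 - c e) \<le> edge_prob p e * (c e)\<^sup>2" if "e \<in> edges n" for e
      using exp_le_quadratic[OF c[OF that]] edge_prob_bounds[OF p that] by (intro mult_left_mono) auto
    then show ?thesis by (simp add: sum_mono)
  qed
  finally show ?thesis .
qed

text \<open>Bilinear forms sum over ordered pairs, whereas the independent variables are unordered
  edges. The fiber collects the ordered pairs above an edge: one for a loop, two otherwise.\<close>

definition edge_fiber :: "nat \<Rightarrow> nat set \<Rightarrow> (nat \<times> nat) set" where
  "edge_fiber n e = {x \<in> {..<n} \<times> {..<n}. {fst x, snd x} = e}"

lemma card_edge_fiber: "card (edge_fiber n e) \<le> 2"
proof (cases "edge_fiber n e = {}")
  case False
  then obtain i j where e: "e = {i, j}" by (auto simp: edge_fiber_def)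
  have "edge_fiber n e \<subseteq> {(i, j), (j, i)}"
    unfolding e edge_fiber_def by (auto simp: doubleton_eq_iff)
  from card_mono[OF _ this] have "card (edge_fiber n e) \<le> card {(i, j), (j, i)}" by simp
  also have "\<dots> \<le> Suc (card {(j, i)})" by (rule card_insert_le_m1) simp_all
  finally show ?thesis by simp
qed simp

lemma finite_edge_fiber [simp]: "finite (edge_fiber n e)"
  unfolding edge_fiber_def by (rule finite_subset[of _ "{..<n} \<times> {..<n}"]) auto

lemma sum_over_edge_fibers:
  fixes h :: "nat \<Rightarrow> nat \<Rightarrow> real"
  shows "(\<Sum>i<n. \<Sum>j<n. h i j * g {i, j}) = (\<Sum>e\<in>edges n. (\<Sum>(i, j)\<in>edge_fiber n e. h i j) * g e)"
proof -
  have "(\<Sum>e\<in>edges n. (\<Sum>(i, j)\<in>edge_fiber n e. h i j) * g e)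
      = (\<Sum>e\<in>edges n. \<Sum>x\<in>edge_fiber n e. h (fst x) (snd x) * g {fst x, snd x})"
    unfolding sum_distrib_right split_def
    by (intro sum.cong refl) (auto simp: edge_fiber_def)
  also have "\<dots> = (\<Sum>x\<in>{..<n} \<times> {..<n}. h (fst x) (snd x) * g {fst x, snd x})"
    unfolding edge_fiber_def by (rule sum.group) auto
  also have "\<dots> = (\<Sum>i<n. \<Sum>j<n. h i j * g {i, j})" by (simp add: sum.cartesian_product split_def)
  finally show ?thesis by simp
qed

lemma sum_edge_fiber_square:
  fixes h :: "nat \<Rightarrow> nat \<Rightarrow> real"
  shows "(\<Sum>(i, j)\<in>edge_fiber n e. h i j)\<^sup>2 \<le> 2 * (\<Sum>(i, j)\<in>edge_fiber n e. (h i j)\<^sup>2)"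
proof -
  have "(\<Sum>x\<in>edge_fiber n e. h (fst x) (snd x) * 1)\<^sup>2
      \<le> (\<Sum>x\<in>edge_fiber n e. (h (fst x) (snd x))\<^sup>2) * (\<Sum>x\<in>edge_fiber n e. 1\<^sup>2)"
    by (rule Cauchy_Schwarz_ineq_sum)
  also have "\<dots> \<le> (\<Sum>x\<in>edge_fiber n e. (h (fst x) (snd x))\<^sup>2) * 2"
  proof (rule mult_left_mono)
    show "(\<Sum>x\<in>edge_fiber n e. 1\<^sup>2) \<le> (2 :: real)" using card_edge_fiber[of n e] by simp
  qed (simp add: sum_nonneg)
  finally show ?thesis unfolding split_def mult_1_right by linarith
qed

text \<open>The diagonal is excluded here and in all forms below because \<open>p_max\<close> says
  nothing about loops. Loops come back in \<open>centered_form_near_star_form\<close>, at the cost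
  of one squared norm.\<close>

definition light_sum :: "nat \<Rightarrow> (nat \<Rightarrow> nat \<Rightarrow> real) \<Rightarrow> real \<Rightarrow> (nat set \<Rightarrow> bool) \<Rightarrow> (nat \<Rightarrow> real) \<Rightarrow> (nat \<Rightarrow> real) \<Rightarrow> real" where
  "light_sum n p s G x y = (\<Sum>i<n. \<Sum>j<n.
     of_bool (i \<noteq> j \<and> \<bar>x i * y j\<bar> \<le> s) * (x i * y j) * (of_bool (G {i, j}) - p i j))"

text \<open>Dividing by \<open>2 * s\<close> makes the coefficient of every edge at most 1, since a
  fiber has at most two light entries. The variance is then at most (5 n) (5 n) / (2 n) = 12.5 n,
  whence the 13.\<close>

lemma prob_light_sum_ge:
  assumes p: "edge_probabilities n p" and s: "s > 0"
    and ps: "\<And>i j. i < n \<Longrightarrow> j < n \<Longrightarrow> i \<noteq> j \<Longrightarrow> p i j \<le> s\<^sup>2 / n"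
    and x: "(\<Sum>i<n. (x i)\<^sup>2) \<le> 5 * real n" and y: "(\<Sum>i<n. (y i)\<^sup>2) \<le> 5 * real n" and n: "n > 0"
  shows "measure_pmf.prob (random_graph n p) {G. 2 * s * t \<le> light_sum n p s G x y} \<le> exp (13 * real n - t)"
proof -
  define h where "h i j = of_bool (i \<noteq> j \<and> \<bar>x i * y j\<bar> \<le> s) * (x i * y j) / (2 * s)" for i j
  define c where "c e = (\<Sum>(i, j)\<in>edge_fiber n e. h i j)" for e
  have h1: "\<bar>h i j\<bar> \<le> 1 / 2" for i j using s by (auto simp: h_def field_simps)
  have c1: "\<bar>c e\<bar> \<le> 1" for e
  proof -
    have "\<bar>c e\<bar> \<le> (\<Sum>x\<in>edge_fiber n e. 1 / 2)"
      unfolding c_def split_def by (rule order_trans[OF sum_abs sum_mono]) (rule h1)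
    also have "\<dots> \<le> 1" using card_edge_fiber[of n e] by simp
    finally show ?thesis .
  qed
  have eq: "light_sum n p s G x y = 2 * s * (\<Sum>e\<in>edges n. c e * (of_bool (G e) - edge_prob p e))" for G
  proof -
    have "(\<Sum>i<n. \<Sum>j<n. h i j * (of_bool (G {i, j}) - edge_prob p {i, j})) = light_sum n p s G x y / (2 * s)"
      unfolding light_sum_def sum_divide_distrib
      by (intro sum.cong refl) (simp add: h_def edge_prob_insert[OF p])
    then show ?thesis using s by (simp add: sum_over_edge_fibers[of h "\<lambda>e. of_bool (G e) - edge_prob p e" n] c_def)
  qed
  have "(\<Sum>e\<in>edges n. edge_prob p e * (c e)\<^sup>2)
      \<le> (\<Sum>e\<in>edges n. edge_prob p e * (2 * (\<Sum>(i, j)\<in>edge_fiber n e. (h i j)\<^sup>2)))"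
    unfolding c_def by (intro sum_mono mult_left_mono sum_edge_fiber_square edge_prob_bounds[OF p])
  also have "\<dots> = 2 * (\<Sum>i<n. \<Sum>j<n. (h i j)\<^sup>2 * edge_prob p {i, j})"
    unfolding sum_over_edge_fibers[where h = "\<lambda>i j. (h i j)\<^sup>2" and g = "edge_prob p"]
    by (simp only: sum_distrib_left[of 2 _ "edges n"] mult_ac)
  also have "\<dots> \<le> 2 * (\<Sum>i<n. \<Sum>j<n. ((x i)\<^sup>2 * (y j)\<^sup>2) * (1 / (4 * real n)))"
  proof (intro mult_left_mono sum_mono)
    fix i j assume "i \<in> {..<n}" "j \<in> {..<n}"
    then have ij: "i < n" "j < n" by auto
    show "(h i j)\<^sup>2 * edge_prob p {i, j} \<le> ((x i)\<^sup>2 * (y j)\<^sup>2) * (1 / (4 * real n))"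
    proof (cases "i = j")
      case False
      have "(h i j)\<^sup>2 \<le> ((x i)\<^sup>2 * (y j)\<^sup>2) / (4 * s\<^sup>2)"
        by (cases "i \<noteq> j \<and> \<bar>x i * y j\<bar> \<le> s") (simp_all add: h_def power_divide power_mult_distrib)
      moreover have "edge_prob p {i, j} \<le> s\<^sup>2 / n" using ps ij False by (simp add: edge_prob_insert[OF p])
      ultimately have "(h i j)\<^sup>2 * edge_prob p {i, j} \<le> ((x i)\<^sup>2 * (y j)\<^sup>2) / (4 * s\<^sup>2) * (s\<^sup>2 / n)"
        using edge_prob_bounds[OF p] ij by (intro mult_mono) auto
      then show ?thesis using s by simp
    qed (simp add: h_def)
  qed simp
  also have "\<dots> = (\<Sum>i<n. (x i)\<^sup>2) * (\<Sum>i<n. (y i)\<^sup>2) / (2 * real n)"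
    by (simp only: sum_product sum_distrib_right[symmetric]) simp
  also have "\<dots> \<le> (5 * real n) * (5 * real n) / (2 * real n)"
  proof (rule divide_right_mono)
    show "(\<Sum>i<n. (x i)\<^sup>2) * (\<Sum>i<n. (y i)\<^sup>2) \<le> (5 * real n) * (5 * real n)"
      by (rule mult_mono[OF x y]) (simp_all add: sum_nonneg)
  qed simp
  also have "\<dots> \<le> 13 * real n" using n by (simp add: field_simps)
  finally have v: "(\<Sum>e\<in>edges n. edge_prob p e * (c e)\<^sup>2) \<le> 13 * real n" .
  have "measure_pmf.prob (random_graph n p) {G. 2 * s * t \<le> light_sum n p s G x y}
      = measure_pmf.prob (random_graph n p) {G. t \<le> (\<Sum>e\<in>edges n. c e * (of_bool (G e) - edge_prob p e))}"
    using s by (simp add: eq)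
  also have "\<dots> \<le> exp ((\<Sum>e\<in>edges n. edge_prob p e * (c e)\<^sup>2) - t)"
    by (rule prob_centered_edge_sum[OF p c1])
  also have "\<dots> \<le> exp (13 * real n - t)" using v by simp
  finally show ?thesis .
qed

section \<open>A dyadic net of test vectors\<close>

definition dyadic :: "nat \<Rightarrow> real set" where
  "dyadic N = insert 0 ((\<lambda>a. 2 ^ a) ` {..N} \<union> (\<lambda>a. - (2 ^ a)) ` {..N})"

text \<open>Test vectors are scaled to squared norm n, so that 1 is the typical entry size and
  serves as the smallest nonzero level. Rounding an entry c yields a square of at most
  \<open>1 + 4 * c\<^sup>2\<close>; summing gives the bound 5 n.\<close>

definition dyadic_net :: "nat \<Rightarrow> (nat \<Rightarrow> real) set" where
  "dyadic_net n = {x \<in> {..<n} \<rightarrow>\<^sub>E dyadic n. (\<Sum>i<n. (x i)\<^sup>2) \<le> 5 * real n}"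

lemma finite_dyadic [simp]: "finite (dyadic N)" by (simp add: dyadic_def)

lemma finite_dyadic_net [simp]: "finite (dyadic_net n)"
  unfolding dyadic_net_def by (rule finite_subset[of _ "{..<n} \<rightarrow>\<^sub>E dyadic n"]) (auto intro: finite_PiE)

lemma sum_exp_dyadic: "(\<Sum>v\<in>dyadic N. exp (- v\<^sup>2)) \<le> 4"
proof -
  have half: "(\<Sum>a\<le>N. exp (- (2 ^ a)\<^sup>2)) \<le> (4 / 3 :: real)"
  proof -
    have "(\<Sum>a\<le>N. exp (- (2 ^ a)\<^sup>2)) \<le> (\<Sum>a\<le>N. (1 / 4 :: real) ^ a)"
    proof (intro sum_mono)
      fix a
      have "(4 :: real) ^ a \<le> exp (4 ^ a)" using exp_ge_add_one_self[of "4 ^ a :: real"] by linarith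
      then have "exp (- (4 ^ a)) \<le> (1 / 4 :: real) ^ a"
        by (simp add: exp_minus power_one_over field_simps)
      moreover have "(2 ^ a)\<^sup>2 = (4 ^ a :: real)" by (simp add: power2_eq_square power_mult_distrib[symmetric])
      ultimately show "exp (- (2 ^ a)\<^sup>2) \<le> (1 / 4 :: real) ^ a" by simp
    qed
    also have "\<dots> \<le> 4 / 3"
    proof -
      have "3 * (\<Sum>a\<le>N. (1 / 4 :: real) ^ a) = 4 - (1 / 4) ^ N" by (induction N) simp_all
      moreover have "(1 / 4 :: real) ^ N \<ge> 0" by simp
      ultimately show ?thesis by linarith
    qed
    finally show ?thesis .
  qed
  have im: "(\<Sum>v\<in>f ` {..N}. exp (- v\<^sup>2)) \<le> 4 / 3"
    if f: "\<And>a. (f a)\<^sup>2 = (2 ^ a)\<^sup>2" for f :: "nat \<Rightarrow> real"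
  proof -
    have "(\<Sum>v\<in>f ` {..N}. exp (- v\<^sup>2)) \<le> (\<Sum>a\<le>N. exp (- (f a)\<^sup>2))"
      using sum_image_le[of "{..N}" "\<lambda>v. exp (- v\<^sup>2)" f] unfolding o_def by simp
    then show ?thesis using half unfolding f by linarith
  qed
  have un: "(\<Sum>v\<in>A \<union> B. exp (- v\<^sup>2)) \<le> (\<Sum>v\<in>A. exp (- v\<^sup>2)) + (\<Sum>v\<in>B. exp (- v\<^sup>2))"
    if "finite A" "finite B" for A B :: "real set"
    using sum.union_inter[OF that, of "\<lambda>v. exp (- v\<^sup>2)"] sum_nonneg[of "A \<inter> B" "\<lambda>v. exp (- v\<^sup>2)"] by simp
  have "(\<Sum>v\<in>dyadic N. exp (- v\<^sup>2)) \<le> (\<Sum>v\<in>{0}. exp (- v\<^sup>2)) +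
     (\<Sum>v\<in>((\<lambda>a. 2 ^ a) ` {..N} \<union> (\<lambda>a. - (2 ^ a)) ` {..N}). exp (- v\<^sup>2))"
    unfolding dyadic_def by (subst insert_is_Un, rule un) simp_all
  moreover have "(\<Sum>v\<in>((\<lambda>a. 2 ^ a) ` {..N} \<union> (\<lambda>a. - (2 ^ a)) ` {..N}). exp (- v\<^sup>2))
      \<le> (\<Sum>v\<in>(\<lambda>a. 2 ^ a) ` {..N}. exp (- v\<^sup>2)) + (\<Sum>v\<in>(\<lambda>a. - (2 ^ a)) ` {..N}. exp (- v\<^sup>2) :: real)"
    by (rule un) simp_all
  moreover have "(\<Sum>v\<in>(\<lambda>a. 2 ^ a) ` {..N}. exp (- v\<^sup>2)) \<le> 4 / (3 :: real)" by (rule im) simp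
  moreover have "(\<Sum>v\<in>(\<lambda>a. - (2 ^ a)) ` {..N}. exp (- v\<^sup>2)) \<le> 4 / (3 :: real)" by (rule im) simp
  moreover have "(\<Sum>v\<in>{0}. exp (- v\<^sup>2)) = (1 :: real)" by simp
  ultimately show ?thesis by linarith
qed

text \<open>Each net vector x has weight \<open>exp (5 n - |x|^2)\<close> at least 1, so the
  cardinality is at most the sum of these weights over the whole grid. That sum factorises into
  one-coordinate sums, each at most 4 and hence at most \<open>exp 2\<close>.\<close>

lemma card_dyadic_net: "card (dyadic_net n) \<le> exp (7 * real n)"
proof -
  have "real (card (dyadic_net n)) = (\<Sum>x\<in>dyadic_net n. 1)" by simp
  also have "\<dots> \<le> (\<Sum>x\<in>dyadic_net n. exp (5 * real n) * (\<Prod>i<n. exp (- (x i)\<^sup>2)))"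
  proof (rule sum_mono)
    fix x assume "x \<in> dyadic_net n"
    then have "0 \<le> 5 * real n + (\<Sum>i<n. - (x i)\<^sup>2)" by (simp add: dyadic_net_def sum_negf)
    then have "1 \<le> exp (5 * real n + (\<Sum>i<n. - (x i)\<^sup>2))" by simp
    then show "1 \<le> exp (5 * real n) * (\<Prod>i<n. exp (- (x i)\<^sup>2))"
      by (simp only: exp_add exp_sum finite_lessThan)
  qed
  also have "\<dots> \<le> (\<Sum>x\<in>{..<n} \<rightarrow>\<^sub>E dyadic n. exp (5 * real n) * (\<Prod>i<n. exp (- (x i)\<^sup>2)))"
    by (rule sum_mono2) (simp_all add: dyadic_net_def finite_PiE prod_nonneg subset_iff)
  also have "\<dots> = exp (5 * real n) * (\<Prod>i<n. \<Sum>v\<in>dyadic n. exp (- v\<^sup>2))"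
    by (subst prod_sum_PiE) (simp_all add: sum_distrib_left)
  also have "\<dots> \<le> exp (5 * real n) * exp 2 ^ n"
  proof -
    have "(4 :: real) \<le> (exp 1)\<^sup>2" using exp_ge_add_one_self[of 1] power_mono[of 2 "exp 1 :: real" 2] by simp
    then have "(\<Sum>v\<in>dyadic n. exp (- v\<^sup>2)) \<le> exp 2"
      using sum_exp_dyadic[of n] exp_double[of "1 :: real"] by simp
    then show ?thesis by (simp add: power_mono sum_nonneg)
  qed
  also have "\<dots> = exp (5 * real n) * exp (real n * 2)" by (simp only: exp_of_nat_mult)
  also have "\<dots> = exp (5 * real n + real n * 2)" by (rule exp_add[symmetric])
  also have "5 * real n + real n * 2 = 7 * real n" by simp
  finally show ?thesis .
qed

text \<open>The two net vectors cost entropy 7 n each and the variance costs 13 n, so the deviation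
  28 n leaves \<open>exp (- n)\<close>. The scaling factor \<open>2 * s\<close> turns 28 into
  56.\<close>

lemma prob_light_event:
  assumes p: "edge_probabilities n p" and s: "s > 0" and n: "n > 0"
    and ps: "\<And>i j. i < n \<Longrightarrow> j < n \<Longrightarrow> i \<noteq> j \<Longrightarrow> p i j \<le> s\<^sup>2 / n"
  shows "measure_pmf.prob (random_graph n p)
     {G. \<exists>x\<in>dyadic_net n. \<exists>y\<in>dyadic_net n. 56 * s * real n \<le> light_sum n p s G x y} \<le> exp (- real n)"
proof -
  have e: "2 * s * (28 * real n) = 56 * s * real n" by simp
  let ?N = "dyadic_net n \<times> dyadic_net n"
  let ?B = "\<lambda>xy. {G. 2 * s * (28 * real n) \<le> light_sum n p s G (fst xy) (snd xy)}"
  have eq: "{G. \<exists>x\<in>dyadic_net n. \<exists>y\<in>dyadic_net n. 56 * s * real n \<le> light_sum n p s G x y} = (\<Union>xy\<in>?N. ?B xy)"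
    unfolding e by fastforce
  have bound: "measure_pmf.prob (random_graph n p) (?B xy) \<le> exp (13 * real n - 28 * real n)" if "xy \<in> ?N" for xy
    by (rule prob_light_sum_ge[OF p s ps _ _ n]) (use that in \<open>simp_all add: dyadic_net_def mem_Times_iff\<close>)
  have "measure_pmf.prob (random_graph n p) (\<Union>xy\<in>?N. ?B xy) \<le> (\<Sum>xy\<in>?N. measure_pmf.prob (random_graph n p) (?B xy))"
    by (rule measure_pmf.finite_measure_subadditive_finite) simp_all
  also have "\<dots> \<le> (\<Sum>xy\<in>?N. exp (13 * real n - 28 * real n))"
    by (rule sum_mono) (rule bound)
  also have "\<dots> = (real (card (dyadic_net n)) * real (card (dyadic_net n))) * exp (- 15 * real n)"
    by (simp add: card_cartesian_product)
  also have "\<dots> \<le> (exp (7 * real n) * exp (7 * real n)) * exp (- 15 * real n)"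
    using card_dyadic_net by (intro mult_right_mono mult_mono) auto
  also have "\<dots> = exp (7 * real n + 7 * real n + - 15 * real n)" by (simp only: exp_add)
  also have "7 * real n + 7 * real n + - 15 * real n = - real n" by simp
  finally show ?thesis unfolding eq .
qed

section \<open>Discrepancy\<close>

text \<open>An edge inside the intersection of \<open>A\<close> and \<open>B\<close> is one element
  here although it arises from two ordered pairs; \<open>pair_count_le_cross_edges\<close> pays a
  factor 2 for this.\<close>

definition cross_edges :: "nat set \<Rightarrow> nat set \<Rightarrow> nat set set" where
  "cross_edges A B = (\<lambda>(i, j). {i, j}) ` {(i, j). i \<in> A \<and> j \<in> B \<and> i \<noteq> j}"

text \<open>The logarithm of (e n / b)^b, the standard bound on the number of subsets with at most b
  elements.\<close>

definition subset_entropy :: "nat \<Rightarrow> nat \<Rightarrow> real" where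
  "subset_entropy n b = real b * (1 + ln (real n / real b))"

text \<open>The usual discrepancy property is an alternative: few edges relative to the mean, or few
  relative to the entropy. Here it is replaced by the Chernoff inequality for every integer tilt
  \<open>u\<close>. The optimisation over \<open>u\<close> is thereby postponed to the deterministic
  argument, and restricting to \<open>1 <= u <= n\<close> keeps the union bound finite.\<close>

definition discrepancy_bounded :: "nat \<Rightarrow> real \<Rightarrow> (nat set \<Rightarrow> bool) \<Rightarrow> bool" where
  "discrepancy_bounded n s G \<longleftrightarrow> (\<forall>A B u. A \<subseteq> {..<n} \<and> B \<subseteq> {..<n} \<and> A \<noteq> {} \<and> card A \<le> card B \<and> 1 \<le> u \<and> u \<le> n \<longrightarrow>
     real u * real (card {e \<in> cross_edges A B. G e})
       \<le> real (card A) * real (card B) * (s\<^sup>2 / real n) * exp (real u) + 6 * subset_entropy n (card B))"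

lemma cross_edges_subset:
  assumes "A \<subseteq> {..<n}" "B \<subseteq> {..<n}" shows "cross_edges A B \<subseteq> edges n"
proof
  fix e assume "e \<in> cross_edges A B"
  then obtain i j where "i \<in> A" "j \<in> B" "e = {i, j}" by (auto simp: cross_edges_def)
  then show "e \<in> edges n" using assms by (auto intro: mem_edges)
qed

lemma sum_edge_prob_cross_edges:
  assumes p: "edge_probabilities n p" and AB: "A \<subseteq> {..<n}" "B \<subseteq> {..<n}"
    and h: "\<And>i j. i \<in> A \<Longrightarrow> j \<in> B \<Longrightarrow> i \<noteq> j \<Longrightarrow> p i j \<le> h i j" "\<And>i j. 0 \<le> h i j"
  shows "(\<Sum>e\<in>cross_edges A B. edge_prob p e) \<le> (\<Sum>i\<in>A. \<Sum>j\<in>B. h i j)"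
proof -
  let ?S = "{(i, j). i \<in> A \<and> j \<in> B \<and> i \<noteq> j}"
  have fin: "finite A" "finite B" using finite_subset[OF AB(1)] finite_subset[OF AB(2)] by simp_all
  have S: "?S \<subseteq> A \<times> B" by auto
  then have fS: "finite ?S" by (rule finite_subset) (use fin in simp)
  have pij: "edge_prob p {i, j} = p i j" if "i \<in> A" "j \<in> B" for i j
    using that AB by (intro edge_prob_insert[OF p]) auto
  have "(\<Sum>e\<in>cross_edges A B. edge_prob p e) \<le> (\<Sum>x\<in>?S. edge_prob p (case x of (i, j) \<Rightarrow> {i, j}))"
    unfolding cross_edges_def
  proof (rule sum_image_le[OF fS, of "edge_prob p", unfolded o_def])
    fix x assume "x \<in> ?S"
    then have "(case x of (i, j) \<Rightarrow> {i, j}) \<in> edges n" using AB by (auto intro: mem_edges)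
    then show "0 \<le> edge_prob p (case x of (i, j) \<Rightarrow> {i, j})" by (rule edge_prob_bounds(1)[OF p])
  qed
  also have "\<dots> \<le> (\<Sum>x\<in>?S. h (fst x) (snd x))"
    by (rule sum_mono) (use h pij in auto)
  also have "\<dots> \<le> (\<Sum>x\<in>A \<times> B. h (fst x) (snd x))"
    by (rule sum_mono2) (use fin S h in auto)
  also have "\<dots> = (\<Sum>i\<in>A. \<Sum>j\<in>B. h i j)" by (simp add: sum.cartesian_product split_def)
  finally show ?thesis .
qed

text \<open>Over \<open>1 <= b <= n\<close> the entropy is smallest at b = 1. This converts each
  entropy left over in the union bound into a power of n.\<close>

lemma subset_entropy_ge:
  assumes "1 \<le> b" "b \<le> n" shows "1 + ln (real n) \<le> subset_entropy n b"
proof -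
  have b: "1 \<le> real b" "real b \<le> real n" using assms by auto
  have "ln (real b) \<le> real b - 1" using b ln_le_minus_one by simp
  moreover have "(real b - 1) * ln (real b) \<le> (real b - 1) * ln (real n)"
    using b by (intro mult_left_mono) auto
  ultimately have "real b * ln (real b) \<le> (real b - 1) * (1 + ln (real n))"
    by (simp add: algebra_simps)
  moreover have e: "ln (real n / real b) = ln (real n) - ln (real b)" using b by (simp add: ln_div)
  ultimately show ?thesis unfolding subset_entropy_def e by (simp add: algebra_simps)
qed

lemma sum_power_card_Pow:
  fixes x :: real assumes "finite S" shows "(\<Sum>A\<in>Pow S. x ^ card A) = (1 + x) ^ card S"
  using prod_add[OF assms, of "\<lambda>_. x" "\<lambda>_. 1"] by (simp add: add.commute)

text \<open>Give a subset \<open>A\<close> the weight \<open>x ^ card A\<close> with x = b / n. All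
  weights together are \<open>(1 + x) ^ n\<close>, at most \<open>exp b\<close>, while each small
  subset weighs at least \<open>x ^ b\<close>.\<close>

lemma card_small_subsets:
  assumes "1 \<le> b" "b \<le> n"
  shows "real (card {A \<in> Pow {..<n}. card A \<le> b}) \<le> exp (subset_entropy n b)"
proof -
  let ?x = "real b / real n"
  have x: "0 < ?x" "?x \<le> 1" using assms by auto
  have "real (card {A \<in> Pow {..<n}. card A \<le> b}) * ?x ^ b = (\<Sum>A\<in>{A \<in> Pow {..<n}. card A \<le> b}. ?x ^ b)"
    by simp
  also have "\<dots> \<le> (\<Sum>A\<in>{A \<in> Pow {..<n}. card A \<le> b}. ?x ^ card A)"
    by (rule sum_mono) (use x in \<open>auto intro: power_decreasing\<close>)
  also have "\<dots> \<le> (\<Sum>A\<in>Pow {..<n}. ?x ^ card A)"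
    by (rule sum_mono2) auto
  also have "\<dots> = (1 + ?x) ^ n" by (simp add: sum_power_card_Pow)
  also have "\<dots> \<le> exp ?x ^ n" using x by (intro power_mono) (auto intro: exp_ge_add_one_self)
  also have "\<dots> = exp (real b)" using assms by (simp add: exp_of_nat_mult[symmetric])
  finally have "real (card {A \<in> Pow {..<n}. card A \<le> b}) \<le> exp (real b) / ?x ^ b"
    using x by (simp add: pos_le_divide_eq)
  also have "?x ^ b = exp (real b * ln ?x)" using x by (simp add: exp_of_nat_mult)
  also have "exp (real b) / exp (real b * ln ?x) = exp (real b - real b * ln ?x)" by (rule exp_diff[symmetric])
  also have "real b - real b * ln ?x = subset_entropy n b"
    using assms by (simp add: subset_entropy_def ln_div algebra_simps)
  finally show ?thesis .
qed

lemma prob_cross_edges_many: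
  assumes p: "edge_probabilities n p" and n: "n > 0" and u: "u \<ge> 1"
    and ps: "\<And>i j. i < n \<Longrightarrow> j < n \<Longrightarrow> i \<noteq> j \<Longrightarrow> p i j \<le> s\<^sup>2 / real n"
    and AB: "A \<subseteq> {..<n}" "B \<subseteq> {..<n}"
  shows "measure_pmf.prob (random_graph n p)
     {G. real (card A) * real (card B) * (s\<^sup>2 / real n) * exp (real u) + T
         \<le> real u * real (card {e \<in> cross_edges A B. G e})} \<le> exp (- T)"
proof -
  let ?m = "real (card A) * real (card B) * (s\<^sup>2 / real n)"
  have eq: "{G. ?m * exp (real u) + T \<le> real u * real (card {e \<in> cross_edges A B. G e})} =
     {G. (\<forall>e\<in>{}. G e) \<and> (?m * exp (real u) + T) / real u \<le> real (card {e \<in> cross_edges A B. G e})}"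
    using u by (simp add: pos_divide_le_eq mult.commute)
  have "measure_pmf.prob (random_graph n p) {G. ?m * exp (real u) + T \<le> real u * real (card {e \<in> cross_edges A B. G e})}
     \<le> (\<Prod>e\<in>{}. edge_prob p e * exp (real u)) *
      exp (exp (real u) * (\<Sum>e\<in>cross_edges A B. edge_prob p e) - real u * ((?m * exp (real u) + T) / real u))"
    unfolding eq by (rule prob_edges_present_and_count[OF p _ cross_edges_subset[OF AB]]) simp_all
  also have "\<dots> = exp (exp (real u) * (\<Sum>e\<in>cross_edges A B. edge_prob p e) - (?m * exp (real u) + T))"
    using u by simp
  also have "\<dots> \<le> exp (- T)"
  proof -
    have "(\<Sum>e\<in>cross_edges A B. edge_prob p e) \<le> (\<Sum>i\<in>A. \<Sum>j\<in>B. s\<^sup>2 / real n)"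
    proof (rule sum_edge_prob_cross_edges[OF p AB])
      show "p i j \<le> s\<^sup>2 / real n" if "i \<in> A" "j \<in> B" "i \<noteq> j" for i j using ps that AB by blast
    qed simp
    also have "\<dots> = ?m" by simp
    finally have "exp (real u) * (\<Sum>e\<in>cross_edges A B. edge_prob p e) \<le> exp (real u) * ?m"
      by (rule mult_left_mono) simp
    then show ?thesis by (simp add: mult.commute)
  qed
  finally show ?thesis .
qed

text \<open>The coefficient 6 of the entropy h: choosing \<open>A\<close> and \<open>B\<close> costs
  2 h, and the remaining 4 h is at least \<open>4 * (1 + ln n)\<close>. This beats the n choices of
  \<open>u\<close> and the n choices of \<open>b\<close>.\<close>

lemma prob_not_discrepancy_bounded:
  assumes p: "edge_probabilities n p" and n: "n > 0"
    and ps: "\<And>i j. i < n \<Longrightarrow> j < n \<Longrightarrow> i \<noteq> j \<Longrightarrow> p i j \<le> s\<^sup>2 / real n"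
  shows "measure_pmf.prob (random_graph n p) {G. \<not> discrepancy_bounded n s G} \<le> 1 / real n"
proof -
  let ?P = "measure_pmf.prob (random_graph n p)"
  define S where "S b = {A \<in> Pow {..<n}. card A \<le> b}" for b
  define I where "I = Sigma {1..n} (\<lambda>b. S b \<times> (S b \<times> {1..n}))"
  define E where "E = (\<lambda>(b, A, B, u). if card B = b then {G. real (card A) * real (card B) * (s\<^sup>2 / real n) * exp (real u)
     + 6 * subset_entropy n (card B) \<le> real u * real (card {e \<in> cross_edges A B. G e})} else {})"
  have finS: "finite (S b)" for b by (simp add: S_def)
  have finI: "finite I" unfolding I_def by (intro finite_SigmaI finite_cartesian_product finS) auto
  have sub: "{G. \<not> discrepancy_bounded n s G} \<subseteq> (\<Union>x\<in>I. E x)"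
  proof
    fix G assume "G \<in> {G. \<not> discrepancy_bounded n s G}"
    then obtain A B u where *: "A \<subseteq> {..<n}" "B \<subseteq> {..<n}" "A \<noteq> {}" "card A \<le> card B" "1 \<le> u" "u \<le> n"
      and G: "real u * real (card {e \<in> cross_edges A B. G e})
       > real (card A) * real (card B) * (s\<^sup>2 / real n) * exp (real u) + 6 * subset_entropy n (card B)"
      unfolding discrepancy_bounded_def by (auto simp: not_le)
    have "finite A" using finite_subset[OF *(1)] by simp
    then have "card A \<ge> 1" using *(3) by (simp add: Suc_le_eq card_gt_0_iff)
    moreover have "card B \<le> n" using card_mono[OF _ *(2)] by simp
    ultimately have "(card B, A, B, u) \<in> I" using * by (simp add: I_def S_def)
    moreover have "G \<in> E (card B, A, B, u)" using G by (simp add: E_def)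
    ultimately show "G \<in> (\<Union>x\<in>I. E x)" by blast
  qed
  have bnd: "?P (E (b, A, B, u)) \<le> exp (- (6 * subset_entropy n b))"
    if "(b, A, B, u) \<in> I" for b A B u
  proof (cases "card B = b")
    case True
    then show ?thesis
      using that prob_cross_edges_many[OF p n _ ps, of u A B "6 * subset_entropy n b"]
      by (simp add: E_def I_def S_def)
  qed (simp add: E_def)
  have "?P {G. \<not> discrepancy_bounded n s G} \<le> ?P (\<Union>x\<in>I. E x)"
    using sub by (rule measure_pmf.finite_measure_mono) simp
  also have "\<dots> \<le> (\<Sum>x\<in>I. ?P (E x))"
    by (rule measure_pmf.finite_measure_subadditive_finite[OF finI]) simp
  also have "\<dots> \<le> (\<Sum>x\<in>I. exp (- (6 * subset_entropy n (fst x))))"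
  proof (rule sum_mono)
    fix x assume "x \<in> I"
    then show "?P (E x) \<le> exp (- (6 * subset_entropy n (fst x)))"
      using bnd by (cases x) simp
  qed
  also have "\<dots> = (\<Sum>b\<in>{1..n}. \<Sum>x\<in>S b \<times> (S b \<times> {1..n}). exp (- (6 * subset_entropy n b)))"
    unfolding I_def using finS by (subst sum.Sigma) (auto intro!: sum.cong)
  also have "\<dots> \<le> (\<Sum>b\<in>{1..n}. real n * exp (- (4 * (1 + ln (real n)))))"
  proof (rule sum_mono)
    fix b assume b: "b \<in> {1..n}"
    let ?h = "subset_entropy n b"
    have cS: "real (card (S b)) \<le> exp ?h" using card_small_subsets[of b n] b by (simp add: S_def)
    have "(\<Sum>x\<in>S b \<times> (S b \<times> {1..n}). exp (- (6 * ?h))) = (real (card (S b)) * real (card (S b))) * (real n * exp (- (6 * ?h)))"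
      by (simp add: card_cartesian_product)
    also have "\<dots> \<le> (exp ?h * exp ?h) * (real n * exp (- (6 * ?h)))"
      by (intro mult_right_mono mult_mono cS) simp_all
    also have "\<dots> = real n * exp (?h + ?h + - (6 * ?h))" by (simp only: exp_add mult_ac)
    also have "\<dots> \<le> real n * exp (- (4 * (1 + ln (real n))))"
      using subset_entropy_ge[of b n] b by simp
    finally show "(\<Sum>x\<in>S b \<times> (S b \<times> {1..n}). exp (- (6 * ?h))) \<le> real n * exp (- (4 * (1 + ln (real n))))" .
  qed
  also have "\<dots> = (real n * real n) * exp (- (4 * (1 + ln (real n))))" by simp
  also have "\<dots> \<le> (real n * real n) * exp (- (3 * ln (real n)))"
  proof (rule mult_left_mono)
    have "1 \<le> real n" using n by linarith
    then have "0 \<le> ln (real n)" by (rule ln_ge_zero)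
    then show "exp (- (4 * (1 + ln (real n)))) \<le> exp (- (3 * ln (real n)))" by simp
  qed simp
  also have "exp (- (3 * ln (real n))) = 1 / real n ^ 3"
    using n exp_of_nat_mult[of 3 "ln (real n)"] by (simp add: exp_minus divide_inverse)
  also have "real n * real n * (1 / real n ^ 3) = 1 / real n"
    using n by (simp add: power3_eq_cube)
  finally show ?thesis .
qed

section \<open>Heavy pairs\<close>

definition offdiag_degree :: "nat \<Rightarrow> (nat set \<Rightarrow> bool) \<Rightarrow> nat \<Rightarrow> real" where
  "offdiag_degree n G i = (\<Sum>j<n. of_bool (i \<noteq> j \<and> G {i, j}))"

definition pair_count :: "nat \<Rightarrow> (nat set \<Rightarrow> bool) \<Rightarrow> nat set \<Rightarrow> nat set \<Rightarrow> real" where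
  "pair_count n G A B = (\<Sum>i<n. \<Sum>j<n. of_bool (i \<in> A) * of_bool (j \<in> B) * of_bool (i \<noteq> j \<and> G {i, j}))"

definition level_set :: "nat \<Rightarrow> (nat \<Rightarrow> real) \<Rightarrow> nat \<Rightarrow> nat set" where
  "level_set n x a = {i. i < n \<and> \<bar>x i\<bar> = 2 ^ a}"

text \<open>The squared norm carried by level \<open>a\<close>, in units of n. On net vectors these
  weights add up to at most 5, and the heavy sum is estimated in terms of them.\<close>

definition level_weight :: "nat \<Rightarrow> (nat \<Rightarrow> real) \<Rightarrow> nat \<Rightarrow> real" where
  "level_weight n x a = real (card (level_set n x a)) * 4 ^ a / real n"

lemma level_set_subset: "level_set n x a \<subseteq> {..<n}" by (auto simp: level_set_def)

lemma finite_level_set [simp]: "finite (level_set n x a)"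
  by (rule finite_subset[OF level_set_subset]) simp

lemma level_weight_nonneg: "0 \<le> level_weight n x a" by (simp add: level_weight_def)

lemma pair_count_nonneg: "0 \<le> pair_count n G A B"
  unfolding pair_count_def by (intro sum_nonneg) simp

lemma pair_count_commute: "pair_count n G A B = pair_count n G B A"
  unfolding pair_count_def
  by (subst sum.swap) (intro sum.cong refl, simp add: insert_commute mult_ac eq_commute)

lemma pair_count_le_cross_edges:
  assumes "A \<subseteq> {..<n}" "B \<subseteq> {..<n}"
  shows "pair_count n G A B \<le> 2 * real (card {e \<in> cross_edges A B. G e})"
proof -
  define P where "P = {(i, j). i \<in> A \<and> j \<in> B \<and> i \<noteq> j \<and> G {i, j}}"
  let ?E = "{e \<in> cross_edges A B. G e}"
  have P: "P \<subseteq> {..<n} \<times> {..<n}" using assms by (auto simp: P_def)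
  have finE: "finite ?E"
    by (rule finite_subset[OF _ finite_edges[of n]]) (use cross_edges_subset[OF assms] in auto)
  have "pair_count n G A B = (\<Sum>x\<in>{..<n} \<times> {..<n}. of_bool (x \<in> P))"
    unfolding pair_count_def sum.cartesian_product P_def by (intro sum.cong refl) auto
  also have "\<dots> = real (card P)"
  proof -
    have "({..<n} \<times> {..<n}) \<inter> {x. x \<in> P} = P" using P by auto
    then show ?thesis by (subst sum_of_bool_eq) simp_all
  qed
  also have "card P \<le> card (\<Union>e\<in>?E. edge_fiber n e)"
  proof (rule card_mono)
    show "finite (\<Union>e\<in>?E. edge_fiber n e)" by (rule finite_UN_I[OF finE]) simp
    show "P \<subseteq> (\<Union>e\<in>?E. edge_fiber n e)"
    proof
      fix x assume "x \<in> P"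
      then obtain i j where x: "x = (i, j)" "i \<in> A" "j \<in> B" "i \<noteq> j" "G {i, j}"
        unfolding P_def by blast
      have "{i, j} \<in> ?E" unfolding cross_edges_def using x by blast
      moreover have "x \<in> edge_fiber n {i, j}" using x assms by (auto simp: edge_fiber_def)
      ultimately show "x \<in> (\<Union>e\<in>?E. edge_fiber n e)" by blast
    qed
  qed
  also have "\<dots> \<le> (\<Sum>e\<in>?E. card (edge_fiber n e))" by (rule card_UN_le[OF finE])
  also have "\<dots> \<le> (\<Sum>e\<in>?E. 2)" by (rule sum_mono) (rule card_edge_fiber)
  finally show ?thesis by simp
qed

lemma pair_count_le_degree:
  assumes "A \<subseteq> {..<n}" and deg: "\<And>i. i \<in> A \<Longrightarrow> offdiag_degree n G i \<le> t"
  shows "pair_count n G A B \<le> real (card A) * t"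
proof -
  have "pair_count n G A B \<le> (\<Sum>i<n. if i \<in> A then t else 0)"
    unfolding pair_count_def
  proof (rule sum_mono)
    fix i assume "i \<in> {..<n}"
    have "(\<Sum>j<n. of_bool (i \<in> A) * of_bool (j \<in> B) * of_bool (i \<noteq> j \<and> G {i, j}))
      \<le> of_bool (i \<in> A) * offdiag_degree n G i"
      unfolding offdiag_degree_def sum_distrib_left by (rule sum_mono) auto
    also have "\<dots> \<le> (if i \<in> A then t else 0)" using deg by simp
    finally show "(\<Sum>j<n. of_bool (i \<in> A) * of_bool (j \<in> B) * of_bool (i \<noteq> j \<and> G {i, j})) \<le> (if i \<in> A then t else 0)" .
  qed
  also have "\<dots> = real (card A) * t" using assms(1) by (simp add: sum.If_cases Int_absorb1)
  finally show ?thesis .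
qed

lemma sum_level_weight:
  assumes "(\<Sum>i<n. (x i)\<^sup>2) \<le> 5 * real n"
  shows "(\<Sum>a\<le>N. level_weight n x a) \<le> 5"
proof (cases "n = 0")
  case False
  have disj: "level_set n x a \<inter> level_set n x b = {}" if "a \<noteq> b" for a b
    using that by (auto simp: level_set_def)
  have "(\<Sum>a\<le>N. real (card (level_set n x a)) * 4 ^ a) = (\<Sum>a\<le>N. \<Sum>i\<in>level_set n x a. (x i)\<^sup>2)"
  proof (rule sum.cong[OF refl])
    fix a
    have "(\<Sum>i\<in>level_set n x a. (x i)\<^sup>2) = (\<Sum>i\<in>level_set n x a. 4 ^ a)"
    proof (rule sum.cong[OF refl])
      fix i assume "i \<in> level_set n x a"
      then have "\<bar>x i\<bar>\<^sup>2 = (2 ^ a)\<^sup>2" by (simp add: level_set_def)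
      then show "(x i)\<^sup>2 = 4 ^ a" by (simp add: power_mult[symmetric] mult.commute[of a]) (simp add: power_mult)
    qed
    then show "real (card (level_set n x a)) * 4 ^ a = (\<Sum>i\<in>level_set n x a. (x i)\<^sup>2)" by simp
  qed
  also have "\<dots> = (\<Sum>i\<in>(\<Union>a\<in>{..N}. level_set n x a). (x i)\<^sup>2)"
    by (rule sum.UNION_disjoint[symmetric]) (use disj in auto)
  also have "\<dots> \<le> (\<Sum>i<n. (x i)\<^sup>2)"
    by (rule sum_mono2) (auto simp: level_set_def)
  finally have "(\<Sum>a\<le>N. real (card (level_set n x a)) * 4 ^ a) \<le> 5 * real n" using assms by simp
  then show ?thesis using False by (simp add: level_weight_def sum_divide_distrib[symmetric] pos_divide_le_eq)
qed (simp add: level_weight_def)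

text \<open>A geometric sum is comparable to its largest term, here at most \<open>Y\<close>. The
  bound does not depend on the number of levels, so no logarithm is lost.\<close>

lemma truncated_geometric_sum_le:
  fixes q Y :: real
  assumes q: "q > 1" and Y: "Y > 0"
  shows "(\<Sum>b\<le>N. of_bool (q ^ b \<le> Y) * q ^ b) \<le> Y * (q / (q - 1))"
proof (induction N)
  case 0
  have "1 \<le> q / (q - 1)" using q by simp
  then have "Y * 1 \<le> Y * (q / (q - 1))" using Y by (intro mult_left_mono) auto
  moreover have "(\<Sum>b\<le>0. of_bool (q ^ b \<le> Y) * q ^ b) \<le> Y" using Y by simp
  ultimately show ?case by linarith
next
  case (Suc N)
  show ?case
  proof (cases "q ^ Suc N \<le> Y")
    case True
    have "(\<Sum>b\<le>Suc N. of_bool (q ^ b \<le> Y) * q ^ b) \<le> (\<Sum>b\<le>Suc N. q ^ b)"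
      by (rule sum_mono) (use q in auto)
    also have "\<dots> = (q ^ Suc (Suc N) - 1) / (q - 1)"
      using sum_gp_basic[of q "Suc N"] q by (simp add: field_simps del: sum.atMost_Suc)
    also have "\<dots> \<le> q ^ Suc (Suc N) / (q - 1)" using q by (intro divide_right_mono) auto
    also have "\<dots> \<le> (Y * q) / (q - 1)"
      using True q mult_right_mono[OF True, of q] by (intro divide_right_mono) (auto simp: mult_ac)
    finally show ?thesis by simp
  next
    case False then show ?thesis using Suc by simp
  qed
qed

lemma one_plus_ln_div_le:
  fixes Y :: real assumes "Y \<ge> 1" shows "(1 + ln Y) / Y \<le> 2 / sqrt Y"
proof -
  have s: "sqrt Y \<ge> 1" "Y = sqrt Y * sqrt Y" using assms by simp_all
  have "ln Y = 2 * ln (sqrt Y)" using assms by (simp add: ln_sqrt)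
  also have "\<dots> \<le> 2 * (sqrt Y - 1)" using s ln_le_minus_one[of "sqrt Y"] by simp
  finally have "1 + ln Y \<le> 2 * sqrt Y" by simp
  then have "(1 + ln Y) / Y \<le> 2 * sqrt Y / Y" using assms by (intro divide_right_mono) auto
  also have "\<dots> = 2 / sqrt Y" using s by (simp add: field_simps)
  finally show ?thesis .
qed

text \<open>The parameter \<open>u\<close> of the discrepancy bound is tuned to the pair of levels: \<open>exp u\<close> is of
  order \<open>2 ^ (a + b) / s\<close>, raised further if the set at level \<open>b\<close> is so small that the entropy
  term would dominate.\<close>

lemma level_pair_discrepancy_bound:
  fixes x y :: "nat \<Rightarrow> real"
  assumes disc: "discrepancy_bounded n s G" and s: "s \<ge> 1"
    and n: "n > 0" "2 + ln (5 * real n) + ln (real n) \<le> real n"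
    and x: "(\<Sum>i<n. (x i)\<^sup>2) \<le> 5 * real n" and y: "(\<Sum>i<n. (y i)\<^sup>2) \<le> 5 * real n"
    and ab: "s < 2 ^ (a + b)" "2 ^ a \<le> 2 ^ b * s"
    and ne: "level_set n x a \<noteq> {}" "card (level_set n x a) \<le> card (level_set n y b)"
  shows "2 ^ (a + b) * pair_count n G (level_set n x a) (level_set n y b) \<le>
     real n * s * (16 * (level_weight n x a * (level_weight n y b + (1 / 2) ^ b)) + 36 * (level_weight n y b * sqrt (2 ^ a / (2 ^ b * s))))"
proof -
  let ?A = "level_set n x a" and ?B = "level_set n y b"
  define \<alpha> where "\<alpha> = level_weight n x a"
  define \<beta> where "\<beta> = level_weight n y b"
  define z where "z = 2 ^ (a + b) / s"
  \<comment> \<open>Since \<open>\<beta> * M <= \<beta> + (1 / 2) ^ b\<close>, raising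
    \<open>exp u\<close> by the factor \<open>M\<close> adds only a term summable in b. In exchange,
    \<open>ln M\<close> controls \<open>- ln \<beta>\<close>, the dangerous part of the entropy of a
    small set.\<close>
  define M where "M = max 1 ((1 / 2) ^ b / \<beta>)"
  define Y where "Y = 2 ^ b * s / 2 ^ a"
  define v where "v = 1 + ln z + ln M"
  define u where "u = nat \<lceil>v\<rceil>"
  have cA: "card ?A \<ge> 1" using ne(1) by (simp add: Suc_le_eq card_gt_0_iff)
  then have cB: "card ?B \<ge> 1" "real (card ?B) \<ge> 1" using ne(2) by linarith+
  have cBn: "real (card ?B) \<le> real n" using card_mono[OF _ level_set_subset[of n y b]] by simp
  have n0: "real n > 0" using n by simp
  have \<alpha>0: "\<alpha> \<ge> 0" by (simp add: \<alpha>_def level_weight_nonneg)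
  have B_eq: "real (card ?B) = real n * \<beta> / 4 ^ b" using n by (simp add: \<beta>_def level_weight_def)
  have A_eq: "real (card ?A) = real n * \<alpha> / 4 ^ a" using n by (simp add: \<alpha>_def level_weight_def)
  have four: "1 \<le> (4 :: real) ^ b" "1 \<le> (4 :: real) ^ a" by simp_all
  have \<beta>_ge: "1 / real n \<le> \<beta>"
  proof -
    have "1 * 1 \<le> real (card ?B) * 4 ^ b" using cB four by (intro mult_mono) auto
    then show ?thesis unfolding \<beta>_def level_weight_def by (intro divide_right_mono) auto
  qed
  then have \<beta>0: "\<beta> > 0" using n0 by (smt (verit) divide_pos_pos)
  have z1: "z \<ge> 1" using ab(1) s by (simp add: z_def pos_le_divide_eq)
  have M1: "M \<ge> 1" by (simp add: M_def)
  have Y1: "Y \<ge> 1" using ab(2) by (simp add: Y_def pos_le_divide_eq)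
  have v1: "v \<ge> 1" using z1 M1 by (simp add: v_def)
  have u: "v \<le> real u" "real u \<le> v + 1" "u \<ge> 1" using v1 unfolding u_def by linarith+
  have a5: "4 ^ a \<le> 5 * real n"
  proof -
    have "level_weight n x a \<le> (\<Sum>a'\<le>a. level_weight n x a')"
      by (rule member_le_sum) (auto simp: level_weight_nonneg)
    then have "level_weight n x a \<le> 5" using sum_level_weight[OF x, of a] by linarith
    moreover have "4 ^ a / real n \<le> level_weight n x a"
      unfolding level_weight_def using cA n by (intro divide_right_mono) auto
    ultimately have "4 ^ a / real n \<le> 5" by linarith
    then show ?thesis using n0 by (simp add: pos_divide_le_eq)
  qed
  have b5: "4 ^ b \<le> 5 * real n"
  proof -
    have "level_weight n y b \<le> (\<Sum>a'\<le>b. level_weight n y a')"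
      by (rule member_le_sum) (auto simp: level_weight_nonneg)
    then have "level_weight n y b \<le> 5" using sum_level_weight[OF y, of b] by linarith
    moreover have "4 ^ b / real n \<le> level_weight n y b"
      unfolding level_weight_def using cB n by (intro divide_right_mono) auto
    ultimately have "4 ^ b / real n \<le> 5" by linarith
    then show ?thesis using n0 by (simp add: pos_divide_le_eq)
  qed
  have sq: "(2 :: real) ^ a * 2 ^ a = 4 ^ a" "(2 :: real) ^ b * 2 ^ b = 4 ^ b"
    by (simp_all add: power_mult_distrib[symmetric])
  have z5: "z \<le> 5 * real n"
  proof -
    have "0 \<le> ((2 :: real) ^ a - 2 ^ b)\<^sup>2" by simp
    then have "2 * ((2 :: real) ^ a * 2 ^ b) \<le> 4 ^ a + 4 ^ b"
      using sq by (simp add: power2_eq_square algebra_simps)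
    then have "(2 :: real) ^ (a + b) \<le> 5 * real n" using a5 b5 by (simp add: power_add)
    moreover have "z \<le> 2 ^ (a + b) / 1" unfolding z_def using s by (intro divide_left_mono) auto
    ultimately show ?thesis by simp
  qed
  have Mn: "M \<le> real n"
  proof -
    have "(1 / 2) ^ b / \<beta> \<le> 1 / (1 / real n)"
      using \<beta>_ge n0 by (intro frac_le) (auto simp: power_le_one)
    then show ?thesis using n by (simp add: M_def)
  qed
  have "ln z \<le> ln (5 * real n)" "ln M \<le> ln (real n)" using z5 Mn z1 M1 by simp_all
  \<comment> \<open>Nonempty levels force \<open>4 ^ a\<close> and \<open>4 ^ b\<close> below 5 n,
    which bounds \<open>z\<close> by 5 n. The size assumption on n is made precisely so that the
    tuned \<open>u\<close> stays in the admissible range.\<close>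
  then have un: "u \<le> n" using u(2) n(2) by (simp add: v_def)
  have eu: "exp (real u) \<le> 8 * (z * M)"
  proof -
    have "exp (real u) \<le> exp (2 + ln z + ln M)" using u(2) by (simp add: v_def)
    also have "\<dots> = exp 2 * (z * M)" using z1 M1 by (simp add: exp_add)
    also have "\<dots> \<le> 8 * (z * M)"
    proof (rule mult_right_mono)
      have "exp 1 \<le> (272 / 100 :: real)" using e_less_272 by simp
      then have "(exp 1)\<^sup>2 \<le> (272 / 100 :: real)\<^sup>2" by (rule power_mono) simp
      then show "exp 2 \<le> (8 :: real)" using exp_double[of "1 :: real"] by (simp add: power2_eq_square)
    qed (use z1 M1 in simp)
    finally show ?thesis .
  qed
  let ?c = "real (card {e \<in> cross_edges ?A ?B. G e})"
  have d: "real u * ?c \<le> real (card ?A) * real (card ?B) * (s\<^sup>2 / real n) * exp (real u) + 6 * subset_entropy n (card ?B)"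
    by (rule disc[unfolded discrepancy_bounded_def, rule_format]) (intro conjI level_set_subset ne u(3) un)
  have first: "2 ^ (a + b) * (real (card ?A) * real (card ?B) * (s\<^sup>2 / real n) * exp (real u)) \<le> real n * s * (8 * (\<alpha> * (\<beta> + (1 / 2) ^ b))) * real u"
  proof -
    have \<beta>M: "\<beta> * M \<le> \<beta> + (1 / 2) ^ b" using \<beta>0 by (simp add: M_def max_def)
    have "2 ^ (a + b) * (real (card ?A) * real (card ?B) * (s\<^sup>2 / real n) * exp (real u))
       \<le> 2 ^ (a + b) * (real (card ?A) * real (card ?B) * (s\<^sup>2 / real n) * (8 * (z * M)))"
      by (intro mult_left_mono eu) simp_all
    also have "\<dots> = real n * s * (8 * (\<alpha> * (\<beta> * M)))"
    proof -
      have "(2 :: real) ^ (a + b) * 2 ^ (a + b) = 4 ^ a * 4 ^ b" using sq by (simp add: power_add mult_ac)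
      moreover have "2 ^ (a + b) * (real (card ?A) * real (card ?B) * (s\<^sup>2 / real n) * (8 * (z * M)))
         = (2 ^ (a + b) * 2 ^ (a + b)) * (real n * \<alpha> / 4 ^ a) * (real n * \<beta> / 4 ^ b) * (s * s) / real n * 8 * M / s"
        unfolding A_eq B_eq z_def by (simp add: power2_eq_square)
      ultimately show ?thesis using n0 s by simp
    qed
    also have "\<dots> \<le> real n * s * (8 * (\<alpha> * (\<beta> + (1 / 2) ^ b)))"
      using \<beta>M \<alpha>0 s by (intro mult_left_mono) auto
    also have "\<dots> * 1 \<le> real n * s * (8 * (\<alpha> * (\<beta> + (1 / 2) ^ b))) * real u"
      using u(3) \<alpha>0 \<beta>0 s by (intro mult_left_mono) auto
    finally show ?thesis by simp
  qed
  have second: "2 ^ (a + b) * (6 * subset_entropy n (card ?B)) \<le> real n * s * (18 * (\<beta> * (1 / sqrt Y))) * real u"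
  proof -
    have lz: "ln z = (real a + real b) * ln 2 - ln s"
      using s by (simp add: z_def ln_div ln_realpow)
    have lY: "ln Y = real b * ln 2 + ln s - real a * ln 2"
      using s by (simp add: Y_def ln_div ln_mult ln_realpow)
    have l\<beta>: "- ln \<beta> \<le> ln M + real b * ln 2"
    proof -
      have "ln ((1 / 2) ^ b / \<beta>) \<le> ln M" using \<beta>0 M1 by (simp add: M_def)
      moreover have "ln ((1 / 2) ^ b / \<beta>) = - (real b * ln 2) - ln \<beta>"
        using \<beta>0 by (simp add: ln_div ln_realpow)
      ultimately show ?thesis by simp
    qed
    have "ln (real n / real (card ?B)) = ln (4 ^ b / \<beta>)" unfolding B_eq using n0 by simp
    also have "\<dots> = 2 * (real b * ln 2) - ln \<beta>"
      using \<beta>0 ln_realpow[of "2 :: real" 2] by (simp add: ln_div ln_realpow)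
    finally have "1 + ln (real n / real (card ?B)) \<le> 1 + 3 * (real b * ln 2) + ln M" using l\<beta> by simp
    \<comment> \<open>In \<open>v + ln Y\<close> the terms with \<open>a\<close> and
      \<open>s\<close> cancel, leaving \<open>1 + 2 * b * ln 2 + ln M\<close>; multiplying by 3 / 2
      dominates the left side.\<close>
    also have "\<dots> \<le> 3 / 2 * (v + ln Y)"
      using ln_ge_zero[OF M1] unfolding v_def lz lY by (simp add: algebra_simps)
    also have "\<dots> \<le> 3 / 2 * (real u * (1 + ln Y))"
    proof -
      have "ln Y \<le> real u * ln Y" using u(3) Y1 mult_right_mono[of 1 "real u" "ln Y"] by simp
      then show ?thesis using u(1) by (simp add: algebra_simps)
    qed
    finally have ent: "1 + ln (real n / real (card ?B)) \<le> 3 / 2 * (real u * (1 + ln Y))" .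
    have "2 ^ (a + b) * (6 * subset_entropy n (card ?B)) \<le> 2 ^ (a + b) * (6 * (real (card ?B) * (3 / 2 * (real u * (1 + ln Y)))))"
      unfolding subset_entropy_def using ent by (intro mult_left_mono) auto
    also have "\<dots> = 9 * (real n * \<beta> * (2 ^ a / 2 ^ b) * (1 + ln Y) * real u)"
      unfolding B_eq sq(2)[symmetric] by (simp add: power_add field_simps)
    also have "2 ^ a / 2 ^ b = s / Y" using s by (simp add: Y_def)
    also have "9 * (real n * \<beta> * (s / Y) * (1 + ln Y) * real u) = 9 * real n * s * \<beta> * real u * ((1 + ln Y) / Y)"
      by simp
    also have "\<dots> \<le> 9 * real n * s * \<beta> * real u * (2 / sqrt Y)"
      using \<beta>0 s by (intro mult_left_mono one_plus_ln_div_le[OF Y1]) auto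
    finally show ?thesis by (simp add: mult_ac)
  qed
  have "2 ^ (a + b) * pair_count n G ?A ?B * real u \<le> 2 ^ (a + b) * (2 * ?c) * real u"
    using pair_count_le_cross_edges[OF level_set_subset level_set_subset, of n G x a y b]
    by (intro mult_right_mono mult_left_mono) auto
  also have "\<dots> = 2 ^ (a + b) * 2 * (real u * ?c)" by simp
  also have "\<dots> \<le> 2 ^ (a + b) * 2 * (real (card ?A) * real (card ?B) * (s\<^sup>2 / real n) * exp (real u) + 6 * subset_entropy n (card ?B))"
    by (rule mult_left_mono[OF d]) simp
  also have "\<dots> = 2 * (2 ^ (a + b) * (real (card ?A) * real (card ?B) * (s\<^sup>2 / real n) * exp (real u))) +
     2 * (2 ^ (a + b) * (6 * subset_entropy n (card ?B)))" by (simp only: distrib_left mult_ac)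
  also have "\<dots> \<le> 2 * (real n * s * (8 * (\<alpha> * (\<beta> + (1 / 2) ^ b))) * real u) + 2 * (real n * s * (18 * (\<beta> * (1 / sqrt Y))) * real u)"
    using first second by linarith
  also have "\<dots> = real n * s * (16 * (\<alpha> * (\<beta> + (1 / 2) ^ b)) + 36 * (\<beta> * (1 / sqrt Y))) * real u"
    by (simp add: algebra_simps)
  finally have "2 ^ (a + b) * pair_count n G ?A ?B \<le> real n * s * (16 * (\<alpha> * (\<beta> + (1 / 2) ^ b)) + 36 * (\<beta> * (1 / sqrt Y)))"
    using u(3) by (simp add: mult_le_cancel_right)
  moreover have "1 / sqrt Y = sqrt (2 ^ a / (2 ^ b * s))"
    by (simp add: Y_def real_sqrt_divide)
  ultimately show ?thesis by (simp add: \<alpha>_def \<beta>_def)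
qed

text \<open>Two regimes. If \<open>2 ^ a <= 2 ^ b * s\<close>, the discrepancy bound applies.
  Otherwise the degree bound on the larger entries suffices, as the terms decay geometrically when b
  moves down. With level weights summing to at most 5, the three sums are at most 10, 35 and 20, and
  10 + 16 * 35 + 36 * 20 = 1290.\<close>

lemma sum_heavy_levels_le:
  fixes x y :: "nat \<Rightarrow> real"
  assumes disc: "discrepancy_bounded n s G" and s: "s \<ge> 1"
    and n: "n > 0" "2 + ln (5 * real n) + ln (real n) \<le> real n"
    and x: "(\<Sum>i<n. (x i)\<^sup>2) \<le> 5 * real n" and y: "(\<Sum>i<n. (y i)\<^sup>2) \<le> 5 * real n"
    and deg: "\<And>i. i < n \<Longrightarrow> x i \<noteq> 0 \<Longrightarrow> offdiag_degree n G i \<le> s\<^sup>2"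
  shows "(\<Sum>a\<le>N. \<Sum>b\<le>N. of_bool (s < 2 ^ (a + b) \<and> card (level_set n x a) \<le> card (level_set n y b)) *
     (2 ^ (a + b) * pair_count n G (level_set n x a) (level_set n y b))) \<le> 1290 * real n * s"
proof -
  let ?A = "level_set n x" and ?B = "level_set n y"
  let ?\<alpha> = "level_weight n x" and ?\<beta> = "level_weight n y"
  \<comment> \<open>Geometric weights truncated where they would exceed 1, in the shape required by
    \<open>truncated_geometric_sum_le\<close>: \<open>w1\<close> for the degree regime,
    \<open>w2\<close> for the entropy term of the discrepancy regime.\<close>
  define w1 where "w1 a b = of_bool (2 ^ b \<le> 2 ^ a / s) * 2 ^ b * (s / 2 ^ a)" for a b :: nat
  define w2 where "w2 a b = of_bool (sqrt 2 ^ a \<le> sqrt (2 ^ b * s)) * sqrt 2 ^ a * (1 / sqrt (2 ^ b * s))" for a b :: nat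
  have w0: "0 \<le> w1 a b" "0 \<le> w2 a b" for a b using s by (simp_all add: w1_def w2_def)
  have bnd: "of_bool (s < 2 ^ (a + b) \<and> card (?A a) \<le> card (?B b)) * (2 ^ (a + b) * pair_count n G (?A a) (?B b))
     \<le> real n * s * (?\<alpha> a * w1 a b + 16 * (?\<alpha> a * (?\<beta> b + (1 / 2) ^ b)) + 36 * (?\<beta> b * w2 a b))"
    (is "?L \<le> ?R") for a b
  proof (cases "s < 2 ^ (a + b) \<and> card (?A a) \<le> card (?B b) \<and> ?A a \<noteq> {}")
    case False
    have "?L = 0" using False by (auto simp: pair_count_def)
    moreover have "0 \<le> ?R" using s w0 by (intro mult_nonneg_nonneg add_nonneg_nonneg) (auto simp: level_weight_nonneg)
    ultimately show ?thesis by linarith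
  next
    case True
    show ?thesis
    proof (cases "2 ^ a \<le> 2 ^ b * s")
      case le: True
      have eq: "sqrt (2 ^ a / (2 ^ b * s)) = sqrt 2 ^ a * (1 / sqrt (2 ^ b * s))"
        by (simp add: real_sqrt_divide real_sqrt_power)
      have "sqrt 2 ^ a \<le> sqrt (2 ^ b * s)"
        using le real_sqrt_le_mono[OF le] by (simp add: real_sqrt_power)
      then have w2: "w2 a b = sqrt (2 ^ a / (2 ^ b * s))" unfolding eq by (simp add: w2_def)
      have "?L \<le> real n * s * (16 * (?\<alpha> a * (?\<beta> b + (1 / 2) ^ b)) + 36 * (?\<beta> b * w2 a b))"
        using level_pair_discrepancy_bound[OF disc s n x y _ le] True unfolding w2 by simp
      also have "\<dots> \<le> ?R" using s w0 by (intro mult_left_mono) (auto simp: level_weight_nonneg)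
      finally show ?thesis .
    next
      case gt: False
      then have w1: "w1 a b = 2 ^ b * (s / 2 ^ a)" using s by (simp add: w1_def pos_le_divide_eq)
      have "pair_count n G (?A a) (?B b) \<le> real (card (?A a)) * s\<^sup>2"
      proof (rule pair_count_le_degree[OF level_set_subset])
        fix i assume i: "i \<in> ?A a"
        then have "x i \<noteq> 0" unfolding level_set_def by (metis (mono_tags, lifting) abs_zero mem_Collect_eq power_eq_0_iff zero_neq_numeral)
        then show "offdiag_degree n G i \<le> s\<^sup>2" using deg i by (simp add: level_set_def)
      qed
      then have "?L \<le> 2 ^ (a + b) * (real (card (?A a)) * s\<^sup>2)" using True by simp
      also have "\<dots> = real n * s * (?\<alpha> a * w1 a b)"
      proof -
        have "(4 :: real) ^ a = 2 ^ a * 2 ^ a" by (simp add: power_mult_distrib[symmetric])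
        then show ?thesis unfolding w1 level_weight_def using n by (simp add: power_add power2_eq_square)
      qed
      also have "\<dots> \<le> ?R" using s w0 by (intro mult_left_mono) (auto simp: level_weight_nonneg)
      finally show ?thesis .
    qed
  qed
  have sw1: "(\<Sum>b\<le>N. w1 a b) \<le> 2" for a
  proof -
    have "(\<Sum>b\<le>N. w1 a b) = (\<Sum>b\<le>N. of_bool (2 ^ b \<le> 2 ^ a / s) * 2 ^ b) * (s / 2 ^ a)"
      by (simp only: w1_def sum_distrib_right)
    also have "\<dots> \<le> (2 ^ a / s * (2 / (2 - 1))) * (s / 2 ^ a)"
      using s by (intro mult_right_mono truncated_geometric_sum_le) auto
    also have "\<dots> = 2" using s by simp
    finally show ?thesis .
  qed
  have sw2: "(\<Sum>a\<le>N. w2 a b) \<le> 4" for b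
  proof -
    have r2: "sqrt 2 > 4 / 3" by (rule real_less_rsqrt) (simp add: power2_eq_square)
    have "(\<Sum>a\<le>N. w2 a b) = (\<Sum>a\<le>N. of_bool (sqrt 2 ^ a \<le> sqrt (2 ^ b * s)) * sqrt 2 ^ a) * (1 / sqrt (2 ^ b * s))"
      by (simp only: w2_def sum_distrib_right)
    also have "\<dots> \<le> (sqrt (2 ^ b * s) * (sqrt 2 / (sqrt 2 - 1))) * (1 / sqrt (2 ^ b * s))"
      using s by (intro mult_right_mono truncated_geometric_sum_le) auto
    also have "\<dots> = sqrt 2 / (sqrt 2 - 1)" using s by simp
    also have "\<dots> \<le> 4" using r2 by (simp add: pos_divide_le_eq)
    finally show ?thesis .
  qed
  have half: "(\<Sum>b\<le>N. (1 / 2) ^ b) \<le> (2 :: real)"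
  proof -
    have "(\<Sum>b\<le>N. (1 / 2) ^ b) = 2 - (1 / 2 :: real) ^ N" by (induction N) simp_all
    then show ?thesis by simp
  qed
  have A5: "(\<Sum>a\<le>N. ?\<alpha> a) \<le> 5" and B5: "(\<Sum>b\<le>N. ?\<beta> b) \<le> 5"
    using sum_level_weight[OF x] sum_level_weight[OF y] .
  have t1: "(\<Sum>a\<le>N. \<Sum>b\<le>N. ?\<alpha> a * w1 a b) \<le> 10"
  proof -
    have "(\<Sum>a\<le>N. \<Sum>b\<le>N. ?\<alpha> a * w1 a b) \<le> (\<Sum>a\<le>N. ?\<alpha> a * 2)"
      unfolding sum_distrib_left[symmetric] by (intro sum_mono mult_left_mono sw1 level_weight_nonneg)
    then show ?thesis using A5 by (simp add: sum_distrib_right[symmetric])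
  qed
  have t2: "(\<Sum>a\<le>N. \<Sum>b\<le>N. ?\<alpha> a * (?\<beta> b + (1 / 2) ^ b)) \<le> 35"
  proof -
    have "(\<Sum>a\<le>N. \<Sum>b\<le>N. ?\<alpha> a * (?\<beta> b + (1 / 2) ^ b)) = (\<Sum>a\<le>N. ?\<alpha> a) * (\<Sum>b\<le>N. ?\<beta> b + (1 / 2) ^ b)"
      by (simp only: sum_product)
    also have "\<dots> \<le> 5 * 7"
      using A5 B5 half by (intro mult_mono) (auto simp: sum.distrib intro!: sum_nonneg add_nonneg_nonneg level_weight_nonneg)
    finally show ?thesis by simp
  qed
  have t3: "(\<Sum>a\<le>N. \<Sum>b\<le>N. ?\<beta> b * w2 a b) \<le> 20"
  proof -
    have "(\<Sum>a\<le>N. \<Sum>b\<le>N. ?\<beta> b * w2 a b) = (\<Sum>b\<le>N. ?\<beta> b * (\<Sum>a\<le>N. w2 a b))"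
      unfolding sum_distrib_left by (rule sum.swap)
    also have "\<dots> \<le> (\<Sum>b\<le>N. ?\<beta> b * 4)"
      by (intro sum_mono mult_left_mono sw2 level_weight_nonneg)
    finally show ?thesis using B5 by (simp add: sum_distrib_right[symmetric])
  qed
  have "(\<Sum>a\<le>N. \<Sum>b\<le>N. of_bool (s < 2 ^ (a + b) \<and> card (?A a) \<le> card (?B b)) * (2 ^ (a + b) * pair_count n G (?A a) (?B b)))
     \<le> (\<Sum>a\<le>N. \<Sum>b\<le>N. real n * s * (?\<alpha> a * w1 a b + 16 * (?\<alpha> a * (?\<beta> b + (1 / 2) ^ b)) + 36 * (?\<beta> b * w2 a b)))"
    by (intro sum_mono bnd)
  also have "\<dots> = real n * s * ((\<Sum>a\<le>N. \<Sum>b\<le>N. ?\<alpha> a * w1 a b) + 16 * (\<Sum>a\<le>N. \<Sum>b\<le>N. ?\<alpha> a * (?\<beta> b + (1 / 2) ^ b))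
      + 36 * (\<Sum>a\<le>N. \<Sum>b\<le>N. ?\<beta> b * w2 a b))"
    by (simp only: sum_distrib_left[symmetric] sum.distrib)
  also have "\<dots> \<le> real n * s * 1290" using t1 t2 t3 s by (intro mult_left_mono) auto
  finally show ?thesis by (simp add: mult_ac)
qed

text \<open>The heavy pairs are grouped by their levels. The level estimate wants the smaller set
  first; for the other order the roles of \<open>x\<close> and \<open>y\<close> are exchanged, which
  doubles the constant.\<close>

lemma sum_heavy_pairs_le:
  fixes x y :: "nat \<Rightarrow> real"
  assumes disc: "discrepancy_bounded n s G" and s: "s \<ge> 1"
    and n: "n > 0" "2 + ln (5 * real n) + ln (real n) \<le> real n"
    and x: "x \<in> dyadic_net n" and y: "y \<in> dyadic_net n"
    and degx: "\<And>i. i < n \<Longrightarrow> x i \<noteq> 0 \<Longrightarrow> offdiag_degree n G i \<le> s\<^sup>2"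
    and degy: "\<And>i. i < n \<Longrightarrow> y i \<noteq> 0 \<Longrightarrow> offdiag_degree n G i \<le> s\<^sup>2"
  shows "(\<Sum>i<n. \<Sum>j<n. of_bool (i \<noteq> j \<and> \<bar>x i * y j\<bar> > s) * \<bar>x i * y j\<bar> * of_bool (G {i, j}))
    \<le> 2580 * real n * s"
proof -
  let ?A = "level_set n x" and ?B = "level_set n y"
  have x5: "(\<Sum>i<n. (x i)\<^sup>2) \<le> 5 * real n" and y5: "(\<Sum>i<n. (y i)\<^sup>2) \<le> 5 * real n"
    using x y by (simp_all add: dyadic_net_def)
  have lev: "\<exists>a\<le>n. \<bar>v i\<bar> = 2 ^ a" if "v \<in> dyadic_net n" "i < n" "v i \<noteq> 0" for v i
  proof -
    have "v i \<in> dyadic n" using that by (auto simp: dyadic_net_def PiE_iff)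
    then show ?thesis using that(3) by (auto simp: dyadic_def)
  qed
  define t where "t a b i j = of_bool (s < 2 ^ (a + b)) * (2 ^ (a + b) *
     (of_bool (i \<in> ?A a) * of_bool (j \<in> ?B b) * of_bool (i \<noteq> j \<and> G {i, j})) :: real)" for a b i j
  have t0: "0 \<le> t a b i j" for a b i j by (simp add: t_def)
  have pt: "of_bool (i \<noteq> j \<and> \<bar>x i * y j\<bar> > s) * \<bar>x i * y j\<bar> * of_bool (G {i, j}) \<le> (\<Sum>a\<le>n. \<Sum>b\<le>n. t a b i j)"
    if ij: "i < n" "j < n" for i j
  proof (cases "i \<noteq> j \<and> \<bar>x i * y j\<bar> > s \<and> G {i, j}")
    case True
    then have "x i \<noteq> 0" "y j \<noteq> 0" using s by auto
    then obtain a b where ab: "a \<le> n" "b \<le> n" "\<bar>x i\<bar> = 2 ^ a" "\<bar>y j\<bar> = 2 ^ b"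
      using lev x y ij by meson
    then have xy: "\<bar>x i * y j\<bar> = 2 ^ (a + b)" by (simp add: abs_mult power_add)
    then have "of_bool (i \<noteq> j \<and> \<bar>x i * y j\<bar> > s) * \<bar>x i * y j\<bar> * of_bool (G {i, j}) = t a b i j"
      using True ab ij by (simp add: t_def level_set_def)
    also have "\<dots> \<le> (\<Sum>b\<le>n. t a b i j)"
      by (rule member_le_sum) (use ab t0 in auto)
    also have "\<dots> \<le> (\<Sum>a\<le>n. \<Sum>b\<le>n. t a b i j)"
      by (rule member_le_sum[where f = "\<lambda>a. \<Sum>b\<le>n. t a b i j"]) (use ab t0 in \<open>auto intro: sum_nonneg\<close>)
    finally show ?thesis .
  next
    case False
    then have "of_bool (i \<noteq> j \<and> \<bar>x i * y j\<bar> > s) * \<bar>x i * y j\<bar> * of_bool (G {i, j}) = 0" by auto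
    moreover have "0 \<le> (\<Sum>a\<le>n. \<Sum>b\<le>n. t a b i j)" by (intro sum_nonneg t0)
    ultimately show ?thesis by linarith
  qed
  have "(\<Sum>i<n. \<Sum>j<n. of_bool (i \<noteq> j \<and> \<bar>x i * y j\<bar> > s) * \<bar>x i * y j\<bar> * of_bool (G {i, j}))
     \<le> (\<Sum>i<n. \<Sum>j<n. \<Sum>a\<le>n. \<Sum>b\<le>n. t a b i j)"
    by (intro sum_mono pt) auto
  also have "\<dots> = (\<Sum>i<n. \<Sum>a\<le>n. \<Sum>j<n. \<Sum>b\<le>n. t a b i j)"
    by (intro sum.cong refl sum.swap)
  also have "\<dots> = (\<Sum>a\<le>n. \<Sum>i<n. \<Sum>j<n. \<Sum>b\<le>n. t a b i j)" by (rule sum.swap)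
  also have "\<dots> = (\<Sum>a\<le>n. \<Sum>i<n. \<Sum>b\<le>n. \<Sum>j<n. t a b i j)"
    by (intro sum.cong refl sum.swap)
  also have "\<dots> = (\<Sum>a\<le>n. \<Sum>b\<le>n. \<Sum>i<n. \<Sum>j<n. t a b i j)"
    by (intro sum.cong refl sum.swap)
  also have "\<dots> = (\<Sum>a\<le>n. \<Sum>b\<le>n. of_bool (s < 2 ^ (a + b)) * (2 ^ (a + b) * pair_count n G (?A a) (?B b)))"
    by (simp only: t_def pair_count_def sum_distrib_left)
  also have "\<dots> \<le> (\<Sum>a\<le>n. \<Sum>b\<le>n.
     of_bool (s < 2 ^ (a + b) \<and> card (?A a) \<le> card (?B b)) * (2 ^ (a + b) * pair_count n G (?A a) (?B b))
     + of_bool (s < 2 ^ (b + a) \<and> card (?B b) \<le> card (?A a)) * (2 ^ (b + a) * pair_count n G (?B b) (?A a)))"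
  proof (intro sum_mono)
    fix a b
    have "0 \<le> 2 ^ (a + b) * pair_count n G (?A a) (?B b)" by (simp add: pair_count_nonneg)
    then show "of_bool (s < 2 ^ (a + b)) * (2 ^ (a + b) * pair_count n G (?A a) (?B b)) \<le>
      of_bool (s < 2 ^ (a + b) \<and> card (?A a) \<le> card (?B b)) * (2 ^ (a + b) * pair_count n G (?A a) (?B b))
     + of_bool (s < 2 ^ (b + a) \<and> card (?B b) \<le> card (?A a)) * (2 ^ (b + a) * pair_count n G (?B b) (?A a))"
      unfolding pair_count_commute[of n G "?B b"] add.commute[of b a]
      by (cases "card (?A a) \<le> card (?B b)") auto
  qed
  also have "\<dots> = (\<Sum>a\<le>n. \<Sum>b\<le>n. of_bool (s < 2 ^ (a + b) \<and> card (?A a) \<le> card (?B b)) * (2 ^ (a + b) * pair_count n G (?A a) (?B b)))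
     + (\<Sum>b\<le>n. \<Sum>a\<le>n. of_bool (s < 2 ^ (b + a) \<and> card (?B b) \<le> card (?A a)) * (2 ^ (b + a) * pair_count n G (?B b) (?A a)))"
    unfolding sum.distrib
    by (rule arg_cong2[of _ _ _ _ "(+)", OF refl sum.swap])
  also have "\<dots> \<le> 1290 * real n * s + 1290 * real n * s"
    by (intro add_mono sum_heavy_levels_le disc s n x5 y5 degx degy)
  also have "\<dots> = 2580 * real n * s" by simp
  finally show ?thesis .
qed

section \<open>The centered bilinear form off the hubs\<close>

definition offdiag_form :: "nat \<Rightarrow> (nat \<Rightarrow> nat \<Rightarrow> real) \<Rightarrow> (nat set \<Rightarrow> bool) \<Rightarrow> (nat \<Rightarrow> real) \<Rightarrow> (nat \<Rightarrow> real) \<Rightarrow> real" where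
  "offdiag_form n p G x y = (\<Sum>i<n. \<Sum>j<n. of_bool (i \<noteq> j) * (of_bool (G {i, j}) - p i j) * (x i * y j))"

text \<open>Three contributions: light pairs 56, heavy edges 2580, and the mean over heavy pairs 25.
  For the last, heaviness gives \<open>s * |x i * y j| <= (x i * y j)^2\<close>, so the mean is at
  most \<open>s / n\<close> times the product of the squared norms.\<close>

lemma offdiag_form_net_le:
  assumes p: "edge_probabilities n p"
    and ps: "\<And>i j. i < n \<Longrightarrow> j < n \<Longrightarrow> i \<noteq> j \<Longrightarrow> p i j \<le> s\<^sup>2 / real n"
    and light: "light_sum n p s G x y \<le> 56 * s * real n"
    and disc: "discrepancy_bounded n s G" and s: "s \<ge> 1"
    and n: "n > 0" "2 + ln (5 * real n) + ln (real n) \<le> real n"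
    and x: "x \<in> dyadic_net n" and y: "y \<in> dyadic_net n"
    and degx: "\<And>i. i < n \<Longrightarrow> x i \<noteq> 0 \<Longrightarrow> offdiag_degree n G i \<le> s\<^sup>2"
    and degy: "\<And>i. i < n \<Longrightarrow> y i \<noteq> 0 \<Longrightarrow> offdiag_degree n G i \<le> s\<^sup>2"
  shows "offdiag_form n p G x y \<le> 2661 * real n * s"
proof -
  have x5: "(\<Sum>i<n. (x i)\<^sup>2) \<le> 5 * real n" and y5: "(\<Sum>i<n. (y i)\<^sup>2) \<le> 5 * real n"
    using x y by (simp_all add: dyadic_net_def)
  have "offdiag_form n p G x y \<le> (\<Sum>i<n. \<Sum>j<n.
      of_bool (i \<noteq> j \<and> \<bar>x i * y j\<bar> \<le> s) * (x i * y j) * (of_bool (G {i, j}) - p i j)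
      + of_bool (i \<noteq> j \<and> \<bar>x i * y j\<bar> > s) * \<bar>x i * y j\<bar> * of_bool (G {i, j})
      + (x i)\<^sup>2 * (y j)\<^sup>2 * (s / real n))"
    unfolding offdiag_form_def
  proof (intro sum_mono)
    fix i j assume "i \<in> {..<n}" "j \<in> {..<n}"
    then have ij: "i < n" "j < n" by auto
    have p0: "0 \<le> p i j" using p ij by (simp add: edge_probabilities_def)
    let ?R = "of_bool (i \<noteq> j \<and> \<bar>x i * y j\<bar> \<le> s) * (x i * y j) * (of_bool (G {i, j}) - p i j)
      + of_bool (i \<noteq> j \<and> \<bar>x i * y j\<bar> > s) * \<bar>x i * y j\<bar> * of_bool (G {i, j})
      + (x i)\<^sup>2 * (y j)\<^sup>2 * (s / real n)"
    have sq0: "0 \<le> (x i)\<^sup>2 * (y j)\<^sup>2 * (s / real n)" using s by simp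
    consider "i = j" | "i \<noteq> j" "\<bar>x i * y j\<bar> \<le> s" | "i \<noteq> j" "\<bar>x i * y j\<bar> > s" by linarith
    then show "of_bool (i \<noteq> j) * (of_bool (G {i, j}) - p i j) * (x i * y j) \<le> ?R"
    proof cases
      case 3
      have "- (p i j * (x i * y j)) \<le> p i j * \<bar>x i * y j\<bar>"
        using mult_left_mono[OF abs_ge_minus_self[of "x i * y j"] p0] by simp
      also have "\<dots> \<le> (s\<^sup>2 / real n) * \<bar>x i * y j\<bar>" using ps[OF ij 3(1)] by (intro mult_right_mono) auto
      also have "\<dots> = (s / real n) * (s * \<bar>x i * y j\<bar>)" by (simp add: power2_eq_square)
      also have "\<dots> \<le> (s / real n) * (\<bar>x i * y j\<bar> * \<bar>x i * y j\<bar>)"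
        using 3 s by (intro mult_left_mono mult_right_mono) auto
      also have "\<bar>x i * y j\<bar> * \<bar>x i * y j\<bar> = (x i)\<^sup>2 * (y j)\<^sup>2"
        by (simp add: power2_eq_square[symmetric] power_mult_distrib)
      finally have "- (p i j * (x i * y j)) \<le> (x i)\<^sup>2 * (y j)\<^sup>2 * (s / real n)" by (simp only: mult.commute)
      moreover have "of_bool (G {i, j}) * (x i * y j) \<le> \<bar>x i * y j\<bar> * of_bool (G {i, j})"
        using abs_ge_self[of "x i * y j"] by auto
      ultimately show ?thesis using 3 by (simp add: left_diff_distrib)
    qed (use sq0 in auto)
  qed
  also have "\<dots> = light_sum n p s G x y
      + (\<Sum>i<n. \<Sum>j<n. of_bool (i \<noteq> j \<and> \<bar>x i * y j\<bar> > s) * \<bar>x i * y j\<bar> * of_bool (G {i, j}))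
      + (\<Sum>i<n. (x i)\<^sup>2) * (\<Sum>j<n. (y j)\<^sup>2) * (s / real n)"
  proof -
    have "(\<Sum>i<n. (x i)\<^sup>2) * (\<Sum>j<n. (y j)\<^sup>2) * (s / real n) = (\<Sum>i<n. \<Sum>j<n. (x i)\<^sup>2 * (y j)\<^sup>2 * (s / real n))"
      unfolding sum_product by (simp only: sum_distrib_right)
    then show ?thesis by (simp only: sum.distrib light_sum_def)
  qed
  also have "\<dots> \<le> 56 * s * real n + 2580 * real n * s + (5 * real n) * (5 * real n) * (s / real n)"
  proof (intro add_mono light)
    show "(\<Sum>i<n. \<Sum>j<n. of_bool (i \<noteq> j \<and> \<bar>x i * y j\<bar> > s) * \<bar>x i * y j\<bar> * of_bool (G {i, j})) \<le> 2580 * real n * s"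
      by (rule sum_heavy_pairs_le[OF disc s n x y degx degy])
    show "(\<Sum>i<n. (x i)\<^sup>2) * (\<Sum>j<n. (y j)\<^sup>2) * (s / real n) \<le> (5 * real n) * (5 * real n) * (s / real n)"
      by (rule mult_right_mono[OF mult_mono[OF x5 y5]]) (use s in \<open>simp_all add: sum_nonneg\<close>)
  qed
  also have "\<dots> = 2661 * real n * s" using n by simp
  finally show ?thesis .
qed

text \<open>If \<open>c * w\<close> is not positive, round \<open>c\<close> to 0, otherwise away
  from zero to the next power of two. An entry at most 1 in absolute value becomes at most 1 and a
  larger one at most doubles. Zero stays zero, so rounding never leaves the low-degree
  vertices.\<close>

lemma dyadic_rounding:
  fixes c w :: real
  assumes "c\<^sup>2 \<le> real n"
  shows "\<exists>v\<in>dyadic n. c * w \<le> v * w \<and> v\<^sup>2 \<le> 1 + 4 * c\<^sup>2 \<and> (c = 0 \<longrightarrow> v = 0)"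
proof (cases "c * w \<le> 0")
  case True then show ?thesis by (intro bexI[of _ 0]) (auto simp: dyadic_def)
next
  case False
  have "\<bar>c\<bar> \<le> 2 ^ n"
  proof -
    have "real n \<le> 2 ^ n" using of_nat_less_two_power[of n, where ?'a = real] by simp
    also have "\<dots> \<le> (2 ^ n)\<^sup>2" by (simp add: power2_eq_square)
    finally have "\<bar>c\<bar>\<^sup>2 \<le> (2 ^ n)\<^sup>2" using assms by simp
    then show ?thesis by (rule power2_le_imp_le) simp
  qed
  define a where "a = (LEAST a. \<bar>c\<bar> \<le> 2 ^ a)"
  have a: "\<bar>c\<bar> \<le> 2 ^ a" "a \<le> n" unfolding a_def
    using \<open>\<bar>c\<bar> \<le> 2 ^ n\<close> by (auto intro: LeastI Least_le)
  have sq: "(2 ^ a)\<^sup>2 \<le> 1 + 4 * c\<^sup>2"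
  proof (cases a)
    case (Suc b)
    then have "\<not> \<bar>c\<bar> \<le> 2 ^ b" using not_less_Least[of b "\<lambda>a. \<bar>c\<bar> \<le> 2 ^ a"] by (simp add: a_def)
    then have "(2 ^ b)\<^sup>2 \<le> \<bar>c\<bar>\<^sup>2" by (intro power_mono) auto
    moreover have "((2 :: real) ^ a)\<^sup>2 = 4 * (2 ^ b)\<^sup>2" by (simp add: Suc power_mult_distrib)
    ultimately show ?thesis by simp
  qed simp
  have c0: "c \<noteq> 0" using False by auto
  show ?thesis
  proof (cases "c > 0")
    case True
    then have "w \<ge> 0" using False by (simp add: zero_less_mult_iff not_le)
    then have "c * w \<le> 2 ^ a * w" using a(1) True by (intro mult_right_mono) auto
    then show ?thesis using sq a(2) c0 by (intro bexI[of _ "2 ^ a"]) (auto simp: dyadic_def)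
  next
    case F: False
    then have "w \<le> 0" using False by (simp add: zero_less_mult_iff not_le)
    then have "c * w \<le> - (2 ^ a) * w" using a(1) F by (intro mult_right_mono_neg) auto
    then show ?thesis using sq a(2) c0 by (intro bexI[of _ "- (2 ^ a)"]) (auto simp: dyadic_def)
  qed
qed

lemma dyadic_net_rounding:
  fixes f w :: "nat \<Rightarrow> real"
  assumes f: "(\<Sum>i<n. (f i)\<^sup>2) \<le> real n"
  obtains x where "x \<in> dyadic_net n" "\<And>i. i < n \<Longrightarrow> x i \<noteq> 0 \<Longrightarrow> f i \<noteq> 0"
    "(\<Sum>i<n. f i * w i) \<le> (\<Sum>i<n. x i * w i)"
proof -
  have fi: "(f i)\<^sup>2 \<le> real n" if "i < n" for i
    using member_le_sum[of i "{..<n}" "\<lambda>i. (f i)\<^sup>2"] that f by auto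
  have "\<forall>i\<in>{..<n}. \<exists>v. v \<in> dyadic n \<and> f i * w i \<le> v * w i \<and> v\<^sup>2 \<le> 1 + 4 * (f i)\<^sup>2 \<and> (f i = 0 \<longrightarrow> v = 0)"
    using dyadic_rounding[OF fi] by (simp add: Bex_def)
  then obtain v where v: "\<And>i. i < n \<Longrightarrow> v i \<in> dyadic n \<and> f i * w i \<le> v i * w i \<and> (v i)\<^sup>2 \<le> 1 + 4 * (f i)\<^sup>2 \<and> (f i = 0 \<longrightarrow> v i = 0)"
    using bchoice[of "{..<n}"] by (metis lessThan_iff)
  let ?x = "restrict v {..<n}"
  show thesis
  proof (rule that[of ?x])
    have "(\<Sum>i<n. (?x i)\<^sup>2) \<le> (\<Sum>i<n. 1 + 4 * (f i)\<^sup>2)" by (rule sum_mono) (use v in auto)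
    also have "\<dots> = real n + 4 * (\<Sum>i<n. (f i)\<^sup>2)" by (simp add: sum.distrib sum_distrib_left)
    also have "\<dots> \<le> 5 * real n" using f by simp
    finally show "?x \<in> dyadic_net n" using v by (auto simp: dyadic_net_def)
    show "(\<Sum>i<n. f i * w i) \<le> (\<Sum>i<n. ?x i * w i)" by (rule sum_mono) (use v in auto)
    show "f i \<noteq> 0" if "i < n" "?x i \<noteq> 0" for i using that v by auto
  qed
qed

text \<open>The bilinear form is linear in each argument, so rounding each coordinate in the right
  direction does not decrease it and only net vectors need to be tested.\<close>

lemma offdiag_form_bound:
  assumes p: "edge_probabilities n p"
    and ps: "\<And>i j. i < n \<Longrightarrow> j < n \<Longrightarrow> i \<noteq> j \<Longrightarrow> p i j \<le> s\<^sup>2 / real n"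
    and light: "\<And>x y. x \<in> dyadic_net n \<Longrightarrow> y \<in> dyadic_net n \<Longrightarrow> light_sum n p s G x y \<le> 56 * s * real n"
    and disc: "discrepancy_bounded n s G" and s: "s \<ge> 1"
    and n: "n > 0" "2 + ln (5 * real n) + ln (real n) \<le> real n"
    and deg: "\<And>i. i < n \<Longrightarrow> f i \<noteq> 0 \<Longrightarrow> offdiag_degree n G i \<le> s\<^sup>2"
  shows "\<bar>offdiag_form n p G f f\<bar> \<le> 2661 * s * (\<Sum>i<n. (f i)\<^sup>2)"
proof -
  have bil: "offdiag_form n p G g h \<le> 2661 * real n * s"
    if g: "(\<Sum>i<n. (g i)\<^sup>2) \<le> real n" "\<And>i. i < n \<Longrightarrow> g i \<noteq> 0 \<Longrightarrow> f i \<noteq> 0"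
      and h: "(\<Sum>i<n. (h i)\<^sup>2) \<le> real n" "\<And>i. i < n \<Longrightarrow> h i \<noteq> 0 \<Longrightarrow> f i \<noteq> 0" for g h
  proof -
    let ?m = "\<lambda>i j. of_bool (i \<noteq> j) * (of_bool (G {i, j}) - p i j)"
    have form1: "offdiag_form n p G g h = (\<Sum>i<n. g i * (\<Sum>j<n. ?m i j * h j))" for g h
      unfolding offdiag_form_def sum_distrib_left by (intro sum.cong refl) (simp only: mult_ac)
    have form2: "offdiag_form n p G g h = (\<Sum>j<n. h j * (\<Sum>i<n. ?m i j * g i))" for g h
    proof -
      have "offdiag_form n p G g h = (\<Sum>j<n. \<Sum>i<n. ?m i j * (g i * h j))"
        unfolding offdiag_form_def by (rule sum.swap)
      also have "\<dots> = (\<Sum>j<n. \<Sum>i<n. h j * (?m i j * g i))"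
        by (intro sum.cong refl) (simp only: mult_ac)
      finally show ?thesis by (simp only: sum_distrib_left)
    qed
    obtain x where x: "x \<in> dyadic_net n" "\<And>i. i < n \<Longrightarrow> x i \<noteq> 0 \<Longrightarrow> g i \<noteq> 0"
      "(\<Sum>i<n. g i * (\<Sum>j<n. ?m i j * h j)) \<le> (\<Sum>i<n. x i * (\<Sum>j<n. ?m i j * h j))"
      by (rule dyadic_net_rounding[OF g(1), of "\<lambda>i. \<Sum>j<n. ?m i j * h j"]) (rule that, assumption, blast, assumption)
    obtain y where y: "y \<in> dyadic_net n" "\<And>i. i < n \<Longrightarrow> y i \<noteq> 0 \<Longrightarrow> h i \<noteq> 0"
      "(\<Sum>j<n. h j * (\<Sum>i<n. ?m i j * x i)) \<le> (\<Sum>j<n. y j * (\<Sum>i<n. ?m i j * x i))"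
      by (rule dyadic_net_rounding[OF h(1), of "\<lambda>j. \<Sum>i<n. ?m i j * x i"]) (rule that, assumption, blast, assumption)
    have "offdiag_form n p G g h \<le> offdiag_form n p G x h" using x(3) by (simp only: form1)
    also have "\<dots> \<le> offdiag_form n p G x y" using y(3) by (simp only: form2)
    also have "\<dots> \<le> 2661 * real n * s"
    proof (rule offdiag_form_net_le[OF p ps light[OF x(1) y(1)] disc s n x(1) y(1)])
      show "offdiag_degree n G i \<le> s\<^sup>2" if "i < n" "x i \<noteq> 0" for i using deg g(2) x(2) that by blast
      show "offdiag_degree n G i \<le> s\<^sup>2" if "i < n" "y i \<noteq> 0" for i using deg h(2) y(2) that by blast
    qed
    finally show ?thesis .
  qed
  define S where "S = (\<Sum>i<n. (f i)\<^sup>2)"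
  show ?thesis
  proof (cases "S = 0")
    case True
    then have "\<forall>i\<in>{..<n}. (f i)\<^sup>2 = 0" unfolding S_def by (subst (asm) sum_nonneg_eq_0_iff) auto
    then have "offdiag_form n p G f f = 0" unfolding offdiag_form_def by (intro sum.neutral ballI) auto
    then show ?thesis using True by (simp add: S_def)
  next
    case False
    then have S: "S > 0" unfolding S_def by (simp add: less_le sum_nonneg)
    \<comment> \<open>This scales \<open>f\<close> to squared norm n, the normalisation of the
      net.\<close>
    define c where "c = sqrt (real n / S)"
    have c: "c\<^sup>2 = real n / S" using S by (simp add: c_def)
    have scale: "offdiag_form n p G (\<lambda>i. a * f i) (\<lambda>i. b * f i) = a * b * offdiag_form n p G f f" for a b
      unfolding offdiag_form_def sum_distrib_left by (intro sum.cong refl) (simp only: mult_ac)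
    have nrm: "(\<Sum>i<n. (a * f i)\<^sup>2) \<le> real n" if "a\<^sup>2 = c\<^sup>2" for a
    proof -
      have "(\<Sum>i<n. (a * f i)\<^sup>2) = c\<^sup>2 * S" by (simp add: S_def power_mult_distrib sum_distrib_left that)
      then show ?thesis using S by (simp add: c)
    qed
    have 1: "offdiag_form n p G (\<lambda>i. c * f i) (\<lambda>i. c * f i) \<le> 2661 * real n * s"
      by (rule bil) (auto intro!: nrm)
    \<comment> \<open>Flipping the sign of one argument bounds the form from below, so the bilinear
      estimate covers the absolute value.\<close>
    have 2: "offdiag_form n p G (\<lambda>i. c * f i) (\<lambda>i. - c * f i) \<le> 2661 * real n * s"
      by (rule bil[OF nrm _ nrm]) auto
    have "c\<^sup>2 * \<bar>offdiag_form n p G f f\<bar> \<le> 2661 * real n * s"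
      using 1 2 unfolding scale by (simp add: abs_if power2_eq_square)
    then have "real n / S * \<bar>offdiag_form n p G f f\<bar> \<le> 2661 * real n * s" by (simp only: c)
    then have "real n * \<bar>offdiag_form n p G f f\<bar> \<le> real n * (2661 * s * S)"
      using S by (simp add: pos_divide_le_eq mult_ac)
    then show ?thesis using n(1) by (simp add: S_def)
  qed
qed

section \<open>Stars around hubs\<close>

definition adjacent :: "(nat set \<Rightarrow> bool) \<Rightarrow> nat \<Rightarrow> nat \<Rightarrow> bool" where
  "adjacent G i j \<longleftrightarrow> i \<noteq> j \<and> G {i, j}"

definition hub_set :: "nat \<Rightarrow> (nat set \<Rightarrow> bool) \<Rightarrow> real \<Rightarrow> nat set" where
  "hub_set n G t = {x. x < n \<and> t \<le> offdiag_degree n G x}"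

lemma adjacent_commute: "adjacent G i j \<longleftrightarrow> adjacent G j i"
  by (auto simp: adjacent_def insert_commute)

lemma finite_hub_set [simp]: "finite (hub_set n G t)"
  by (rule finite_subset[of _ "{..<n}"]) (auto simp: hub_set_def)

lemma offdiag_degree_eq_card: "offdiag_degree n G i = real (card {j. j < n \<and> adjacent G i j})"
proof -
  have "{..<n} \<inter> {j. i \<noteq> j \<and> G {i, j}} = {j. j < n \<and> adjacent G i j}" by (auto simp: adjacent_def)
  then show ?thesis unfolding offdiag_degree_def by (subst sum_of_bool_eq) simp_all
qed

lemma degree_of_eq: "i < n \<Longrightarrow> degree_of n G i = of_bool (G {i}) + offdiag_degree n G i"
proof -
  assume i: "i < n"
  have "degree_of n G i = (\<Sum>j<n. of_bool (G {i, j}))"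
    unfolding degree_of_def adj_mat_def using i by simp
  also have "\<dots> = of_bool (G {i}) + (\<Sum>j\<in>{..<n} - {i}. of_bool (G {i, j}))"
    using i by (subst sum.remove[of _ i]) auto
  also have "(\<Sum>j\<in>{..<n} - {i}. of_bool (G {i, j})) = (\<Sum>j\<in>{..<n} - {i}. of_bool (i \<noteq> j \<and> G {i, j}) :: real)"
    by (intro sum.cong refl) auto
  also have "\<dots> = offdiag_degree n G i"
    unfolding offdiag_degree_def using i by (intro sum.mono_neutral_left) auto
  finally show ?thesis .
qed

lemma sum_single_column:
  fixes c :: "nat \<Rightarrow> real" assumes "finite X"
  shows "(\<Sum>x\<in>X. c x * of_bool (i = x)) = (if i \<in> X then c i else 0)"
proof -
  have "(\<Sum>x\<in>X. c x * of_bool (i = x)) = (\<Sum>x\<in>X. if i = x then c x else 0)"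
    by (intro sum.cong refl) auto
  then show ?thesis using assms by simp
qed

text \<open>The deterministic half of the argument: the assumptions list everything the random graph
  has to provide. \<open>\<tau>\<close> is the hub threshold, \<open>\<rho>\<close> the noise level
  off the hubs, \<open>r\<close> controls the irregular edges at hubs, and \<open>few_hubs\<close>
  is tuned to \<open>mean_form_bound\<close>.\<close>

locale hub_graph =
  fixes n :: nat and p :: "nat \<Rightarrow> nat \<Rightarrow> real" and G :: "nat set \<Rightarrow> bool"
    and \<tau> \<rho> d P :: real and r :: nat
  assumes p: "edge_probabilities n p"
    and nonneg: "0 \<le> \<tau>" "0 \<le> \<rho>" "0 \<le> P"
    and form_U: "\<And>f. (\<And>i. i < n \<Longrightarrow> f i \<noteq> 0 \<Longrightarrow> offdiag_degree n G i < \<tau>) \<Longrightarrow>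
        \<bar>offdiag_form n p G f f\<bar> \<le> \<rho> * (\<Sum>i<n. (f i)\<^sup>2)"
    and few_hub_neighbours: "\<And>z. z < n \<Longrightarrow> card {y \<in> hub_set n G \<tau>. adjacent G z y} \<le> r"
    and few_bad_leaves: "\<And>x. x \<in> hub_set n G \<tau> \<Longrightarrow>
        card {z. z < n \<and> z \<notin> hub_set n G \<tau> \<and> adjacent G x z \<and> (\<exists>y\<in>hub_set n G \<tau>. y \<noteq> x \<and> adjacent G z y)} \<le> 2 * r"
    and d: "0 < d" "\<And>i. i < n \<Longrightarrow> (\<Sum>j<n. p i j) \<le> d"
    and P: "\<And>i j. i < n \<Longrightarrow> j < n \<Longrightarrow> i \<noteq> j \<Longrightarrow> p i j \<le> P"
    and few_hubs: "d * (real (card (hub_set n G \<tau>)) * P) \<le> 1"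
begin

abbreviation "V \<equiv> hub_set n G \<tau>"

text \<open>Neighbours shared with another hub are dropped. This makes the stars pairwise disjoint
  and costs at most 2 r leaves per hub.\<close>

definition leaves :: "nat \<Rightarrow> nat set" where
  "leaves x = {z. z < n \<and> z \<notin> V \<and> adjacent G x z \<and> (\<forall>y\<in>V. adjacent G z y \<longrightarrow> y = x)}"

definition bad :: "nat \<Rightarrow> nat \<Rightarrow> bool" where
  "bad i j \<longleftrightarrow> adjacent G i j \<and> (i \<in> V \<or> j \<in> V) \<and> \<not> (i \<in> V \<and> j \<in> leaves i) \<and> \<not> (j \<in> V \<and> i \<in> leaves j)"

definition star_form :: "(nat \<Rightarrow> real) \<Rightarrow> real" where
  "star_form f = (\<Sum>x\<in>V. 2 * f x * (\<Sum>z\<in>leaves x. f z))"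

definition sqnorm :: "(nat \<Rightarrow> real) \<Rightarrow> real" where
  "sqnorm f = (\<Sum>i<n. (f i)\<^sup>2)"

definition centered_form :: "(nat \<Rightarrow> real) \<Rightarrow> real" where
  "centered_form f = (\<Sum>i<n. \<Sum>j<n. centered_adj_mat n p G $$ (i, j) * f i * f j)"

lemma V_less: "x \<in> V \<Longrightarrow> x < n" by (simp add: hub_set_def)

lemma leaves_subset: "leaves x \<subseteq> {..<n}" by (auto simp: leaves_def)

lemma finite_leaves [simp]: "finite (leaves x)"
  by (rule finite_subset[OF leaves_subset]) simp

lemma leaves_disjoint: "x \<in> V \<Longrightarrow> y \<in> V \<Longrightarrow> x \<noteq> y \<Longrightarrow> leaves x \<inter> leaves y = {}"
  unfolding leaves_def using adjacent_commute by fastforce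

lemma leaves_not_V: "z \<in> leaves x \<Longrightarrow> z \<notin> V" by (simp add: leaves_def)

lemma sqnorm_nonneg: "0 \<le> sqnorm f" by (simp add: sqnorm_def sum_nonneg)

lemma card_leaves_le: "real (card (leaves x)) \<le> offdiag_degree n G x"
  unfolding offdiag_degree_eq_card of_nat_le_iff by (rule card_mono) (auto simp: leaves_def)

text \<open>A hub has at most r hub neighbours and at most 2 r neighbours shared with other hubs.
  For a vertex that is not a hub, every bad neighbour is a hub.\<close>

lemma card_bad: "card {j. j < n \<and> bad i j} \<le> 3 * r" if i: "i < n"
proof (cases "i \<in> V")
  case True
  let ?A = "{y \<in> V. adjacent G i y}"
  let ?B = "{z. z < n \<and> z \<notin> V \<and> adjacent G i z \<and> (\<exists>y\<in>V. y \<noteq> i \<and> adjacent G z y)}"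
  have "{j. j < n \<and> bad i j} \<subseteq> ?A \<union> ?B" using True by (auto simp: bad_def leaves_def)
  moreover have fin: "finite (?A \<union> ?B)" by simp
  ultimately have "card {j. j < n \<and> bad i j} \<le> card (?A \<union> ?B)" by (intro card_mono)
  also have "\<dots> \<le> card ?A + card ?B" by (rule card_Un_le)
  also have "\<dots> \<le> r + 2 * r" using few_hub_neighbours[OF i] few_bad_leaves[OF True] by linarith
  finally show ?thesis by simp
next
  case False
  have "{j. j < n \<and> bad i j} \<subseteq> {y \<in> V. adjacent G i y}" using False by (auto simp: bad_def)
  then have "card {j. j < n \<and> bad i j} \<le> card {y \<in> V. adjacent G i y}" by (intro card_mono) simp_all
  then show ?thesis using few_hub_neighbours[OF i] by linarith
qed

lemma bad_commute: "bad i j \<longleftrightarrow> bad j i" unfolding bad_def using adjacent_commute by blast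

lemma offdiag_degree_le_leaves: "x \<in> V \<Longrightarrow> offdiag_degree n G x \<le> real (card (leaves x)) + 3 * real r"
proof -
  assume x: "x \<in> V"
  have "{j. j < n \<and> adjacent G x j} \<subseteq> leaves x \<union> {j. j < n \<and> bad x j}"
    using x leaves_not_V by (auto simp: bad_def)
  then have "card {j. j < n \<and> adjacent G x j} \<le> card (leaves x \<union> {j. j < n \<and> bad x j})" by (intro card_mono) simp_all
  also have "\<dots> \<le> card (leaves x) + card {j. j < n \<and> bad x j}" by (rule card_Un_le)
  also have "\<dots> \<le> card (leaves x) + 3 * r" using card_bad[OF V_less[OF x]] by simp
  finally have "real (card {j. j < n \<and> adjacent G x j}) \<le> real (card (leaves x) + 3 * r)" by (simp only: of_nat_le_iff)
  then show ?thesis unfolding offdiag_degree_eq_card by simp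
qed

lemma sum_restrict_lessThan: "A \<subseteq> {..<n} \<Longrightarrow> (\<Sum>i<n. of_bool (i \<in> A) * h i) = (\<Sum>i\<in>A. h i)" for h :: "nat \<Rightarrow> real"
  by (rule sum.mono_neutral_cong_right) auto

text \<open>For a symmetric 0-1 matrix the row sums bound the form, by
  \<open>|a * b| <= (a^2 + b^2) / 2\<close>; the row sums are at most 3 r.\<close>

lemma bad_form_bound: "\<bar>\<Sum>i<n. \<Sum>j<n. of_bool (bad i j) * (f i * f j)\<bar> \<le> 3 * real r * sqnorm f"
proof -
  have "\<bar>\<Sum>i<n. \<Sum>j<n. of_bool (bad i j) * (f i * f j)\<bar> \<le> (\<Sum>i<n. \<Sum>j<n. \<bar>of_bool (bad i j) * (f i * f j)\<bar>)"
    by (rule order_trans[OF sum_abs]) (intro sum_mono sum_abs)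
  also have "\<dots> \<le> (\<Sum>i<n. \<Sum>j<n. of_bool (bad i j) * ((f i)\<^sup>2 / 2) + of_bool (bad j i) * ((f j)\<^sup>2 / 2))"
  proof (intro sum_mono)
    fix i j
    have "0 \<le> (\<bar>f i\<bar> - \<bar>f j\<bar>)\<^sup>2" by simp
    then have "\<bar>f i * f j\<bar> \<le> (f i)\<^sup>2 / 2 + (f j)\<^sup>2 / 2"
      unfolding power2_diff abs_mult by simp
    then show "\<bar>of_bool (bad i j) * (f i * f j)\<bar> \<le> of_bool (bad i j) * ((f i)\<^sup>2 / 2) + of_bool (bad j i) * ((f j)\<^sup>2 / 2)"
      by (simp add: bad_commute[of j i] of_bool_def)
  qed
  also have "\<dots> = (\<Sum>i<n. \<Sum>j<n. of_bool (bad i j) * ((f i)\<^sup>2 / 2)) + (\<Sum>j<n. \<Sum>i<n. of_bool (bad j i) * ((f j)\<^sup>2 / 2))"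
    unfolding sum.distrib by (rule arg_cong2[of _ _ _ _ "(+)", OF refl sum.swap])
  also have "\<dots> = (\<Sum>i<n. (\<Sum>j<n. of_bool (bad i j)) * (f i)\<^sup>2)"
    by (simp add: sum.distrib[symmetric] sum_distrib_right[symmetric])
  also have "\<dots> \<le> (\<Sum>i<n. 3 * real r * (f i)\<^sup>2)"
  proof (intro sum_mono mult_right_mono)
    fix i assume "i \<in> {..<n}"
    then have "card {j. j < n \<and> bad i j} \<le> 3 * r" by (intro card_bad) simp
    moreover have "{..<n} \<inter> {j. bad i j} = {j. j < n \<and> bad i j}" by auto
    ultimately show "(\<Sum>j<n. of_bool (bad i j)) \<le> 3 * real r"
      by (subst sum_of_bool_eq) simp_all
  qed simp
  finally show ?thesis by (simp add: sqnorm_def sum_distrib_left)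
qed

text \<open>The unweighted inequality would lose a factor \<open>d\<close>. Weighting it by
  \<open>d\<close> balances the two sides: the square of the hub coordinate is divided by
  \<open>d\<close>, which the row sum cancels, and the other square gets \<open>d\<close>, which is
  affordable because only hub rows occur and \<open>d * (card V * P) <= 1\<close>.\<close>

lemma mean_form_bound:
  "\<bar>\<Sum>i<n. \<Sum>j<n. of_bool ((i \<in> V \<or> j \<in> V) \<and> i \<noteq> j) * (p i j * (f i * f j))\<bar> \<le> 2 * sqnorm f"
proof -
  define h where "h i j = of_bool (i \<in> V \<and> i \<noteq> j) * (p i j * ((f i)\<^sup>2 / d + d * (f j)\<^sup>2) / 2)" for i j
  have p0: "0 \<le> p i j" and pc: "p i j = p j i" if "i < n" "j < n" for i j
    using p that unfolding edge_probabilities_def by blast+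
  have am: "\<bar>a * b\<bar> \<le> (a\<^sup>2 / d + d * b\<^sup>2) / 2" for a b :: real
  proof -
    have "0 \<le> (\<bar>a\<bar> - d * \<bar>b\<bar>)\<^sup>2" by simp
    then have "2 * d * \<bar>a * b\<bar> \<le> a\<^sup>2 + d\<^sup>2 * b\<^sup>2"
      unfolding power2_diff abs_mult by (simp add: power_mult_distrib mult_ac)
    also have "\<dots> = 2 * d * ((a\<^sup>2 / d + d * b\<^sup>2) / 2)" using d(1) by (simp add: field_simps power2_eq_square)
    finally show ?thesis using d(1) by simp
  qed
  have "\<bar>\<Sum>i<n. \<Sum>j<n. of_bool ((i \<in> V \<or> j \<in> V) \<and> i \<noteq> j) * (p i j * (f i * f j))\<bar>
     \<le> (\<Sum>i<n. \<Sum>j<n. \<bar>of_bool ((i \<in> V \<or> j \<in> V) \<and> i \<noteq> j) * (p i j * (f i * f j))\<bar>)"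
    by (rule order_trans[OF sum_abs]) (intro sum_mono sum_abs)
  also have "\<dots> \<le> (\<Sum>i<n. \<Sum>j<n. h i j + h j i)"
  proof (intro sum_mono)
    fix i j assume "i \<in> {..<n}" "j \<in> {..<n}"
    then have ij: "i < n" "j < n" by auto
    have b: "p i j * \<bar>f i * f j\<bar> \<le> p i j * ((f i)\<^sup>2 / d + d * (f j)\<^sup>2) / 2"
      "p i j * \<bar>f i * f j\<bar> \<le> p i j * ((f j)\<^sup>2 / d + d * (f i)\<^sup>2) / 2"
      using mult_left_mono[OF am[of "f i" "f j"] p0[OF ij]] mult_left_mono[OF am[of "f j" "f i"] p0[OF ij]]
      by (simp_all add: mult.commute[of "f j"])
    have h0: "0 \<le> h i j" "0 \<le> h j i" using p0[OF ij] p0[OF ij(2,1)] d(1) by (simp_all add: h_def)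
    have l: "\<bar>of_bool ((i \<in> V \<or> j \<in> V) \<and> i \<noteq> j) * (p i j * (f i * f j))\<bar> = of_bool ((i \<in> V \<or> j \<in> V) \<and> i \<noteq> j) * (p i j * \<bar>f i * f j\<bar>)"
      using p0[OF ij] by (simp add: abs_mult)
    consider "i = j" | "i \<in> V" "i \<noteq> j" | "j \<in> V" "i \<noteq> j" | "i \<notin> V" "j \<notin> V" by blast
    then show "\<bar>of_bool ((i \<in> V \<or> j \<in> V) \<and> i \<noteq> j) * (p i j * (f i * f j))\<bar> \<le> h i j + h j i"
    proof cases
      case 2
      then have "p i j * \<bar>f i * f j\<bar> \<le> h i j" using b(1) by (simp add: h_def)
      then show ?thesis unfolding l using 2 h0 by simp
    next
      case 3
      then have "p i j * \<bar>f i * f j\<bar> \<le> h j i" using b(2) pc[OF ij] by (simp add: h_def)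
      then show ?thesis unfolding l using 3 h0 by simp
    qed (use h0 in simp_all)
  qed
  also have "\<dots> = (\<Sum>i<n. \<Sum>j<n. h i j) + (\<Sum>j<n. \<Sum>i<n. h j i)"
    unfolding sum.distrib by (rule arg_cong2[of _ _ _ _ "(+)", OF refl sum.swap])
  also have "\<dots> = (\<Sum>i<n. \<Sum>j<n. 2 * h i j)" by (simp add: sum_distrib_left[symmetric])
  also have "\<dots> \<le> (\<Sum>i<n. \<Sum>j<n. p i j * ((f i)\<^sup>2 / d) + of_bool (i \<in> V) * (P * (d * (f j)\<^sup>2)))"
  proof (intro sum_mono)
    fix i j assume "i \<in> {..<n}" "j \<in> {..<n}"
    then have ij: "i < n" "j < n" by auto
    show "2 * h i j \<le> p i j * ((f i)\<^sup>2 / d) + of_bool (i \<in> V) * (P * (d * (f j)\<^sup>2))"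
    proof (cases "i \<in> V \<and> i \<noteq> j")
      case True
      then have "p i j * (d * (f j)\<^sup>2) \<le> P * (d * (f j)\<^sup>2)" using P[OF ij] d(1) by (intro mult_right_mono) auto
      moreover have "2 * h i j = p i j * ((f i)\<^sup>2 / d + d * (f j)\<^sup>2)" using True by (simp add: h_def)
      ultimately show ?thesis using True unfolding distrib_left by simp
    next
      case False
      then have "h i j = 0" by (auto simp: h_def)
      moreover have "0 \<le> p i j * ((f i)\<^sup>2 / d)" "0 \<le> of_bool (i \<in> V) * (P * (d * (f j)\<^sup>2))"
        using p0[OF ij] d(1) nonneg by simp_all
      ultimately show ?thesis by linarith
    qed
  qed
  also have "\<dots> = (\<Sum>i<n. (\<Sum>j<n. p i j) * ((f i)\<^sup>2 / d)) + (\<Sum>i<n. of_bool (i \<in> V) * (P * (d * sqnorm f)))"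
    by (simp only: sum.distrib sum_distrib_left sum_distrib_right sqnorm_def)
  also have "(\<Sum>i<n. of_bool (i \<in> V) * (P * (d * sqnorm f))) = d * (real (card V) * P) * sqnorm f"
    by (subst sum_restrict_lessThan) (auto simp: hub_set_def)
  also have "(\<Sum>i<n. (\<Sum>j<n. p i j) * ((f i)\<^sup>2 / d)) \<le> (\<Sum>i<n. d * ((f i)\<^sup>2 / d))"
    using d by (intro sum_mono mult_right_mono) auto
  also have "(\<Sum>i<n. d * ((f i)\<^sup>2 / d)) = sqnorm f" using d(1) by (simp add: sqnorm_def)
  also have "d * (real (card V) * P) * sqnorm f \<le> 1 * sqnorm f"
    by (rule mult_right_mono[OF few_hubs sqnorm_nonneg])
  finally show ?thesis by simp
qed

lemma star_form_eq: "(\<Sum>i<n. \<Sum>j<n. (of_bool (i \<in> V \<and> j \<in> leaves i) + of_bool (j \<in> V \<and> i \<in> leaves j)) * (f i * f j)) = star_form f"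
proof -
  have half: "(\<Sum>i<n. \<Sum>j<n. of_bool (i \<in> V \<and> j \<in> leaves i) * (f i * f j)) = (\<Sum>x\<in>V. f x * (\<Sum>z\<in>leaves x. f z))"
  proof -
    have "(\<Sum>i<n. \<Sum>j<n. of_bool (i \<in> V \<and> j \<in> leaves i) * (f i * f j))
       = (\<Sum>i<n. of_bool (i \<in> V) * (f i * (\<Sum>j<n. of_bool (j \<in> leaves i) * f j)))"
      unfolding sum_distrib_left by (intro sum.cong refl) auto
    then show ?thesis
      by (simp only: sum_restrict_lessThan[OF leaves_subset])
        (subst sum_restrict_lessThan, auto simp: hub_set_def)
  qed
  have "(\<Sum>i<n. \<Sum>j<n. of_bool (j \<in> V \<and> i \<in> leaves j) * (f i * f j)) = (\<Sum>j<n. \<Sum>i<n. of_bool (j \<in> V \<and> i \<in> leaves j) * (f j * f i))"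
    by (subst sum.swap) (simp only: mult.commute)
  then show ?thesis
    unfolding distrib_right sum.distrib half star_form_def
    using half by (simp add: sum_distrib_left mult.assoc)
qed

text \<open>The matrix splits into loops (cost 1), the block off the hubs (\<open>\<rho>\<close>),
  the stars, the bad edges (3 r) and the mean in hub rows and columns (2).\<close>

lemma centered_form_near_star_form: "\<bar>centered_form f - star_form f\<bar> \<le> (\<rho> + 3 * real r + 3) * sqnorm f"
proof -
  define g where "g i = (if i \<in> V then 0 else f i)" for i
  have pij: "0 \<le> p i j" "p i j \<le> 1" if "i < n" "j < n" for i j
    using p that unfolding edge_probabilities_def by blast+
  have split: "centered_adj_mat n p G $$ (i, j) * f i * f j =
      of_bool (i = j) * ((of_bool (G {i, i}) - p i i) * (f i)\<^sup>2)
    + of_bool (i \<noteq> j) * (of_bool (G {i, j}) - p i j) * (g i * g j)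
    + (of_bool (i \<in> V \<and> j \<in> leaves i) + of_bool (j \<in> V \<and> i \<in> leaves j)) * (f i * f j)
    + of_bool (bad i j) * (f i * f j)
    - of_bool ((i \<in> V \<or> j \<in> V) \<and> i \<noteq> j) * (p i j * (f i * f j))" if ij: "i < n" "j < n" for i j
  proof -
    have c: "centered_adj_mat n p G $$ (i, j) = of_bool (G {i, j}) - p i j"
      using ij by (simp add: centered_adj_mat_def adj_mat_def)
    consider "i = j" | "i \<noteq> j" "i \<notin> V" "j \<notin> V" | "i \<noteq> j" "i \<in> V \<or> j \<in> V" "\<not> G {i, j}"
      | "i \<noteq> j" "i \<in> V \<or> j \<in> V" "G {i, j}" by blast
    then show ?thesis
    proof cases
      case 1
      then have "\<not> adjacent G i j" by (simp add: adjacent_def)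
      then show ?thesis using 1 unfolding c by (simp add: bad_def leaves_def power2_eq_square)
    next
      case 2
      then show ?thesis unfolding c by (simp add: bad_def g_def)
    next
      case 3
      then have "\<not> adjacent G i j" "\<not> adjacent G j i" by (simp_all add: adjacent_def insert_commute)
      then show ?thesis using 3 unfolding c by (auto simp add: bad_def g_def leaves_def)
    next
      case 4
      then have a: "adjacent G i j" by (simp add: adjacent_def)
      have ex: "of_bool (i \<in> V \<and> j \<in> leaves i) + of_bool (j \<in> V \<and> i \<in> leaves j) + of_bool (bad i j) = (1 :: real)"
        using a 4 leaves_not_V unfolding bad_def by auto
      have g0: "g i * g j = 0" using 4 by (auto simp: g_def)
      have "(of_bool (i \<in> V \<and> j \<in> leaves i) + of_bool (j \<in> V \<and> i \<in> leaves j)) * (f i * f j) + of_bool (bad i j) * (f i * f j) = f i * f j"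
        unfolding distrib_right[symmetric] ex by simp
      then show ?thesis unfolding c g0 using 4 by (simp add: left_diff_distrib mult.assoc)
    qed
  qed
  have diag: "(\<Sum>i<n. \<Sum>j<n. of_bool (i = j) * ((of_bool (G {i, i}) - p i i) * (f i)\<^sup>2)) = (\<Sum>i<n. (of_bool (G {i, i}) - p i i) * (f i)\<^sup>2)"
  proof (rule sum.cong[OF refl])
    fix i assume "i \<in> {..<n}"
    then show "(\<Sum>j<n. of_bool (i = j) * ((of_bool (G {i, i}) - p i i) * (f i)\<^sup>2)) = (of_bool (G {i, i}) - p i i) * (f i)\<^sup>2"
      by (simp only: sum_distrib_right[symmetric]) (simp add: of_bool_def)
  qed
  have diag_le: "\<bar>\<Sum>i<n. (of_bool (G {i, i}) - p i i) * (f i)\<^sup>2\<bar> \<le> sqnorm f"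
    unfolding sqnorm_def
  proof (rule order_trans[OF sum_abs sum_mono])
    fix i assume "i \<in> {..<n}"
    then have "\<bar>of_bool (G {i, i}) - p i i\<bar> \<le> 1" using pij[of i i] by (auto simp: of_bool_def)
    then have "\<bar>of_bool (G {i, i}) - p i i\<bar> * (f i)\<^sup>2 \<le> 1 * (f i)\<^sup>2" by (rule mult_right_mono) simp
    then show "\<bar>(of_bool (G {i, i}) - p i i) * (f i)\<^sup>2\<bar> \<le> (f i)\<^sup>2" by (simp add: abs_mult)
  qed
  have "\<bar>offdiag_form n p G g g\<bar> \<le> \<rho> * (\<Sum>i<n. (g i)\<^sup>2)"
    by (rule form_U) (auto simp: g_def hub_set_def split: if_splits)
  also have "\<dots> \<le> \<rho> * sqnorm f"
  proof (rule mult_left_mono)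
    show "(\<Sum>i<n. (g i)\<^sup>2) \<le> sqnorm f" unfolding sqnorm_def by (rule sum_mono) (simp add: g_def)
    show "0 \<le> \<rho>" by (rule nonneg)
  qed
  finally have U: "\<bar>offdiag_form n p G g g\<bar> \<le> \<rho> * sqnorm f" .
  have "centered_form f = (\<Sum>i<n. \<Sum>j<n. of_bool (i = j) * ((of_bool (G {i, i}) - p i i) * (f i)\<^sup>2)
    + of_bool (i \<noteq> j) * (of_bool (G {i, j}) - p i j) * (g i * g j)
    + (of_bool (i \<in> V \<and> j \<in> leaves i) + of_bool (j \<in> V \<and> i \<in> leaves j)) * (f i * f j)
    + of_bool (bad i j) * (f i * f j)
    - of_bool ((i \<in> V \<or> j \<in> V) \<and> i \<noteq> j) * (p i j * (f i * f j)))"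
    unfolding centered_form_def by (intro sum.cong refl split) auto
  also have "\<dots> = (\<Sum>i<n. (of_bool (G {i, i}) - p i i) * (f i)\<^sup>2) + offdiag_form n p G g g + star_form f
     + (\<Sum>i<n. \<Sum>j<n. of_bool (bad i j) * (f i * f j)) - (\<Sum>i<n. \<Sum>j<n. of_bool ((i \<in> V \<or> j \<in> V) \<and> i \<noteq> j) * (p i j * (f i * f j)))"
    unfolding sum.distrib sum_subtractf diag star_form_eq offdiag_form_def ..
  finally show ?thesis
    using diag_le U bad_form_bound[of f] mean_form_bound[of f] by (simp add: algebra_simps abs_le_iff)
qed

lemma sum_hubs_and_leaves:
  assumes X: "X \<subseteq> V"
  shows "(\<Sum>x\<in>X. (f x)\<^sup>2 + (\<Sum>z\<in>leaves x. (f z)\<^sup>2)) = (\<Sum>i\<in>X \<union> (\<Union>x\<in>X. leaves x). (f i)\<^sup>2)"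
proof -
  have fin: "finite X" by (rule finite_subset[OF X]) simp
  have "(\<Sum>i\<in>(\<Union>x\<in>X. leaves x). (f i)\<^sup>2) = (\<Sum>x\<in>X. \<Sum>z\<in>leaves x. (f z)\<^sup>2)"
  proof (rule sum.UNION_disjoint[OF fin])
    show "\<forall>x\<in>X. \<forall>y\<in>X. x \<noteq> y \<longrightarrow> leaves x \<inter> leaves y = {}"
      using X leaves_disjoint by (meson subsetD)
  qed simp
  moreover have "X \<inter> (\<Union>x\<in>X. leaves x) = {}" using X leaves_not_V by blast
  ultimately show ?thesis
    using fin by (subst sum.union_disjoint) (simp_all add: sum.distrib)
qed

text \<open>Cauchy-Schwarz on each star. Only stars whose centre carries mass contribute, so killing
  the coordinates of large degree lowers the bound to \<open>sqrt D\<close>.\<close>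

lemma star_form_upper:
  assumes D0: "0 \<le> D" and D: "\<And>x. x \<in> V \<Longrightarrow> f x \<noteq> 0 \<Longrightarrow> offdiag_degree n G x \<le> D"
  shows "\<bar>star_form f\<bar> \<le> sqrt D * sqnorm f"
proof -
  have bnd: "\<bar>2 * f x * (\<Sum>z\<in>leaves x. f z)\<bar> \<le> sqrt D * ((f x)\<^sup>2 + (\<Sum>z\<in>leaves x. (f z)\<^sup>2))" if x: "x \<in> V" for x
  proof (cases "f x = 0")
    case True
    then show ?thesis using D0 by (simp add: sum_nonneg)
  next
    case False
    define S where "S = (\<Sum>z\<in>leaves x. (f z)\<^sup>2)"
    have S0: "0 \<le> S" by (simp add: S_def sum_nonneg)
    have "(\<Sum>z\<in>leaves x. f z * 1)\<^sup>2 \<le> S * (\<Sum>z\<in>leaves x. 1\<^sup>2)"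
      unfolding S_def by (rule Cauchy_Schwarz_ineq_sum)
    also have "\<dots> \<le> S * D"
      using card_leaves_le[of x] D[OF x False] S0 by (intro mult_left_mono) auto
    finally have "(\<Sum>z\<in>leaves x. f z)\<^sup>2 \<le> D * S" by (simp add: mult.commute)
    then have sum_le: "\<bar>\<Sum>z\<in>leaves x. f z\<bar> \<le> sqrt D * sqrt S"
      using real_le_rsqrt[of "\<bar>\<Sum>z\<in>leaves x. f z\<bar>" "D * S"] by (simp add: real_sqrt_mult)
    have "0 \<le> (\<bar>f x\<bar> - sqrt S)\<^sup>2" by simp
    then have am: "2 * \<bar>f x\<bar> * sqrt S \<le> (f x)\<^sup>2 + S" unfolding power2_diff using S0 by simp
    have "\<bar>2 * f x * (\<Sum>z\<in>leaves x. f z)\<bar> = 2 * \<bar>f x\<bar> * \<bar>\<Sum>z\<in>leaves x. f z\<bar>" by (simp add: abs_mult)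
    also have "\<dots> \<le> 2 * \<bar>f x\<bar> * (sqrt D * sqrt S)" by (rule mult_left_mono[OF sum_le]) simp
    also have "\<dots> = sqrt D * (2 * \<bar>f x\<bar> * sqrt S)" by simp
    also have "\<dots> \<le> sqrt D * ((f x)\<^sup>2 + S)" by (rule mult_left_mono[OF am]) (use D0 in simp)
    finally show ?thesis by (simp add: S_def)
  qed
  have "\<bar>star_form f\<bar> \<le> (\<Sum>x\<in>V. sqrt D * ((f x)\<^sup>2 + (\<Sum>z\<in>leaves x. (f z)\<^sup>2)))"
    unfolding star_form_def by (rule order_trans[OF sum_abs sum_mono[OF bnd]])
  also have "\<dots> = sqrt D * (\<Sum>i\<in>V \<union> (\<Union>x\<in>V. leaves x). (f i)\<^sup>2)"
    using sum_hubs_and_leaves[OF order_refl, of f] by (simp only: sum_distrib_left[symmetric])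
  also have "\<dots> \<le> sqrt D * sqnorm f"
    unfolding sqnorm_def
  proof (intro mult_left_mono sum_mono2)
    show "V \<union> (\<Union>x\<in>V. leaves x) \<subseteq> {..<n}" using V_less leaves_subset by blast
  qed (use D0 in simp_all)
  finally show ?thesis .
qed

text \<open>For \<sigma> = 1 or -1 and a nonempty star this is its eigenvector for
  \<open>\<sigma> * sqrt (card (leaves x))\<close>, normalised to value 1 at the centre and thus to
  squared norm 2.\<close>

definition star_vector :: "real \<Rightarrow> nat \<Rightarrow> nat \<Rightarrow> real" where
  "star_vector \<sigma> x i = of_bool (i = x) + \<sigma> / sqrt (real (card (leaves x))) * of_bool (i \<in> leaves x)"

lemma star_vector_combination:
  assumes X: "X \<subseteq> V" and f: "f = (\<lambda>i. \<Sum>x\<in>X. c x * star_vector \<sigma> x i)"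
  shows "\<And>x. x \<in> X \<Longrightarrow> f x = c x"
    and "\<And>x. x \<in> V - X \<Longrightarrow> f x = 0"
    and "\<And>x z. x \<in> X \<Longrightarrow> z \<in> leaves x \<Longrightarrow> f z = \<sigma> * c x / sqrt (real (card (leaves x)))"
    and "\<And>i. f i \<noteq> 0 \<Longrightarrow> i \<in> X \<union> (\<Union>x\<in>X. leaves x)"
proof -
  have fin: "finite X" by (rule finite_subset[OF X]) simp
  have hub: "f y = (if y \<in> X then c y else 0)" if "y \<in> V" for y
  proof -
    have "f y = (\<Sum>x\<in>X. c x * of_bool (y = x))"
      unfolding f star_vector_def using leaves_not_V that by (intro sum.cong refl) auto
    then show ?thesis by (simp add: sum_single_column[OF fin])
  qed
  show "f x = c x" if "x \<in> X" for x using hub[of x] that X by auto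
  show "f x = 0" if "x \<in> V - X" for x using hub[of x] that by auto
  show "f z = \<sigma> * c x / sqrt (real (card (leaves x)))" if xz: "x \<in> X" "z \<in> leaves x" for x z
  proof -
    have "f z = (\<Sum>y\<in>X. if y = x then \<sigma> * c x / sqrt (real (card (leaves x))) else 0)"
      unfolding f
    proof (rule sum.cong[OF refl])
      fix y assume y: "y \<in> X"
      have zV: "z \<notin> V" using xz(2) by (rule leaves_not_V)
      then have zy: "z \<noteq> y" using y X by blast
      show "c y * star_vector \<sigma> y z = (if y = x then \<sigma> * c x / sqrt (real (card (leaves x))) else 0)"
      proof (cases "y = x")
        case True then show ?thesis using xz zy by (simp add: star_vector_def)
      next
        case False
        then have "z \<notin> leaves y" using leaves_disjoint[of x y] xz y X by blast
        then show ?thesis using False zy by (simp add: star_vector_def)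
      qed
    qed
    then show ?thesis using xz(1) fin by simp
  qed
  show "i \<in> X \<union> (\<Union>x\<in>X. leaves x)" if "f i \<noteq> 0" for i
  proof (rule ccontr)
    assume "i \<notin> X \<union> (\<Union>x\<in>X. leaves x)"
    then have "f i = 0" unfolding f by (intro sum.neutral) (auto simp: star_vector_def)
    then show False using that by simp
  qed
qed

text \<open>By disjointness the star vectors diagonalise both sides: the squared norm is the sum of
  \<open>2 * (c x)^2\<close>, and the form multiplies each of these terms by its star
  eigenvalue.\<close>

lemma star_form_star_vectors:
  assumes X: "X \<subseteq> V" and f: "f = (\<lambda>i. \<Sum>x\<in>X. c x * star_vector \<sigma> x i)" and \<sigma>: "\<sigma>\<^sup>2 = 1"
    and m: "0 \<le> m" "\<And>x. x \<in> X \<Longrightarrow> 0 < card (leaves x)" "\<And>x. x \<in> X \<Longrightarrow> m \<le> sqrt (real (card (leaves x)))"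
  shows "m * sqnorm f \<le> \<sigma> * star_form f"
proof -
  note fX = star_vector_combination[OF X f]
  have fin: "finite X" by (rule finite_subset[OF X]) simp
  have sub: "X \<union> (\<Union>x\<in>X. leaves x) \<subseteq> {..<n}" using X V_less leaves_subset by blast
  have "sqnorm f = (\<Sum>i\<in>X \<union> (\<Union>x\<in>X. leaves x). (f i)\<^sup>2)"
    unfolding sqnorm_def by (rule sum.mono_neutral_right[OF _ sub]) (use fX(4) in auto)
  also have "\<dots> = (\<Sum>x\<in>X. (f x)\<^sup>2 + (\<Sum>z\<in>leaves x. (f z)\<^sup>2))"
    by (rule sum_hubs_and_leaves[OF X, symmetric])
  also have "\<dots> = (\<Sum>x\<in>X. 2 * (c x)\<^sup>2)"
  proof (rule sum.cong[OF refl])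
    fix x assume x: "x \<in> X"
    have "(\<Sum>z\<in>leaves x. (f z)\<^sup>2) = (\<Sum>z\<in>leaves x. (c x)\<^sup>2 / real (card (leaves x)))"
      by (intro sum.cong refl) (simp add: fX(3)[OF x] power_divide power_mult_distrib \<sigma>)
    also have "\<dots> = (c x)\<^sup>2" using m(2)[OF x] by (auto simp: card_gt_0_iff)
    finally show "(f x)\<^sup>2 + (\<Sum>z\<in>leaves x. (f z)\<^sup>2) = 2 * (c x)\<^sup>2" by (simp add: fX(1)[OF x])
  qed
  finally have sq: "sqnorm f = (\<Sum>x\<in>X. 2 * (c x)\<^sup>2)" .
  have "star_form f = (\<Sum>x\<in>X. 2 * f x * (\<Sum>z\<in>leaves x. f z))"
    unfolding star_form_def by (rule sum.mono_neutral_right[OF _ X]) (use fX(2) in auto)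
  also have "\<dots> = (\<Sum>x\<in>X. \<sigma> * (2 * (c x)\<^sup>2 * sqrt (real (card (leaves x)))))"
  proof (rule sum.cong[OF refl])
    fix x assume x: "x \<in> X"
    have "(\<Sum>z\<in>leaves x. f z) = real (card (leaves x)) * (\<sigma> * c x / sqrt (real (card (leaves x))))"
      by (simp add: fX(3)[OF x])
    also have "\<dots> = \<sigma> * c x * (real (card (leaves x)) / sqrt (real (card (leaves x))))" by simp
    also have "real (card (leaves x)) / sqrt (real (card (leaves x))) = sqrt (real (card (leaves x)))"
      by (simp add: real_div_sqrt)
    finally show "2 * f x * (\<Sum>z\<in>leaves x. f z) = \<sigma> * (2 * (c x)\<^sup>2 * sqrt (real (card (leaves x))))"
      by (simp add: fX(1)[OF x] power2_eq_square)
  qed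
  finally have "\<sigma> * star_form f = \<sigma>\<^sup>2 * (\<Sum>x\<in>X. 2 * (c x)\<^sup>2 * sqrt (real (card (leaves x))))"
    by (simp add: sum_distrib_left[symmetric] power2_eq_square)
  also have "\<dots> \<ge> (\<Sum>x\<in>X. 2 * (c x)\<^sup>2 * m)"
    unfolding \<sigma> mult_1 by (intro sum_mono mult_left_mono m(3)) simp_all
  also have "(\<Sum>x\<in>X. 2 * (c x)\<^sup>2 * m) = m * sqnorm f" by (simp add: sq sum_distrib_left mult_ac)
  finally show ?thesis .
qed

section \<open>Min-max for the centered adjacency matrix\<close>

lemma centered_adj_mat_symmetric:
  "centered_adj_mat n p G \<in> carrier_mat n n" "(centered_adj_mat n p G)\<^sup>T = centered_adj_mat n p G"
proof -
  show c: "centered_adj_mat n p G \<in> carrier_mat n n" 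
    by (auto simp: centered_adj_mat_def adj_mat_def intro!: minus_carrier_mat)
  show "(centered_adj_mat n p G)\<^sup>T = centered_adj_mat n p G"
  proof (rule eq_matI)
    fix i j assume "i < dim_row (centered_adj_mat n p G)" "j < dim_col (centered_adj_mat n p G)"
    then have ij: "i < n" "j < n" using c by auto
    have "p j i = p i j" using p ij unfolding edge_probabilities_def by blast
    then show "(centered_adj_mat n p G)\<^sup>T $$ (i, j) = centered_adj_mat n p G $$ (i, j)"
      using ij by (simp add: centered_adj_mat_def adj_mat_def insert_commute)
  qed (use c in auto)
qed

lemma eigenvalue_coordinate_subspace:
  assumes X: "X \<subseteq> {..<n}" "1 \<le> k" "k \<le> card X"
  shows "(\<And>f. (\<And>i. f i \<noteq> 0 \<Longrightarrow> i \<in> X) \<Longrightarrow> t * sqnorm f \<le> centered_form f) \<Longrightarrow> t \<le> eigenvalue_nth (centered_adj_mat n p G) k"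
    and "(\<And>f. (\<And>i. f i \<noteq> 0 \<Longrightarrow> i \<in> X) \<Longrightarrow> centered_form f \<le> t * sqnorm f) \<Longrightarrow> eigenvalue_nth (centered_adj_mat n p G) (n + 1 - k) \<le> t"
proof -
  have fin: "finite X" by (rule finite_subset[OF X(1)]) simp
  have col: "f i = (if i \<in> X then c i else 0)" if "f = (\<lambda>i. \<Sum>x\<in>X. c x * of_bool (i = x))" for f c :: "nat \<Rightarrow> real" and i
    unfolding that by (rule sum_single_column[OF fin])
  have ne: "\<exists>i<n. f i \<noteq> 0" if "\<exists>x\<in>X. c x \<noteq> 0" "f = (\<lambda>i. \<Sum>x\<in>X. c x * of_bool (i = x))" for f c :: "nat \<Rightarrow> real"
    using col[OF that(2)] that(1) X(1) by auto
  show "t \<le> eigenvalue_nth (centered_adj_mat n p G) k"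
    if h: "\<And>f. (\<And>i. f i \<noteq> 0 \<Longrightarrow> i \<in> X) \<Longrightarrow> t * sqnorm f \<le> centered_form f"
  proof (rule eigenvalue_nth_ge[OF centered_adj_mat_symmetric fin X(2,3), of "\<lambda>x i. of_bool (i = x)"])
    fix c :: "nat \<Rightarrow> real" and f :: "nat \<Rightarrow> real"
    assume a: "\<exists>x\<in>X. c x \<noteq> 0" "f = (\<lambda>i. \<Sum>x\<in>X. c x * of_bool (i = x))"
    have "t * sqnorm f \<le> centered_form f" by (rule h) (use col[OF a(2)] in \<open>auto split: if_splits\<close>)
    then show "(\<exists>i<n. f i \<noteq> 0) \<and> t * (\<Sum>i<n. (f i)\<^sup>2) \<le> (\<Sum>i<n. \<Sum>j<n. centered_adj_mat n p G $$ (i, j) * f i * f j)"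
      using ne[OF a] unfolding sqnorm_def centered_form_def by blast
  qed
  show "eigenvalue_nth (centered_adj_mat n p G) (n + 1 - k) \<le> t"
    if h: "\<And>f. (\<And>i. f i \<noteq> 0 \<Longrightarrow> i \<in> X) \<Longrightarrow> centered_form f \<le> t * sqnorm f"
  proof (rule eigenvalue_nth_le[OF centered_adj_mat_symmetric fin X(2,3), of "\<lambda>x i. of_bool (i = x)"])
    fix c :: "nat \<Rightarrow> real" and f :: "nat \<Rightarrow> real"
    assume a: "\<exists>x\<in>X. c x \<noteq> 0" "f = (\<lambda>i. \<Sum>x\<in>X. c x * of_bool (i = x))"
    have "centered_form f \<le> t * sqnorm f" by (rule h) (use col[OF a(2)] in \<open>auto split: if_splits\<close>)
    then show "(\<exists>i<n. f i \<noteq> 0) \<and> (\<Sum>i<n. \<Sum>j<n. centered_adj_mat n p G $$ (i, j) * f i * f j) \<le> t * (\<Sum>i<n. (f i)\<^sup>2)"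
      using ne[OF a] unfolding sqnorm_def centered_form_def by blast
  qed
qed

text \<open>Upper bound: on the coordinates of degree at most D, at least n + 1 - k of them, the
  form is at most \<open>sqrt D\<close> plus noise. Lower bound: the k vertices of largest degree
  carry star vectors, provided they are hubs with enough leaves. The threshold \<theta> is \<tau>
  plus 3 r bad edges plus a possible loop. Negative eigenvalues come from the same spaces with
  opposite signs.\<close>

lemma eigenvalues_near_degrees:
  assumes k: "1 \<le> k" "k + card V \<le> n"
  defines "E \<equiv> \<rho> + 3 * real r + 3 + sqrt (\<tau> + 3 * real r + 1)"
  shows "\<bar>eigenvalue_nth (centered_adj_mat n p G) k - sqrt (ordered_degree n G k)\<bar> \<le> E"
    and "\<bar>eigenvalue_nth (centered_adj_mat n p G) (n + 1 - k) + sqrt (ordered_degree n G k)\<bar> \<le> E"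
proof -
  let ?H = "centered_adj_mat n p G"
  define D where "D = ordered_degree n G k"
  define R where "R = \<rho> + 3 * real r + 3"
  define \<theta> where "\<theta> = \<tau> + 3 * real r + 1"
  have near: "\<bar>centered_form f - star_form f\<bar> \<le> R * sqnorm f" for f
    unfolding R_def by (rule centered_form_near_star_form)
  have kn: "k \<le> n" using k by simp
  have D_eq: "D = rev (sort (map (degree_of n G) [0..<n])) ! (k - 1)" by (simp add: D_def ordered_degree_def)
  note cnt = ordered_nth_count[OF k(1) kn D_eq]
  have deg: "offdiag_degree n G x \<le> degree_of n G x" "degree_of n G x \<le> offdiag_degree n G x + 1" if "x < n" for x
    using degree_of_eq[OF that, of G] by auto
  have off0: "0 \<le> offdiag_degree n G x" for x unfolding offdiag_degree_eq_card by simp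
  have "0 < card {x. x < n \<and> degree_of n G x \<le> D}" using cnt(2) kn by linarith
  then obtain x0 where "x0 < n" "degree_of n G x0 \<le> D" unfolding card_gt_0_iff by blast
  then have D0: "0 \<le> D" using deg(1)[of x0] off0[of x0] by linarith
  have \<theta>0: "0 \<le> \<theta>" using nonneg by (simp add: \<theta>_def)
  let ?X = "{x. x < n \<and> degree_of n G x \<le> D}"
  have up: "\<bar>star_form f\<bar> \<le> sqrt D * sqnorm f" if "\<And>i. f i \<noteq> 0 \<Longrightarrow> i \<in> ?X" for f
  proof (rule star_form_upper[OF D0])
    fix x assume "x \<in> V" "f x \<noteq> 0"
    then have "x \<in> ?X" using that by blast
    then show "offdiag_degree n G x \<le> D" using deg(1)[of x] by simp
  qed
  \<comment> \<open>The upper bound for the k-th eigenvalue uses the statement about the lower end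
    of the spectrum, with n + 1 - k in place of k.\<close>
  have U: "n + 1 - (n + 1 - k) = k" using kn by simp
  have X: "?X \<subseteq> {..<n}" "1 \<le> n + 1 - k" "n + 1 - k \<le> card ?X" using cnt(2) kn by auto
  have upper1: "eigenvalue_nth ?H k \<le> sqrt D + R"
  proof -
    have "eigenvalue_nth ?H (n + 1 - (n + 1 - k)) \<le> sqrt D + R"
    proof (rule eigenvalue_coordinate_subspace(2)[OF X])
      fix f :: "nat \<Rightarrow> real" assume "\<And>i. f i \<noteq> 0 \<Longrightarrow> i \<in> ?X"
      then have "\<bar>star_form f\<bar> \<le> sqrt D * sqnorm f" by (rule up)
      then show "centered_form f \<le> (sqrt D + R) * sqnorm f"
        using near[of f] unfolding abs_le_iff distrib_right by linarith
    qed
    then show ?thesis unfolding U .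
  qed
  have upper2: "- (sqrt D + R) \<le> eigenvalue_nth ?H (n + 1 - k)"
  proof (rule eigenvalue_coordinate_subspace(1)[OF X])
    fix f :: "nat \<Rightarrow> real" assume "\<And>i. f i \<noteq> 0 \<Longrightarrow> i \<in> ?X"
    then have "\<bar>star_form f\<bar> \<le> sqrt D * sqnorm f" by (rule up)
    then show "- (sqrt D + R) * sqnorm f \<le> centered_form f"
      using near[of f] unfolding abs_le_iff distrib_right minus_mult_left[symmetric] by linarith
  qed
  have lower: "sqrt D - sqrt \<theta> - R \<le> eigenvalue_nth ?H k \<and> eigenvalue_nth ?H (n + 1 - k) \<le> - (sqrt D - sqrt \<theta> - R)"
  \<comment> \<open>For \<open>D <= \<theta>\<close> the claimed lower bound is at most -R, so any k
    coordinates off the hubs do; they exist because \<open>k + card V <= n\<close>.\<close>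
  proof (cases "D \<le> \<theta>")
    case True
    let ?U = "{..<n} - V"
    have "V \<subseteq> {..<n}" using V_less by blast
    then have U': "?U \<subseteq> {..<n}" "1 \<le> k" "k \<le> card ?U" using k by (auto simp: card_Diff_subset)
    have st0: "star_form f = 0" if "\<And>i. f i \<noteq> 0 \<Longrightarrow> i \<in> ?U" for f
      unfolding star_form_def using that by (intro sum.neutral) auto
    have "- R \<le> eigenvalue_nth ?H k"
    proof (rule eigenvalue_coordinate_subspace(1)[OF U'])
      fix f :: "nat \<Rightarrow> real" assume "\<And>i. f i \<noteq> 0 \<Longrightarrow> i \<in> ?U"
      then have "star_form f = 0" by (rule st0)
      then show "- R * sqnorm f \<le> centered_form f" using near[of f] by simp
    qed
    moreover have "eigenvalue_nth ?H (n + 1 - k) \<le> R"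
    proof (rule eigenvalue_coordinate_subspace(2)[OF U'])
      fix f :: "nat \<Rightarrow> real" assume "\<And>i. f i \<noteq> 0 \<Longrightarrow> i \<in> ?U"
      then have "star_form f = 0" by (rule st0)
      then show "centered_form f \<le> R * sqnorm f" using near[of f] by simp
    qed
    moreover have "sqrt D \<le> sqrt \<theta>" using True by simp
    ultimately show ?thesis by linarith
  next
    case False
    let ?T = "{x. x < n \<and> D \<le> degree_of n G x}"
    define m where "m = sqrt (D - (3 * real r + 1))"
    have TV: "?T \<subseteq> V"
    proof
      fix x assume "x \<in> ?T"
      then have "x < n" "\<tau> \<le> offdiag_degree n G x" using False deg(2)[of x] by (auto simp: \<theta>_def)
      then show "x \<in> V" by (simp add: hub_set_def)
    qed
    \<comment> \<open>A loop counts in the degree but is no leaf, hence the 1.\<close>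
    have cl: "D - (3 * real r + 1) \<le> real (card (leaves x))" if "x \<in> ?T" for x
      using that deg(2)[of x] offdiag_degree_le_leaves[of x] TV by force
    have m0: "0 \<le> m" and pos: "\<And>x. x \<in> ?T \<Longrightarrow> 0 < card (leaves x)" and ml: "\<And>x. x \<in> ?T \<Longrightarrow> m \<le> sqrt (real (card (leaves x)))"
    proof -
      show "0 \<le> m" using False nonneg by (simp add: m_def \<theta>_def)
      show "0 < card (leaves x)" if "x \<in> ?T" for x
      proof -
        have "0 < real (card (leaves x))" using cl[OF that] False nonneg(1) unfolding \<theta>_def by linarith
        then show ?thesis by simp
      qed
      show "m \<le> sqrt (real (card (leaves x)))" if "x \<in> ?T" for x using cl[OF that] by (simp add: m_def)
    qed
    have mD: "sqrt D - sqrt \<theta> \<le> m"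
    proof -
      have "sqrt D \<le> sqrt (D - (3 * real r + 1)) + sqrt (3 * real r + 1)"
        using sqrt_add_le_add_sqrt[of "D - (3 * real r + 1)" "3 * real r + 1"] False nonneg by (simp add: \<theta>_def)
      moreover have "sqrt (3 * real r + 1) \<le> sqrt \<theta>" using nonneg by (simp add: \<theta>_def)
      ultimately show ?thesis unfolding m_def by linarith
    qed
    have finT: "finite ?T" by simp
    have ne: "\<exists>i<n. f i \<noteq> 0" if "\<exists>x\<in>?T. c x \<noteq> 0" "f = (\<lambda>i. \<Sum>x\<in>?T. c x * star_vector \<sigma> x i)" for f c \<sigma>
      using star_vector_combination(1)[OF TV that(2)] that(1) by force
    have "m - R \<le> eigenvalue_nth ?H k"
    proof (rule eigenvalue_nth_ge[OF centered_adj_mat_symmetric finT k(1) cnt(1), of "star_vector 1"])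
      fix c f :: "nat \<Rightarrow> real"
      assume a: "\<exists>x\<in>?T. c x \<noteq> 0" "f = (\<lambda>i. \<Sum>x\<in>?T. c x * star_vector 1 x i)"
      have "m * sqnorm f \<le> 1 * star_form f"
        by (rule star_form_star_vectors[OF TV a(2) _ m0 pos ml]) simp
      then have "(m - R) * sqnorm f \<le> centered_form f"
        using near[of f] unfolding abs_le_iff left_diff_distrib by linarith
      then show "(\<exists>i<n. f i \<noteq> 0) \<and> (m - R) * (\<Sum>i<n. (f i)\<^sup>2) \<le> (\<Sum>i<n. \<Sum>j<n. ?H $$ (i, j) * f i * f j)"
        using ne[OF a] unfolding sqnorm_def centered_form_def by blast
    qed
    moreover have "eigenvalue_nth ?H (n + 1 - k) \<le> - (m - R)"
    proof (rule eigenvalue_nth_le[OF centered_adj_mat_symmetric finT k(1) cnt(1), of "star_vector (- 1)"])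
      fix c f :: "nat \<Rightarrow> real"
      assume a: "\<exists>x\<in>?T. c x \<noteq> 0" "f = (\<lambda>i. \<Sum>x\<in>?T. c x * star_vector (- 1) x i)"
      have "m * sqnorm f \<le> - 1 * star_form f"
        by (rule star_form_star_vectors[OF TV a(2) _ m0 pos ml]) simp
      then have "centered_form f \<le> - (m - R) * sqnorm f"
        using near[of f] unfolding abs_le_iff left_diff_distrib minus_mult_left[symmetric] by linarith
      then show "(\<exists>i<n. f i \<noteq> 0) \<and> (\<Sum>i<n. \<Sum>j<n. ?H $$ (i, j) * f i * f j) \<le> - (m - R) * (\<Sum>i<n. (f i)\<^sup>2)"
        using ne[OF a] unfolding sqnorm_def centered_form_def by blast
    qed
    ultimately show ?thesis using mD by linarith
  qed
  have E: "E = R + sqrt \<theta>" by (simp add: E_def R_def \<theta>_def)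
  have s0: "0 \<le> sqrt \<theta>" using \<theta>0 by simp
  show "\<bar>eigenvalue_nth ?H k - sqrt (ordered_degree n G k)\<bar> \<le> E"
    unfolding E D_def[symmetric] abs_le_iff using upper1 lower s0 by linarith
  show "\<bar>eigenvalue_nth ?H (n + 1 - k) + sqrt (ordered_degree n G k)\<bar> \<le> E"
    unfolding E D_def[symmetric] abs_le_iff using upper2 lower s0 by linarith
qed

end

section \<open>Rare configurations around hubs\<close>

lemma prob_UN_uniform_le:
  assumes "finite I" "\<And>i. i \<in> I \<Longrightarrow> measure_pmf.prob M (E i) \<le> b"
  shows "measure_pmf.prob M (\<Union>i\<in>I. E i) \<le> real (card I) * b"
proof -
  have "measure_pmf.prob M (\<Union>i\<in>I. E i) \<le> (\<Sum>i\<in>I. measure_pmf.prob M (E i))"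
    by (rule measure_pmf.finite_measure_subadditive_finite[OF assms(1)]) simp
  also have "\<dots> \<le> (\<Sum>i\<in>I. b)" by (rule sum_mono) (rule assms(2))
  finally show ?thesis by simp
qed

text \<open>Configurations of r distinct vertices are indexed by functions on \<open>{..<r}\<close>,
  so the index set of a union bound has n^r elements. Non-injective indices will carry the empty
  event.\<close>

lemma injective_enumeration:
  assumes "finite A" "r \<le> card A"
  obtains f where "f \<in> {..<r} \<rightarrow>\<^sub>E A" "inj_on f {..<r}"
proof -
  obtain Y where Y: "Y \<subseteq> A" "card Y = r" "finite Y"
    using obtain_subset_with_card_n[OF assms(2)] by blast
  obtain h where h: "bij_betw h {0..<card Y} Y" using ex_bij_betw_nat_finite[OF Y(3)] by blast
  show thesis
  proof (rule that[of "restrict h {..<r}"])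
    have im: "h ` {..<r} = Y" using h Y(2) by (simp add: bij_betw_def atLeast0LessThan)
    show "restrict h {..<r} \<in> {..<r} \<rightarrow>\<^sub>E A" using im Y(1) by (auto intro!: restrict_PiE_iff[THEN iffD2])
    have "inj_on h {..<r}" using h Y(2) by (simp add: bij_betw_def atLeast0LessThan)
    then show "inj_on (restrict h {..<r}) {..<r}" by (simp add: inj_on_def)
  qed
qed

text \<open>Only the edges leaving \<open>Y\<close> are counted, so that each contributes to one degree.\<close>

lemma card_cross_edges_ge_degrees:
  assumes Y: "Y \<subseteq> {..<n}" and hub: "Y \<subseteq> hub_set n G t"
  shows "real (card Y) * (t - real (card Y)) \<le> real (card {e \<in> cross_edges Y ({..<n} - Y). G e})"
proof -
  let ?E = "{e \<in> cross_edges Y ({..<n} - Y). G e}"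
  define N where "N y = {j. j < n \<and> j \<notin> Y \<and> adjacent G y j}" for y
  have fin: "finite Y" by (rule finite_subset[OF Y]) simp
  have finN: "finite (N y)" for y by (simp add: N_def)
  have finE: "finite ?E"
    by (rule finite_subset[OF _ finite_edges[of n]]) (use cross_edges_subset[OF Y, of "{..<n} - Y"] in auto)
  have N: "t - real (card Y) \<le> real (card (N y))" if y: "y \<in> Y" for y
  proof -
    have "{j. j < n \<and> adjacent G y j} \<subseteq> N y \<union> Y" by (auto simp: N_def)
    then have "card {j. j < n \<and> adjacent G y j} \<le> card (N y \<union> Y)" using fin finN by (intro card_mono) auto
    also have "\<dots> \<le> card (N y) + card Y" by (rule card_Un_le)
    finally have "real (card {j. j < n \<and> adjacent G y j}) \<le> real (card (N y)) + real (card Y)" by simp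
    moreover have "t \<le> offdiag_degree n G y" using hub y by (auto simp: hub_set_def)
    ultimately show ?thesis unfolding offdiag_degree_eq_card by simp
  qed
  have "real (card Y) * (t - real (card Y)) = (\<Sum>y\<in>Y. t - real (card Y))" by simp
  also have "\<dots> \<le> (\<Sum>y\<in>Y. real (card (N y)))" by (rule sum_mono) (rule N)
  also have "\<dots> = real (card (Sigma Y N))" using fin finN by simp
  also have "card (Sigma Y N) \<le> card ?E"
  proof (rule card_inj_on_le[OF _ _ finE])
    show "inj_on (\<lambda>(y, j). {y, j}) (Sigma Y N)"
      by (auto simp: inj_on_def N_def doubleton_eq_iff)
    show "(\<lambda>(y, j). {y, j}) ` Sigma Y N \<subseteq> ?E"
    proof
      fix e assume "e \<in> (\<lambda>(y, j). {y, j}) ` Sigma Y N"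
      then obtain y j where e: "y \<in> Y" "j \<in> N y" "e = {y, j}" by auto
      then have j: "j < n" "j \<notin> Y" "y \<noteq> j" "G {y, j}" by (auto simp: N_def adjacent_def)
      have "e \<in> cross_edges Y ({..<n} - Y)"
        unfolding cross_edges_def e(3) using e(1) j by (intro image_eqI[of _ _ "(y, j)"]) auto
      then show "e \<in> ?E" using j e(3) by simp
    qed
  qed
  finally show ?thesis by simp
qed

section \<open>Union bounds for configurations with many hubs\<close>

locale sparse_random_graph =
  fixes n :: nat and p :: "nat \<Rightarrow> nat \<Rightarrow> real" and P d \<tau> lam :: real and r :: nat
  assumes p: "edge_probabilities n p"
    and P: "\<And>i j. i < n \<Longrightarrow> j < n \<Longrightarrow> i \<noteq> j \<Longrightarrow> p i j \<le> P" "0 \<le> P"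
    and d: "0 < d" "\<And>i. i < n \<Longrightarrow> (\<Sum>j<n. p i j) \<le> d"
    and lam: "0 \<le> lam" and r: "1 \<le> r"
begin

abbreviation "prb \<equiv> measure_pmf.prob (random_graph n p)"

text \<open>The Chernoff bound for one hub at tilt \<open>lam\<close>. The threshold is lowered by
  \<open>r\<close> because up to \<open>r\<close> hubs are treated at once and edges among them are
  not counted.\<close>

definition q :: real where "q = exp (d * exp lam - lam * (\<tau> - real r))"

lemma q_nonneg: "0 \<le> q" by (simp add: q_def)

text \<open>Degrees of different vertices are dependent, but the hub conditions force many edges
  between \<open>Y\<close> and its complement. One Chernoff bound for that count gives the factor
  \<open>q\<close> for each hub, just as independence would.\<close>

lemma prob_edges_and_hubs:
  assumes Y: "Y \<subseteq> {..<n}" "card Y \<le> r" and F: "F \<subseteq> edges n" "\<And>e. e \<in> F \<Longrightarrow> edge_prob p e \<le> P"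
  shows "prb {G. (\<forall>e\<in>F. G e) \<and> Y \<subseteq> hub_set n G \<tau>} \<le> (P * exp lam) ^ card F * q ^ card Y"
proof -
  let ?E = "cross_edges Y ({..<n} - Y)" and ?m = "real (card Y)"
  have E: "?E \<subseteq> edges n" by (rule cross_edges_subset[OF Y(1)]) auto
  have "prb {G. (\<forall>e\<in>F. G e) \<and> Y \<subseteq> hub_set n G \<tau>}
      \<le> prb {G. (\<forall>e\<in>F. G e) \<and> ?m * (\<tau> - ?m) \<le> real (card {e \<in> ?E. G e})}"
    by (rule measure_pmf.finite_measure_mono) (use card_cross_edges_ge_degrees[OF Y(1)] in auto)
  also have "\<dots> \<le> (\<Prod>e\<in>F. edge_prob p e * exp lam) * exp (exp lam * (\<Sum>e\<in>?E. edge_prob p e) - lam * (?m * (\<tau> - ?m)))"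
    by (rule prob_edges_present_and_count[OF p F(1) E lam])
  also have "\<dots> \<le> (\<Prod>e\<in>F. P * exp lam) * q ^ card Y"
  proof (intro mult_mono)
    show "(\<Prod>e\<in>F. edge_prob p e * exp lam) \<le> (\<Prod>e\<in>F. P * exp lam)"
      using F edge_prob_bounds(1)[OF p] by (intro prod_mono conjI mult_right_mono mult_nonneg_nonneg) auto
    have "(\<Sum>e\<in>?E. edge_prob p e) \<le> (\<Sum>i\<in>Y. \<Sum>j\<in>{..<n} - Y. max 0 (p i j))"
      by (rule sum_edge_prob_cross_edges[OF p Y(1)]) auto
    also have "\<dots> \<le> (\<Sum>i\<in>Y. d)"
    proof (rule sum_mono)
      fix i assume "i \<in> Y"
      then have i: "i < n" using Y by auto
      have p0: "0 \<le> p i j" if "j < n" for j using p i that unfolding edge_probabilities_def by blast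
      have "(\<Sum>j\<in>{..<n} - Y. max 0 (p i j)) \<le> (\<Sum>j<n. max 0 (p i j))" by (rule sum_mono2) auto
      also have "\<dots> = (\<Sum>j<n. p i j)" by (rule sum.cong) (use p0 in \<open>simp_all add: max_def\<close>)
      finally show "(\<Sum>j\<in>{..<n} - Y. max 0 (p i j)) \<le> d" using d(2)[OF i] by linarith
    qed
    finally have "exp lam * (\<Sum>e\<in>?E. edge_prob p e) \<le> exp lam * (?m * d)" by (intro mult_left_mono) auto
    moreover have "lam * (?m * (\<tau> - real r)) \<le> lam * (?m * (\<tau> - ?m))"
      using Y(2) lam by (intro mult_left_mono) auto
    ultimately have "exp lam * (\<Sum>e\<in>?E. edge_prob p e) - lam * (?m * (\<tau> - ?m)) \<le> exp lam * (?m * d) - lam * (?m * (\<tau> - real r))"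
      by linarith
    also have "\<dots> = ?m * (d * exp lam - lam * (\<tau> - real r))" by (simp add: algebra_simps)
    finally have "exp lam * (\<Sum>e\<in>?E. edge_prob p e) - lam * (?m * (\<tau> - ?m)) \<le> ?m * (d * exp lam - lam * (\<tau> - real r))" .
    then have "exp (exp lam * (\<Sum>e\<in>?E. edge_prob p e) - lam * (?m * (\<tau> - ?m))) \<le> exp (?m * (d * exp lam - lam * (\<tau> - real r)))"
      by simp
    then show "exp (exp lam * (\<Sum>e\<in>?E. edge_prob p e) - lam * (?m * (\<tau> - ?m))) \<le> q ^ card Y"
      unfolding q_def exp_of_nat_mult .
    show "0 \<le> (\<Prod>e\<in>F. P * exp lam)" using P(2) by (intro prod_nonneg) auto
  qed simp
  finally show ?thesis by simp
qed

lemma prob_hub: "x < n \<Longrightarrow> prb {G. x \<in> hub_set n G \<tau>} \<le> q"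
  using prob_edges_and_hubs[of "{x}" "{}"] r by simp

lemma prob_hub_exists: "prb {G. hub_set n G \<tau> \<noteq> {}} \<le> real n * q"
proof -
  have "{G. hub_set n G \<tau> \<noteq> {}} = (\<Union>x\<in>{..<n}. {G. x \<in> hub_set n G \<tau>})"
    by (auto simp: hub_set_def)
  then show ?thesis using prob_UN_uniform_le[of "{..<n}" "random_graph n p" "\<lambda>x. {G. x \<in> hub_set n G \<tau>}" q] prob_hub by simp
qed

lemma prob_many_hubs:
  assumes K: "0 < K"
  shows "prb {G. K \<le> real (card (hub_set n G \<tau>))} \<le> real n * q / K"
proof -
  let ?i = "\<lambda>x G. indicator {G. x \<in> hub_set n G \<tau>} G :: real"
  have cnt: "real (card (hub_set n G \<tau>)) = (\<Sum>x<n. ?i x G)" for G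
  proof -
    have "{..<n} \<inter> {x. x \<in> hub_set n G \<tau>} = hub_set n G \<tau>" by (auto simp: hub_set_def)
    moreover have "(\<Sum>x<n. ?i x G) = (\<Sum>x<n. of_bool (x \<in> hub_set n G \<tau>))" by (intro sum.cong) (auto simp: indicator_def)
    ultimately show ?thesis by (simp only: sum_of_bool_eq finite_lessThan)
  qed
  have "prb {G. K \<le> real (card (hub_set n G \<tau>))} \<le> measure_pmf.expectation (random_graph n p) (\<lambda>G. (\<Sum>x<n. ?i x G) / K)"
    by (rule prob_random_graph_le_expectation) (use K in \<open>simp_all add: cnt[symmetric] pos_le_divide_eq\<close>)
  also have "\<dots> = (\<Sum>x<n. measure_pmf.expectation (random_graph n p) (?i x)) / K"
    by (simp add: integral_sum integrable_measure_pmf_finite[OF finite_set_pmf_random_graph])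
  also have "\<dots> \<le> (\<Sum>x<n. q) / K"
    using K prob_hub by (intro divide_right_mono sum_mono) auto
  finally show ?thesis by simp
qed

text \<open>A star with centre z and r hubs as leaves: n choices for z, n^r for the leaves, r forced
  edges and r hubs.\<close>

lemma prob_many_hub_neighbours:
  "prb {G. \<exists>z<n. r \<le> card {y \<in> hub_set n G \<tau>. adjacent G z y}} \<le> real n * (real n * P * exp lam * q) ^ r"
proof -
  define I where "I = {..<n} \<times> ({..<r} \<rightarrow>\<^sub>E {..<n})"
  define E where "E = (\<lambda>(z, f). {G. inj_on f {..<r} \<and> z \<notin> f ` {..<r} \<and> (\<forall>e\<in>(\<lambda>i. {z, f i}) ` {..<r}. G e) \<and> f ` {..<r} \<subseteq> hub_set n G \<tau>})"
  have fin: "finite I" unfolding I_def by (intro finite_cartesian_product finite_PiE) auto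
  have cI: "real (card I) = real n * real n ^ r" by (simp add: I_def card_cartesian_product card_PiE)
  have sub: "{G. \<exists>z<n. r \<le> card {y \<in> hub_set n G \<tau>. adjacent G z y}} \<subseteq> (\<Union>x\<in>I. E x)"
  proof
    fix G assume "G \<in> {G. \<exists>z<n. r \<le> card {y \<in> hub_set n G \<tau>. adjacent G z y}}"
    then obtain z where z: "z < n" "r \<le> card {y \<in> hub_set n G \<tau>. adjacent G z y}" by blast
    obtain f where f: "f \<in> {..<r} \<rightarrow>\<^sub>E {y \<in> hub_set n G \<tau>. adjacent G z y}" "inj_on f {..<r}"
      by (rule injective_enumeration[OF _ z(2)]) auto
    have fi: "f i \<in> hub_set n G \<tau>" "adjacent G z (f i)" if "i < r" for i using f(1) that by (auto simp: PiE_iff)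
    then have "f \<in> {..<r} \<rightarrow>\<^sub>E {..<n}" using f(1) by (auto simp: PiE_iff hub_set_def)
    then have "(z, f) \<in> I" using z by (simp add: I_def)
    moreover have "G \<in> E (z, f)" using f(2) fi by (auto simp: E_def adjacent_def)
    ultimately show "G \<in> (\<Union>x\<in>I. E x)" by blast
  qed
  have "prb (E (z, f)) \<le> (P * exp lam) ^ r * q ^ r" if zf: "(z, f) \<in> I" for z f
  proof (cases "inj_on f {..<r} \<and> z \<notin> f ` {..<r}")
    case True
    let ?F = "(\<lambda>i. {z, f i}) ` {..<r}" and ?Y = "f ` {..<r}"
    have z: "z < n" and f: "\<And>i. i < r \<Longrightarrow> f i < n" using zf by (auto simp: I_def PiE_iff)
    have cY: "card ?Y = r" using True by (simp add: card_image)
    have "inj_on (\<lambda>i. {z, f i}) {..<r}" using True by (auto simp: inj_on_def doubleton_eq_iff)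
    then have cF: "card ?F = r" by (simp add: card_image)
    have eqE: "E (z, f) = {G. (\<forall>e\<in>?F. G e) \<and> ?Y \<subseteq> hub_set n G \<tau>}" using True by (simp add: E_def)
    have "prb (E (z, f)) \<le> (P * exp lam) ^ card ?F * q ^ card ?Y"
      unfolding eqE
    proof (rule prob_edges_and_hubs)
      show "?Y \<subseteq> {..<n}" "?F \<subseteq> edges n" using f z by auto
      show "edge_prob p e \<le> P" if e: "e \<in> ?F" for e
      proof -
        obtain i where i: "i < r" "e = {z, f i}" using e by auto
        moreover have "z \<noteq> f i" using True i(1) by blast
        ultimately show ?thesis using P(1)[OF z f] edge_prob_insert[OF p z f] by metis
      qed
      show "card ?Y \<le> r" by (simp only: cY)
    qed
    then show ?thesis by (simp only: cY cF)
  qed (use P(2) q_nonneg in \<open>auto simp: E_def\<close>)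
  then have "prb (\<Union>x\<in>I. E x) \<le> real (card I) * ((P * exp lam) ^ r * q ^ r)"
    by (intro prob_UN_uniform_le fin) (auto simp: split_paired_all)
  moreover have "prb {G. \<exists>z<n. r \<le> card {y \<in> hub_set n G \<tau>. adjacent G z y}} \<le> prb (\<Union>x\<in>I. E x)"
    using sub by (rule measure_pmf.finite_measure_mono) simp
  ultimately show ?thesis unfolding cI by (simp add: power_mult_distrib mult_ac)
qed

text \<open>A complete bipartite graph on 2 + 3 vertices. It has five vertices and six edges, so its
  expected number is at most (n P)^6 / n.\<close>

definition three_common :: "(nat set \<Rightarrow> bool) \<Rightarrow> bool" where
  "three_common G \<longleftrightarrow> (\<exists>x<n. \<exists>y<n. x \<noteq> y \<and> 3 \<le> card {z. z < n \<and> adjacent G x z \<and> adjacent G z y})"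

lemma prob_three_common: "prb {G. three_common G} \<le> real n ^ 5 * P ^ 6"
proof -
  define I where "I = ({..<n} \<times> {..<n}) \<times> ({..<3::nat} \<rightarrow>\<^sub>E {..<n})"
  define F where "F x y f = (\<lambda>i. {x, f i}) ` {..<3::nat} \<union> (\<lambda>i. {f i, y}) ` {..<3}" for x y and f :: "nat \<Rightarrow> nat"
  define E where "E = (\<lambda>((x, y), f). {G. x \<noteq> y \<and> inj_on f {..<3} \<and> x \<notin> f ` {..<3} \<and> y \<notin> f ` {..<3} \<and> (\<forall>e\<in>F x y f. G e)})"
  have fin: "finite I" unfolding I_def by (intro finite_cartesian_product finite_PiE) auto
  have cI: "real (card I) = real n ^ 5" by (simp add: I_def card_cartesian_product card_PiE power_numeral_reduce)
  have sub: "{G. three_common G} \<subseteq> (\<Union>x\<in>I. E x)"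
  proof
    fix G assume "G \<in> {G. three_common G}"
    then obtain x y where xy: "x < n" "y < n" "x \<noteq> y" "3 \<le> card {z. z < n \<and> adjacent G x z \<and> adjacent G z y}"
      unfolding three_common_def by blast
    obtain f :: "nat \<Rightarrow> nat" where f: "f \<in> {..<3} \<rightarrow>\<^sub>E {z. z < n \<and> adjacent G x z \<and> adjacent G z y}" "inj_on f {..<3}"
      by (rule injective_enumeration[OF _ xy(4)]) auto
    have fi: "f i < n" "adjacent G x (f i)" "adjacent G (f i) y" if "i < 3" for i using f(1) that by (auto simp: PiE_iff)
    then have "f \<in> {..<3} \<rightarrow>\<^sub>E {..<n}" using f(1) by (auto simp: PiE_iff)
    then have "((x, y), f) \<in> I" using xy by (simp add: I_def)
    moreover have "G \<in> E ((x, y), f)" using f(2) fi xy(3) by (auto simp: E_def F_def adjacent_def)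
    ultimately show "G \<in> (\<Union>x\<in>I. E x)" by blast
  qed
  have "prb (E ((x, y), f)) \<le> P ^ 6" if xyf: "((x, y), f) \<in> I" for x y f
  proof (cases "x \<noteq> y \<and> inj_on f {..<3} \<and> x \<notin> f ` {..<3} \<and> y \<notin> f ` {..<3}")
    case True
    have z: "x < n" "y < n" and f: "\<And>i. i < 3 \<Longrightarrow> f i < n" using xyf by (auto simp: I_def PiE_iff)
    have inj: "inj_on (\<lambda>i. {x, f i}) {..<3}" "inj_on (\<lambda>i. {f i, y}) {..<3}"
      using True by (auto simp: inj_on_def doubleton_eq_iff)
    have disj: "(\<lambda>i. {x, f i}) ` {..<3} \<inter> (\<lambda>i. {f i, y}) ` {..<3} = {}"
      using True by (auto simp: doubleton_eq_iff)
    have cF: "card (F x y f) = 6"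
      unfolding F_def by (subst card_Un_disjoint[OF _ _ disj]) (simp_all add: card_image[OF inj(1)] card_image[OF inj(2)])
    have Fe: "F x y f \<subseteq> edges n" using f z by (auto simp: F_def)
    have FP: "edge_prob p e \<le> P" if e: "e \<in> F x y f" for e
    proof -
      consider i where "i < 3" "e = {x, f i}" | i where "i < 3" "e = {f i, y}" using e by (auto simp: F_def)
      then show ?thesis
      proof cases
        case 1
        then have "x \<noteq> f i" using True by blast
        then show ?thesis using P(1)[OF z(1) f[OF 1(1)]] edge_prob_insert[OF p z(1) f[OF 1(1)]] 1(2) by simp
      next
        case 2
        then have "f i \<noteq> y" using True by blast
        then show ?thesis using P(1)[OF f[OF 2(1)] z(2)] edge_prob_insert[OF p f[OF 2(1)] z(2)] 2(2) by simp
      qed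
    qed
    have "E ((x, y), f) = {G. (\<forall>e\<in>F x y f. G e) \<and> 0 \<le> real (card {e \<in> {}. G e})}" using True by (simp add: E_def)
    also have "prb \<dots> \<le> (\<Prod>e\<in>F x y f. edge_prob p e * exp 0) * exp (exp 0 * (\<Sum>e\<in>{}. edge_prob p e) - 0 * 0)"
      by (rule prob_edges_present_and_count[OF p Fe]) simp_all
    also have "\<dots> = (\<Prod>e\<in>F x y f. edge_prob p e)" by simp
    also have "\<dots> \<le> (\<Prod>e\<in>F x y f. P)" using FP Fe edge_prob_bounds(1)[OF p] by (intro prod_mono conjI) auto
    finally show ?thesis by (simp add: cF)
  qed (use P(2) in \<open>auto simp: E_def\<close>)
  then have "prb (\<Union>x\<in>I. E x) \<le> real (card I) * P ^ 6"
    by (intro prob_UN_uniform_le fin) (auto simp: split_paired_all)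
  moreover have "prb {G. three_common G} \<le> prb (\<Union>x\<in>I. E x)"
    using sub by (rule measure_pmf.finite_measure_mono) simp
  ultimately show ?thesis unfolding cI by simp
qed

text \<open>A spider with body \<open>x\<close> and \<open>r\<close> legs of length two:
  \<open>f\<close> lists the knees and \<open>g\<close> the feet, which are distinct hubs.\<close>

definition hub_spider :: "(nat set \<Rightarrow> bool) \<Rightarrow> nat \<Rightarrow> (nat \<Rightarrow> nat) \<Rightarrow> (nat \<Rightarrow> nat) \<Rightarrow> bool" where
  "hub_spider G x f g \<longleftrightarrow> inj_on f {..<r} \<and> inj_on g {..<r} \<and> f ` {..<r} \<inter> g ` {..<r} = {} \<and>
     x \<notin> f ` {..<r} \<and> x \<notin> g ` {..<r} \<and> (\<forall>i<r. G {x, f i} \<and> G {f i, g i}) \<and> g ` {..<r} \<subseteq> hub_set n G \<tau>"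

text \<open>Besides x there are 2 r vertices, joined by 2 r forced edges, and the r feet contribute
  \<open>q ^ r\<close>.\<close>

lemma prob_hub_spider:
  "prb {G. \<exists>x<n. \<exists>f\<in>{..<r} \<rightarrow>\<^sub>E {..<n}. \<exists>g\<in>{..<r} \<rightarrow>\<^sub>E {..<n}. hub_spider G x f g}
     \<le> real n * ((real n * P * exp lam)\<^sup>2 * q) ^ r"
proof -
  define I where "I = {..<n} \<times> (({..<r} \<rightarrow>\<^sub>E {..<n}) \<times> ({..<r} \<rightarrow>\<^sub>E {..<n}))"
  have fin: "finite I" unfolding I_def by (intro finite_cartesian_product finite_PiE) auto
  have cI: "real (card I) = real n * (real n ^ r * real n ^ r)" by (simp add: I_def card_cartesian_product card_PiE)
  define E where "E = (\<lambda>(x, f, g). {G. hub_spider G x f g})"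
  have eq: "{G. \<exists>x<n. \<exists>f\<in>{..<r} \<rightarrow>\<^sub>E {..<n}. \<exists>g\<in>{..<r} \<rightarrow>\<^sub>E {..<n}. hub_spider G x f g} = (\<Union>x\<in>I. E x)"
    by (auto simp: I_def E_def)
  have "prb (E (x, f, g)) \<le> (P * exp lam) ^ (r + r) * q ^ r" if xfg: "(x, f, g) \<in> I" for x f g
  proof (cases "inj_on f {..<r} \<and> inj_on g {..<r} \<and> f ` {..<r} \<inter> g ` {..<r} = {} \<and> x \<notin> f ` {..<r} \<and> x \<notin> g ` {..<r}")
    case True
    let ?F1 = "(\<lambda>i. {x, f i}) ` {..<r}" and ?F2 = "(\<lambda>i. {f i, g i}) ` {..<r}" and ?Y = "g ` {..<r}"
    have x: "x < n" and f: "\<And>i. i < r \<Longrightarrow> f i < n" and g: "\<And>i. i < r \<Longrightarrow> g i < n"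
      using xfg by (auto simp: I_def PiE_iff)
    have ne: "f i \<noteq> g j" if "i < r" "j < r" for i j using True that by blast
    have cY: "card ?Y = r" using True by (simp add: card_image)
    have inj1: "inj_on (\<lambda>i. {x, f i}) {..<r}" using True by (auto simp: inj_on_def doubleton_eq_iff)
    have inj2: "inj_on (\<lambda>i. {f i, g i}) {..<r}"
      using True ne by (auto simp: inj_on_def doubleton_eq_iff)
    have disj: "?F1 \<inter> ?F2 = {}" using True by (auto simp: doubleton_eq_iff)
    have cF: "card (?F1 \<union> ?F2) = r + r"
      by (subst card_Un_disjoint[OF _ _ disj]) (simp_all add: card_image[OF inj1] card_image[OF inj2])
    have FP: "edge_prob p e \<le> P" if e: "e \<in> ?F1 \<union> ?F2" for e
    proof -
      consider i where "i < r" "e = {x, f i}" | i where "i < r" "e = {f i, g i}" using e by auto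
      then show ?thesis
      proof cases
        case 1
        then have "x \<noteq> f i" using True by blast
        then show ?thesis using P(1)[OF x f[OF 1(1)]] edge_prob_insert[OF p x f[OF 1(1)]] 1(2) by simp
      next
        case 2
        then show ?thesis
          using P(1)[OF f[OF 2(1)] g[OF 2(1)] ne[OF 2(1) 2(1)]] edge_prob_insert[OF p f[OF 2(1)] g[OF 2(1)]] 2(2) by simp
      qed
    qed
    have eqE: "E (x, f, g) = {G. (\<forall>e\<in>?F1 \<union> ?F2. G e) \<and> ?Y \<subseteq> hub_set n G \<tau>}"
      using True by (auto simp: E_def hub_spider_def)
    have "prb (E (x, f, g)) \<le> (P * exp lam) ^ card (?F1 \<union> ?F2) * q ^ card ?Y"
      unfolding eqE
    proof (rule prob_edges_and_hubs)
      show "?Y \<subseteq> {..<n}" using g by auto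
      show "?F1 \<union> ?F2 \<subseteq> edges n" using f g x by auto
      show "edge_prob p e \<le> P" if "e \<in> ?F1 \<union> ?F2" for e using that by (rule FP)
      show "card ?Y \<le> r" by (simp only: cY)
    qed
    then show ?thesis by (simp only: cY cF)
  next
    case False
    then have "E (x, f, g) = {}" by (auto simp: E_def hub_spider_def)
    then show ?thesis using P(2) q_nonneg by simp
  qed
  then have "prb (\<Union>x\<in>I. E x) \<le> real (card I) * ((P * exp lam) ^ (r + r) * q ^ r)"
    by (intro prob_UN_uniform_le fin) (auto simp: split_paired_all)
  also have "real (card I) * ((P * exp lam) ^ (r + r) * q ^ r) = real n * ((real n * P * exp lam)\<^sup>2 * q) ^ r"
  proof -
    have "(real n * P * exp lam)\<^sup>2 * q = (real n * real n) * ((P * exp lam) * (P * exp lam)) * q"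
      by (simp add: power2_eq_square mult_ac)
    then show ?thesis unfolding cI power_add by (simp only: power_mult_distrib mult.assoc)
  qed
  finally show ?thesis unfolding eq .
qed

text \<open>Let each shared neighbour z choose another hub \<open>h z\<close>. Without three common
  neighbours each hub is chosen at most twice, so more than 2 r shared neighbours would lead to at
  least r distinct hubs, the feet of a spider.\<close>

lemma few_bad_leaves_of_no_spider:
  assumes tc: "\<not> three_common G"
    and sp: "\<not> (\<exists>x<n. \<exists>f\<in>{..<r} \<rightarrow>\<^sub>E {..<n}. \<exists>g\<in>{..<r} \<rightarrow>\<^sub>E {..<n}. hub_spider G x f g)"
    and x: "x < n"
  shows "card {z. z < n \<and> z \<notin> hub_set n G \<tau> \<and> adjacent G x z \<and> (\<exists>y\<in>hub_set n G \<tau>. y \<noteq> x \<and> adjacent G z y)} \<le> 2 * r"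
proof (rule ccontr)
  let ?Z = "{z. z < n \<and> z \<notin> hub_set n G \<tau> \<and> adjacent G x z \<and> (\<exists>y\<in>hub_set n G \<tau>. y \<noteq> x \<and> adjacent G z y)}"
  assume "\<not> card ?Z \<le> 2 * r"
  then have big: "2 * r < card ?Z" by simp
  have "\<forall>z\<in>?Z. \<exists>y. y \<in> hub_set n G \<tau> \<and> y \<noteq> x \<and> adjacent G z y" by blast
  from bchoice[OF this] obtain h where h': "\<forall>z\<in>?Z. h z \<in> hub_set n G \<tau> \<and> h z \<noteq> x \<and> adjacent G z (h z)"
    by (elim exE)
  have h: "h z \<in> hub_set n G \<tau> \<and> h z \<noteq> x \<and> adjacent G z (h z)" if "z \<in> ?Z" for z
    using bspec[OF h' that] .
  have finZ: "finite ?Z" by simp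
  have "card ?Z \<le> 2 * card (h ` ?Z)"
  proof -
    have "card ?Z \<le> (\<Sum>y\<in>h ` ?Z. card {z \<in> ?Z. h z = y})"
    proof -
      have "?Z = (\<Union>y\<in>h ` ?Z. {z \<in> ?Z. h z = y})" by blast
      then have "card ?Z = card (\<Union>y\<in>h ` ?Z. {z \<in> ?Z. h z = y})" by (rule arg_cong)
      also have "\<dots> \<le> (\<Sum>y\<in>h ` ?Z. card {z \<in> ?Z. h z = y})" by (rule card_UN_le) (rule finite_imageI[OF finZ])
      finally show ?thesis .
    qed
    also have "\<dots> \<le> (\<Sum>y\<in>h ` ?Z. 2)"
    proof (rule sum_mono)
      fix y assume "y \<in> h ` ?Z"
      then obtain z where z: "z \<in> ?Z" "y = h z" by blast
      then have y: "y < n" "y \<noteq> x" using h[OF z(1)] by (auto simp: hub_set_def)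
      have "card {z \<in> ?Z. h z = y} \<le> card {z. z < n \<and> adjacent G x z \<and> adjacent G z y}"
        by (rule card_mono) (use h in auto)
      also have "\<dots> \<le> 2"
      proof (rule ccontr)
        assume "\<not> ?thesis"
        then have "3 \<le> card {z. z < n \<and> adjacent G x z \<and> adjacent G z y}" by linarith
        then show False using tc x y unfolding three_common_def by blast
      qed
      finally show "card {z \<in> ?Z. h z = y} \<le> 2" .
    qed
    finally show ?thesis by simp
  qed
  then have "r \<le> card (h ` ?Z)" using big by linarith
  then obtain g where g: "g \<in> {..<r} \<rightarrow>\<^sub>E h ` ?Z" "inj_on g {..<r}"
    by (rule injective_enumeration[OF finite_imageI[OF finZ]])
  have gi: "g i \<in> h ` ?Z" if "i < r" for i using PiE_mem[OF g(1)] that by simp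
  \<comment> \<open>\<open>f\<close> picks preimages of the feet under \<open>h\<close>; it is
    injective because \<open>h\<close> maps it to the injective \<open>g\<close>.\<close>
  then have "\<forall>i\<in>{..<r}. \<exists>z. z \<in> ?Z \<and> h z = g i" by (fastforce simp del: mem_Collect_eq)
  from bchoice[OF this] obtain f where f': "\<forall>i\<in>{..<r}. f i \<in> ?Z \<and> h (f i) = g i"
    by (elim exE)
  have f: "f i \<in> ?Z \<and> h (f i) = g i" if "i < r" for i using bspec[OF f', of i] that by blast
  let ?f = "restrict f {..<r}"
  have hg: "g i \<in> hub_set n G \<tau>" "g i \<noteq> x" "adjacent G (f i) (g i)" if "i < r" for i
    using h[of "f i"] f[OF that] by auto
  have fz: "f i < n" "f i \<notin> hub_set n G \<tau>" "adjacent G x (f i)" if "i < r" for i using f[OF that] by auto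
  have "hub_spider G x ?f g"
    unfolding hub_spider_def
  proof (intro conjI)
    show "inj_on ?f {..<r}"
    proof (rule inj_onI)
      fix i j assume ij: "i \<in> {..<r}" "j \<in> {..<r}" "?f i = ?f j"
      then have "g i = g j" using f[of i] f[of j] by (metis lessThan_iff restrict_apply')
      then show "i = j" using g(2) ij by (auto dest: inj_onD)
    qed
    show "?f ` {..<r} \<inter> g ` {..<r} = {}"
    proof (rule equals0I)
      fix w assume "w \<in> ?f ` {..<r} \<inter> g ` {..<r}"
      then obtain i j where "i < r" "j < r" "w = f i" "w = g j" by auto
      then show False using fz(2)[of i] hg(1)[of j] by simp
    qed
    show "x \<notin> ?f ` {..<r}" using fz(3) by (auto simp: adjacent_def)
    show "x \<notin> g ` {..<r}" using hg(2) by auto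
    show "\<forall>i<r. G {x, ?f i} \<and> G {?f i, g i}" using fz(3) hg(3) by (auto simp: adjacent_def)
    show "g ` {..<r} \<subseteq> hub_set n G \<tau>" using hg(1) by auto
  qed (rule g(2))
  moreover have "?f \<in> {..<r} \<rightarrow>\<^sub>E {..<n}" using fz(1) by (simp add: PiE_iff)
  moreover have "g \<in> {..<r} \<rightarrow>\<^sub>E {..<n}" using g(1) hg(1) by (auto simp: PiE_iff hub_set_def)
  ultimately show False using sp x by blast
qed

end

section \<open>High probability bounds\<close>

text \<open>Write l = ln n and w = l / d, so that L = l / ln w. Small \<eta> makes w large, and
  \<open>d >= \<kappa>\<close> gives \<open>L >= l / ln (l / \<kappa>)\<close>, which tends to
  infinity. The last conclusion is the Chernoff exponent for degree \<delta> L at tilt ln (L / d),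
  where \<open>d * exp lam\<close> is L: since \<open>ln (L / d) >= 3/4 * ln w\<close>, the gain is
  at least \<open>3/4 * \<delta> * l\<close>, and the loss L is at most
  \<open>\<delta>/4 * l\<close>.\<close>

lemma L_param_bounds:
  fixes \<kappa> \<delta> K :: real
  assumes \<kappa>: "\<kappa> > 0" and \<delta>: "\<delta> > 0"
  obtains \<eta> N where "\<eta> > 0"
    "\<And>n d. n \<ge> N \<Longrightarrow> \<kappa> \<le> d \<Longrightarrow> d \<le> \<eta> * ln (real n) \<Longrightarrow> K \<le> L_param n d 1"
    "\<And>n d. n \<ge> N \<Longrightarrow> \<kappa> \<le> d \<Longrightarrow> d \<le> \<eta> * ln (real n) \<Longrightarrow> L_param n d 1 \<le> ln (real n)"
    "\<And>n d. n \<ge> N \<Longrightarrow> \<kappa> \<le> d \<Longrightarrow> d \<le> \<eta> * ln (real n) \<Longrightarrow> d \<le> L_param n d 1"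
    "\<And>n d. n \<ge> N \<Longrightarrow> \<kappa> \<le> d \<Longrightarrow> d \<le> \<eta> * ln (real n) \<Longrightarrow>
       L_param n d 1 - ln (L_param n d 1 / d) * (\<delta> * L_param n d 1) \<le> - (\<delta> / 2) * ln (real n)"
proof -
  have "eventually (\<lambda>w. 1 \<le> ln w \<and> 4 / \<delta> \<le> ln w \<and> ln (ln w) \<le> 1 / 4 * ln w \<and> ln w \<le> w) at_top"
    using \<delta> by (intro eventually_conj) (real_asymp+)
  then obtain W0 where W0: "\<And>w. w \<ge> W0 \<Longrightarrow> 1 \<le> ln w \<and> 4 / \<delta> \<le> ln w \<and> ln (ln w) \<le> 1 / 4 * ln w \<and> ln w \<le> w"
    unfolding eventually_at_top_linorder by blast
  define W where "W = max W0 1"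
  have W: "W > 0" "W0 \<le> W" by (simp_all add: W_def)
  have "filterlim (\<lambda>n::nat. ln (real n) / ln (ln (real n) / \<kappa>)) at_top sequentially" using \<kappa> by real_asymp
  then have "eventually (\<lambda>n::nat. K \<le> ln (real n) / ln (ln (real n) / \<kappa>)) sequentially"
    unfolding filterlim_at_top by blast
  then obtain N where N: "\<And>n. n \<ge> N \<Longrightarrow> K \<le> ln (real n) / ln (ln (real n) / \<kappa>)"
    unfolding eventually_sequentially by blast
  have facts: "K \<le> L_param n d 1 \<and> L_param n d 1 \<le> ln (real n) \<and> d \<le> L_param n d 1 \<and>
      L_param n d 1 - ln (L_param n d 1 / d) * (\<delta> * L_param n d 1) \<le> - (\<delta> / 2) * ln (real n)"
    if n: "n \<ge> N" and d: "\<kappa> \<le> d" "d \<le> 1 / W * ln (real n)" for n d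
  proof -
    define l where "l = ln (real n)"
    define w where "w = l / d"
    define L where "L = L_param n d 1"
    have d0: "d > 0" using \<kappa> d by simp
    have "d * W \<le> l" using d(2) W by (simp add: l_def field_simps)
    then have wW: "w \<ge> W" using d0 by (simp add: w_def pos_le_divide_eq mult.commute)
    then have w: "1 \<le> ln w" "4 / \<delta> \<le> ln w" "ln (ln w) \<le> 1 / 4 * ln w" "ln w \<le> w"
      using W0[of w] W by auto
    have w0: "w > 0" using wW W by simp
    have l: "l = d * w" using d0 by (simp add: w_def)
    then have l0: "l > 0" using d0 w0 by simp
    have L: "L = l / ln w" by (simp add: L_def L_param_def l_def w_def)
    have L0: "L > 0" unfolding L using l0 w(1) by (intro divide_pos_pos) auto
    have 1: "K \<le> L"
    proof -
      have "w \<le> l / \<kappa>" unfolding w_def using d \<kappa> l0 by (intro divide_left_mono) auto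
      then have le: "ln w \<le> ln (l / \<kappa>)" using w0 by simp
      have "0 < ln w" "0 < ln (l / \<kappa>)" using w(1) le by linarith+
      then have "l / ln (l / \<kappa>) \<le> L"
        unfolding L by (intro divide_left_mono[OF le less_imp_le[OF l0]] mult_pos_pos)
      then show ?thesis using N[OF n] by (simp add: l_def)
    qed
    have 2: "L \<le> l"
    proof -
      have "0 < ln w" using w(1) by linarith
      then show ?thesis unfolding L using mult_left_mono[OF w(1), of l] l0 by (simp only: pos_divide_le_eq) simp
    qed
    have 3: "d \<le> L"
    proof -
      have "0 < ln w" using w(1) by linarith
      then show ?thesis unfolding L l using mult_left_mono[OF w(4), of d] d0 by (simp only: pos_le_divide_eq)
    qed
    have 4: "L - ln (L / d) * (\<delta> * L) \<le> - (\<delta> / 2) * l"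
    proof -
      have lw: "0 < ln w" using w(1) by linarith
      have "ln (L / d) = ln (w / ln w)" using d0 by (simp add: L l)
      also have "\<dots> = ln w - ln (ln w)" using w0 w by (simp add: ln_div)
      finally have "ln (L / d) \<ge> 3 / 4 * ln w" using w(3) by simp
      then have "ln (L / d) * (\<delta> * L) \<ge> 3 / 4 * ln w * (\<delta> * L)" using \<delta> L0 by (intro mult_right_mono) auto
      moreover have "ln w * L = l" unfolding L using lw by (intro nonzero_mult_div_cancel_left[of "ln w" l, unfolded times_divide_eq_right[symmetric]]) linarith
      then have "3 / 4 * ln w * (\<delta> * L) = 3 / 4 * \<delta> * l" by (simp add: mult_ac)
      moreover have "L \<le> \<delta> / 4 * l"
      proof -
        have "1 \<le> \<delta> / 4 * ln w" using w(2) \<delta> by (simp add: field_simps)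
        then have "l * 1 \<le> l * (\<delta> / 4 * ln w)" using l0 by (intro mult_left_mono) auto
        then show ?thesis unfolding L pos_divide_le_eq[OF lw] by (simp add: mult_ac)
      qed
      ultimately show ?thesis by linarith
    qed
    show ?thesis using 1 2 3 4 by (simp add: L_def l_def)
  qed
  show thesis by (rule that[of "1 / W" N]) (use W facts in auto)
qed

lemma eigenvalues_of_good_graph:
  assumes p: "edge_probabilities n p"
    and n: "n > 0" "2 + ln (5 * real n) + ln (real n) \<le> real n"
    and P: "\<And>i j. i < n \<Longrightarrow> j < n \<Longrightarrow> i \<noteq> j \<Longrightarrow> p i j \<le> P" "0 \<le> P" "real n * P \<le> s\<^sup>2"
    and s: "s \<ge> 1" and \<tau>: "0 \<le> \<tau>" "\<tau> \<le> s\<^sup>2"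
    and light: "\<not> (\<exists>x\<in>dyadic_net n. \<exists>y\<in>dyadic_net n. 56 * s * real n \<le> light_sum n p s G x y)"
    and disc: "discrepancy_bounded n s G"
    and hubs: "\<And>z. z < n \<Longrightarrow> card {y \<in> hub_set n G \<tau>. adjacent G z y} \<le> r"
      "\<And>x. x \<in> hub_set n G \<tau> \<Longrightarrow> card {z. z < n \<and> z \<notin> hub_set n G \<tau> \<and> adjacent G x z \<and>
         (\<exists>y\<in>hub_set n G \<tau>. y \<noteq> x \<and> adjacent G z y)} \<le> 2 * r"
    and d: "0 < d" "\<And>i. i < n \<Longrightarrow> (\<Sum>j<n. p i j) \<le> d"
    and few_hubs: "d * (real (card (hub_set n G \<tau>)) * P) \<le> 1"
    and k: "1 \<le> k" "k + card (hub_set n G \<tau>) \<le> n"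
    and B: "2661 * s + 3 * real r + 3 + sqrt (\<tau> + 3 * real r + 1) \<le> B"
  shows "\<bar>eigenvalue_nth (centered_adj_mat n p G) k - sqrt (ordered_degree n G k)\<bar> \<le> B \<and>
    \<bar>eigenvalue_nth (centered_adj_mat n p G) (n + 1 - k) + sqrt (ordered_degree n G k)\<bar> \<le> B"
proof -
  have ps: "p i j \<le> s\<^sup>2 / real n" if "i < n" "j < n" "i \<noteq> j" for i j
  proof -
    have "P \<le> s\<^sup>2 / real n" using P(3) n by (simp add: pos_le_divide_eq mult.commute)
    then show ?thesis using P(1)[OF that] by linarith
  qed
  interpret hub_graph n p G \<tau> "2661 * s" d P r
  proof unfold_locales
    show "\<bar>offdiag_form n p G f f\<bar> \<le> 2661 * s * (\<Sum>i<n. (f i)\<^sup>2)"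
      if f: "\<And>i. i < n \<Longrightarrow> f i \<noteq> 0 \<Longrightarrow> offdiag_degree n G i < \<tau>" for f
    proof (rule offdiag_form_bound[OF p ps _ disc s n])
      show "light_sum n p s G x y \<le> 56 * s * real n" if "x \<in> dyadic_net n" "y \<in> dyadic_net n" for x y
        using light that by (meson linear)
      show "offdiag_degree n G i \<le> s\<^sup>2" if "i < n" "f i \<noteq> 0" for i using f[OF that] \<tau> by linarith
    qed
    show "0 \<le> 2661 * s" using s by simp
  qed (fact p \<tau>(1) P(2) hubs d P(1) few_hubs)+
  show ?thesis using eigenvalues_near_degrees[OF k] B by linarith
qed

lemma prob_Un_le: "measure_pmf.prob M (A \<union> B) \<le> measure_pmf.prob M A + measure_pmf.prob M B"
  by (rule measure_Un_le) simp_all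

lemma prob_ge_of_bad_event:
  assumes "- B \<subseteq> A" "measure_pmf.prob M B \<le> \<theta>"
  shows "1 - \<theta> \<le> measure_pmf.prob M A"
proof -
  have "measure_pmf.prob M (- B) = 1 - measure_pmf.prob M B"
    using measure_pmf.prob_compl[of B M] by (simp add: Compl_eq_Diff_UNIV)
  moreover have "measure_pmf.prob M (- B) \<le> measure_pmf.prob M A"
    using assms(1) by (rule measure_pmf.finite_measure_mono) simp
  ultimately show ?thesis using assms(2) by linarith
qed

context sparse_random_graph
begin

lemma prob_bad_graph:
  assumes n: "n > 0" and s: "s > 0" "real n * P \<le> s\<^sup>2" and K: "0 < K"
  defines "X \<equiv> real n * P * exp lam"
  shows "prb ({G. \<exists>x\<in>dyadic_net n. \<exists>y\<in>dyadic_net n. 56 * s * real n \<le> light_sum n p s G x y}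
      \<union> {G. \<not> discrepancy_bounded n s G}
      \<union> {G. \<exists>z<n. r \<le> card {y \<in> hub_set n G \<tau>. adjacent G z y}}
      \<union> {G. three_common G}
      \<union> {G. \<exists>x<n. \<exists>f\<in>{..<r} \<rightarrow>\<^sub>E {..<n}. \<exists>g\<in>{..<r} \<rightarrow>\<^sub>E {..<n}. hub_spider G x f g}
      \<union> {G. K \<le> real (card (hub_set n G \<tau>))})
    \<le> exp (- real n) + 1 / real n + real n * (X * q) ^ r + real n ^ 5 * P ^ 6 + real n * (X\<^sup>2 * q) ^ r + real n * q / K"
    and "prb ({G. \<exists>x\<in>dyadic_net n. \<exists>y\<in>dyadic_net n. 56 * s * real n \<le> light_sum n p s G x y}
      \<union> {G. \<not> discrepancy_bounded n s G} \<union> {G. hub_set n G \<tau> \<noteq> {}})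
    \<le> exp (- real n) + 1 / real n + real n * q"
proof -
  have ps: "p i j \<le> s\<^sup>2 / real n" if "i < n" "j < n" "i \<noteq> j" for i j
  proof -
    have "P \<le> s\<^sup>2 / real n" using s(2) n by (simp add: pos_le_divide_eq mult.commute)
    then show ?thesis using P(1)[OF that] by linarith
  qed
  note l = prob_light_event[OF p s(1) n ps] and dd = prob_not_discrepancy_bounded[OF p n ps]
  show "prb ({G. \<exists>x\<in>dyadic_net n. \<exists>y\<in>dyadic_net n. 56 * s * real n \<le> light_sum n p s G x y}
      \<union> {G. \<not> discrepancy_bounded n s G}
      \<union> {G. \<exists>z<n. r \<le> card {y \<in> hub_set n G \<tau>. adjacent G z y}}
      \<union> {G. three_common G}
      \<union> {G. \<exists>x<n. \<exists>f\<in>{..<r} \<rightarrow>\<^sub>E {..<n}. \<exists>g\<in>{..<r} \<rightarrow>\<^sub>E {..<n}. hub_spider G x f g}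
      \<union> {G. K \<le> real (card (hub_set n G \<tau>))})
    \<le> exp (- real n) + 1 / real n + real n * (X * q) ^ r + real n ^ 5 * P ^ 6 + real n * (X\<^sup>2 * q) ^ r + real n * q / K"
    unfolding X_def
    by (intro order_trans[OF prob_Un_le] add_mono l dd prob_many_hub_neighbours prob_three_common prob_hub_spider prob_many_hubs[OF K])
  show "prb ({G. \<exists>x\<in>dyadic_net n. \<exists>y\<in>dyadic_net n. 56 * s * real n \<le> light_sum n p s G x y}
      \<union> {G. \<not> discrepancy_bounded n s G} \<union> {G. hub_set n G \<tau> \<noteq> {}})
    \<le> exp (- real n) + 1 / real n + real n * q"
    by (intro order_trans[OF prob_Un_le] add_mono l dd prob_hub_exists)
qed

end

section \<open>Assembling the high probability event\<close>

lemma p_max_ge: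
  assumes "i < n" "j < n" "i \<noteq> j" shows "p i j \<le> p_max n p"
  unfolding p_max_def
proof (rule Max_ge)
  have "{p i j | i j. i < n \<and> j < n \<and> i \<noteq> j} \<subseteq> (\<lambda>(i, j). p i j) ` ({..<n} \<times> {..<n})" by auto
  then show "finite {p i j | i j. i < n \<and> j < n \<and> i \<noteq> j}" by (rule finite_subset) simp
qed (use assms in blast)

lemma max_mean_degree_ge:
  assumes "i < n" shows "(\<Sum>j<n. p i j) \<le> max_mean_degree n p"
  unfolding max_mean_degree_def by (rule Max_ge) (use assms in auto)

definition eigenvalue_event :: "nat \<Rightarrow> (nat \<Rightarrow> nat \<Rightarrow> real) \<Rightarrow> real \<Rightarrow> real \<Rightarrow> (nat set \<Rightarrow> bool) set" where
  "eigenvalue_event n p t B = {G. \<forall>k. 1 \<le> k \<and> real k \<le> t \<longrightarrow>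
      \<bar>eigenvalue_nth (centered_adj_mat n p G) k - sqrt (ordered_degree n G k)\<bar> \<le> B \<and>
      \<bar>eigenvalue_nth (centered_adj_mat n p G) (n + 1 - k) + sqrt (ordered_degree n G k)\<bar> \<le> B}"

text \<open>If \<open>n * P\<close> dominates \<open>L\<close>, no star is visible above the noise level: with threshold
  \<open>4 * L\<close> there are no hubs at all.\<close>

lemma eigenvalue_event_dense:
  fixes n :: nat
  assumes p: "edge_probabilities n p"
    and n: "n > 0" "2 + ln (5 * real n) + ln (real n) \<le> real n"
    and P: "\<And>i j. i < n \<Longrightarrow> j < n \<Longrightarrow> i \<noteq> j \<Longrightarrow> p i j \<le> P" "0 \<le> P"
    and d: "0 < d" "\<And>i. i < n \<Longrightarrow> (\<Sum>j<n. p i j) \<le> d"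
    and L: "1 \<le> L" "d \<le> L" "L \<le> real n * P" "L - ln (L / d) * (4 * L) \<le> - 2 * ln (real n)"
    and w: "L / d \<le> (ln (real n))\<^sup>2"
    and t: "t \<le> real n"
    and B: "5324 * sqrt (real n * P) + 4 \<le> B"
    and \<theta>: "exp (- real n) + 1 / real n + (ln (real n))\<^sup>2 / real n \<le> \<theta>"
  shows "1 - \<theta> \<le> measure_pmf.prob (random_graph n p) (eigenvalue_event n p t B)"
proof -
  define lam where "lam = ln (L / d)"
  \<comment> \<open>The factor 2 makes \<open>s\<^sup>2 = 4 * (n * P)\<close>, which is at least the
    hub threshold \<open>4 * L\<close>.\<close>
  define s where "s = 2 * sqrt (real n * P)"
  have w1: "1 \<le> L / d" using L(2) d(1) by simp
  have lam_nonneg: "0 \<le> lam" and exp_lam: "exp lam = L / d" using w1 by (simp_all add: lam_def)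
  \<comment> \<open>Only single hubs have to be excluded. Lowering the threshold by 1 costs the
    factor \<open>exp lam = L / d\<close> in \<open>q\<close>.\<close>
  interpret sparse_random_graph n p P d "4 * L" lam 1
    by unfold_locales (fact p P d lam_nonneg | simp)+
  have nP: "1 \<le> real n * P" using L by linarith
  then have sq: "1 \<le> sqrt (real n * P)" by simp
  then have s: "s \<ge> 1" unfolding s_def by linarith
  have s2: "s\<^sup>2 = 4 * (real n * P)" using nP by (simp add: s_def power_mult_distrib)
  have q_le: "q \<le> 1 / (real n)\<^sup>2 * (ln (real n))\<^sup>2"
  proof -
    have "d * exp lam - lam * (4 * L - 1) = (L - ln (L / d) * (4 * L)) + lam"
      using d(1) L(1) by (simp add: lam_def algebra_simps)
    moreover have "q = exp (d * exp lam - lam * (4 * L - 1))" unfolding q_def by simp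
    ultimately have "q = exp (L - ln (L / d) * (4 * L)) * (L / d)" by (simp only: exp_add exp_lam)
    also have "\<dots> \<le> exp (- 2 * ln (real n)) * (ln (real n))\<^sup>2"
      using L(4) w w1 by (intro mult_mono) auto
    also have "exp (- 2 * ln (real n)) = 1 / (real n)\<^sup>2"
      using n exp_of_nat_mult[of 2 "ln (real n)"] by (simp add: exp_minus divide_inverse)
    finally show ?thesis .
  qed
  let ?B = "{G. \<exists>x\<in>dyadic_net n. \<exists>y\<in>dyadic_net n. 56 * s * real n \<le> light_sum n p s G x y}
      \<union> {G. \<not> discrepancy_bounded n s G} \<union> {G. hub_set n G (4 * L) \<noteq> {}}"
  show ?thesis
  proof (rule prob_ge_of_bad_event[of ?B])
    have "prb ?B \<le> exp (- real n) + 1 / real n + real n * q"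
    proof (rule prob_bad_graph(2)[OF n(1), of s 1])
      show "0 < s" using s by linarith
      show "real n * P \<le> s\<^sup>2" unfolding s2 using nP by linarith
    qed simp
    also have "real n * q \<le> real n * (1 / (real n)\<^sup>2 * (ln (real n))\<^sup>2)" by (rule mult_left_mono[OF q_le]) simp
    also have "\<dots> = (ln (real n))\<^sup>2 / real n" using n by (simp add: power2_eq_square)
    finally show "prb ?B \<le> \<theta>" using \<theta> by linarith
    show "- ?B \<subseteq> eigenvalue_event n p t B"
    proof
      fix G assume "G \<in> - ?B"
      then have G: "\<not> (\<exists>x\<in>dyadic_net n. \<exists>y\<in>dyadic_net n. 56 * s * real n \<le> light_sum n p s G x y)"
        "discrepancy_bounded n s G" "hub_set n G (4 * L) = {}" by auto
      show "G \<in> eigenvalue_event n p t B"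
        unfolding eigenvalue_event_def
      proof (intro CollectI allI impI)
        fix k assume k: "1 \<le> k \<and> real k \<le> t"
        show "\<bar>eigenvalue_nth (centered_adj_mat n p G) k - sqrt (ordered_degree n G k)\<bar> \<le> B \<and>
          \<bar>eigenvalue_nth (centered_adj_mat n p G) (n + 1 - k) + sqrt (ordered_degree n G k)\<bar> \<le> B"
        \<comment> \<open>Without hubs there are no irregular edges, so the deterministic bound
          applies with r = 0.\<close>
        proof (rule eigenvalues_of_good_graph[OF p n P _ s _ _ G(1,2), where r = 0 and \<tau> = "4 * L" and d = d])
          have "sqrt (4 * L + 3 * real 0 + 1) \<le> sqrt (4 * L) + sqrt 1"
            using sqrt_add_le_add_sqrt[of "4 * L" 1] L(1) by simp
          also have "sqrt (4 * L) \<le> sqrt (4 * (real n * P))" using L(3) by simp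
          also have "\<dots> = 2 * sqrt (real n * P)" by (simp add: real_sqrt_mult)
          finally show "2661 * s + 3 * real 0 + 3 + sqrt (4 * L + 3 * real 0 + 1) \<le> B" using B by (simp add: s_def)
        qed (use G(3) s2 nP L k t d P(2) in auto)
      qed
    qed
  qed
qed

text \<open>Up to logarithms q is \<open>n powr (- \<delta> / 2)\<close>. Then
  \<open>4 <= \<delta> * r\<close> makes each r-hub configuration have probability about 1 / n.
  About \<open>n powr (1 - \<delta> / 2)\<close> hubs are expected; the cutoff
  \<open>K = n powr (1 - \<delta> / 4)\<close> is large enough for Markov's inequality and still
  small enough for \<open>d * K * P\<close> to be at most 1.\<close>

lemma eigenvalue_event_sparse:
  fixes n r :: nat
  assumes p: "edge_probabilities n p"
    and n: "n > 0" "2 + ln (5 * real n) + ln (real n) \<le> real n" "1 \<le> ln (real n)"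
    and P: "\<And>i j. i < n \<Longrightarrow> j < n \<Longrightarrow> i \<noteq> j \<Longrightarrow> p i j \<le> P" "0 \<le> P"
    and d: "0 < d" "\<And>i. i < n \<Longrightarrow> (\<Sum>j<n. p i j) \<le> d"
    and \<delta>: "0 < \<delta>" and r_ge: "1 \<le> r" "4 \<le> \<delta> * real r"
    and L: "1 \<le> \<delta> * L" "d \<le> L" "L \<le> ln (real n)" "real n * P \<le> L"
      "L - ln (L / d) * (\<delta> * L) \<le> - (\<delta> / 2) * ln (real n)"
    and w: "L / d \<le> (ln (real n))\<^sup>2" "1 + (L * (L / d))\<^sup>2 \<le> ln (real n) ^ 8"
    and t: "t \<le> real n / 2" "real n powr (1 - \<delta> / 4) \<le> real n / 2"
    and few: "ln (real n) * ln (real n) * real n powr (- (\<delta> / 4)) \<le> 1"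
    and B: "2661 * sqrt (real n * P) + 2662 * sqrt (\<delta> * L) + 6 * real r + 4 \<le> B"
    and \<theta>: "exp (- real n) + 1 / real n + 2 * (ln (real n) ^ ((8 + 2 * r) * r) / real n) + ln (real n) ^ 6 / real n
       + real n powr (- (\<delta> / 4)) * ln (real n) ^ (2 * r) \<le> \<theta>"
  shows "1 - \<theta> \<le> measure_pmf.prob (random_graph n p) (eigenvalue_event n p t B)"
proof -
  define lam where "lam = ln (L / d)"
  define s where "s = sqrt (max (real n * P) (\<delta> * L))"
  define l where "l = ln (real n)"
  define K where "K = real n powr (1 - \<delta> / 4)"
  have l1: "1 \<le> l" using n(3) by (simp add: l_def)
  have n0: "real n > 0" using n by simp
  have L0: "0 < L" using L(2) d(1) by linarith
  have w1: "1 \<le> L / d" using L(2) d(1) by simp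
  have lam_nonneg: "0 \<le> lam" and exp_lam: "exp lam = L / d" using w1 by (simp_all add: lam_def)
  interpret sparse_random_graph n p P d "\<delta> * L" lam r
    by unfold_locales (fact p P d lam_nonneg r_ge(1))+
  have s2: "s\<^sup>2 = max (real n * P) (\<delta> * L)" using L(1) by (simp add: s_def)
  have s1: "s \<ge> 1" using L(1) by (simp add: s_def)
  have K0: "K > 0" using n0 by (simp add: K_def)
  have q_le: "q \<le> real n powr (- (\<delta> / 2)) * l ^ (2 * r)"
  proof -
    have "d * exp lam - lam * (\<delta> * L - real r) = (L - ln (L / d) * (\<delta> * L)) + real r * lam"
      using d(1) L0 by (simp add: lam_def algebra_simps)
    then have "q = exp (L - ln (L / d) * (\<delta> * L)) * (L / d) ^ r"
      by (simp add: q_def exp_add exp_of_nat_mult exp_lam)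
    also have "\<dots> \<le> exp (- (\<delta> / 2) * ln (real n)) * (l\<^sup>2) ^ r"
      using L(5) w(1) w1 by (intro mult_mono power_mono) (auto simp: l_def)
    also have "exp (- (\<delta> / 2) * ln (real n)) = real n powr (- (\<delta> / 2))" using n0 by (simp add: powr_def)
    finally show ?thesis by (simp add: power_mult)
  qed
  define X where "X = real n * P * exp lam"
  have X0: "0 \<le> X" using P(2) by (simp add: X_def)
  have X_le: "X \<le> L * (L / d)" unfolding X_def exp_lam using L(4) w1 by (intro mult_right_mono) auto
  have X8: "X \<le> l ^ 8" "X\<^sup>2 \<le> l ^ 8"
  proof -
    have "X\<^sup>2 \<le> (L * (L / d))\<^sup>2" using X_le X0 by (rule power_mono)
    then have X2: "1 + X\<^sup>2 \<le> l ^ 8" using w(2) by (simp add: l_def)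
    then show "X\<^sup>2 \<le> l ^ 8" by linarith
    have "0 \<le> (X - 1)\<^sup>2" by simp
    then have "2 * X \<le> 1 + X\<^sup>2" by (simp add: power2_diff)
    then show "X \<le> l ^ 8" using X2 X0 by linarith
  qed
  \<comment> \<open>Applied to X and to its square: the two configurations spend one and two edges
    per hub, respectively.\<close>
  have spider: "real n * (Y * q) ^ r \<le> l ^ ((8 + 2 * r) * r) / real n" if Y: "0 \<le> Y" "Y \<le> l ^ 8" for Y
  proof -
    have "Y * q \<le> l ^ 8 * (real n powr (- (\<delta> / 2)) * l ^ (2 * r))"
      using Y q_le q_nonneg l1 by (intro mult_mono) auto
    also have "\<dots> = real n powr (- (\<delta> / 2)) * l ^ (8 + 2 * r)" by (simp add: power_add)
    finally have "(Y * q) ^ r \<le> (real n powr (- (\<delta> / 2)) * l ^ (8 + 2 * r)) ^ r"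
      using Y q_nonneg by (intro power_mono) auto
    also have "\<dots> = (real n powr (- (\<delta> / 2))) ^ r * l ^ ((8 + 2 * r) * r)"
      by (simp add: power_mult_distrib power_mult)
    also have "(real n powr (- (\<delta> / 2))) ^ r = real n powr (- (\<delta> * real r / 2))"
      using n0 by (simp add: powr_realpow[symmetric] powr_powr)
    also have "real n powr (- (\<delta> * real r / 2)) * l ^ ((8 + 2 * r) * r) \<le> real n powr (- 2) * l ^ ((8 + 2 * r) * r)"
      using r_ge(2) n l1 by (intro mult_right_mono powr_mono) auto
    finally have "real n * (Y * q) ^ r \<le> real n * (real n powr (- 2) * l ^ ((8 + 2 * r) * r))"
      by (rule mult_left_mono) simp
    also have "real n powr (- 2) = 1 / (real n * real n)" using n0 by (simp add: powr_minus_divide power2_eq_square)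
    finally show ?thesis using n0 by simp
  qed
  let ?B = "{G. \<exists>x\<in>dyadic_net n. \<exists>y\<in>dyadic_net n. 56 * s * real n \<le> light_sum n p s G x y}
      \<union> {G. \<not> discrepancy_bounded n s G}
      \<union> {G. \<exists>z<n. r \<le> card {y \<in> hub_set n G (\<delta> * L). adjacent G z y}}
      \<union> {G. three_common G}
      \<union> {G. \<exists>x<n. \<exists>f\<in>{..<r} \<rightarrow>\<^sub>E {..<n}. \<exists>g\<in>{..<r} \<rightarrow>\<^sub>E {..<n}. hub_spider G x f g}
      \<union> {G. K \<le> real (card (hub_set n G (\<delta> * L)))}"
  show ?thesis
  proof (rule prob_ge_of_bad_event[of ?B])
    have "prb ?B \<le> exp (- real n) + 1 / real n + real n * (X * q) ^ r + real n ^ 5 * P ^ 6 + real n * (X\<^sup>2 * q) ^ r + real n * q / K"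
      unfolding X_def by (rule prob_bad_graph(1)[OF n(1) _ _ K0]) (use s1 s2 in auto)
    moreover have "real n * (X * q) ^ r \<le> l ^ ((8 + 2 * r) * r) / real n" by (rule spider[OF X0 X8(1)])
    moreover have "real n * (X\<^sup>2 * q) ^ r \<le> l ^ ((8 + 2 * r) * r) / real n" by (rule spider[OF _ X8(2)]) simp
    moreover have "real n ^ 5 * P ^ 6 \<le> l ^ 6 / real n"
    proof -
      have "(real n * P) ^ 6 \<le> l ^ 6" using L(3,4) P(2) by (intro power_mono) (auto simp: l_def)
      then have "(real n * P) ^ 6 / real n \<le> l ^ 6 / real n" using n0 by (intro divide_right_mono) auto
      moreover have "(real n * P) ^ 6 / real n = real n ^ 5 * P ^ 6"
        using n0 by (simp add: power_mult_distrib power_numeral_reduce)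
      ultimately show ?thesis by simp
    qed
    moreover have "real n * q / K \<le> real n powr (- (\<delta> / 4)) * l ^ (2 * r)"
    proof -
      have "real n * q / K \<le> real n * (real n powr (- (\<delta> / 2)) * l ^ (2 * r)) / K"
        using K0 by (intro divide_right_mono mult_left_mono q_le) auto
      also have "\<dots> = (real n powr 1 * real n powr (- (\<delta> / 2)) / real n powr (1 - \<delta> / 4)) * l ^ (2 * r)"
        using n0 by (simp add: K_def)
      also have "real n powr 1 * real n powr (- (\<delta> / 2)) / real n powr (1 - \<delta> / 4) = real n powr (- (\<delta> / 4))"
        unfolding powr_add[symmetric] powr_diff[symmetric] by (rule arg_cong[of _ _ "(powr) (real n)"]) simp
      finally show ?thesis .
    qed
    ultimately show "prb ?B \<le> \<theta>" using \<theta> unfolding l_def by linarith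
    show "- ?B \<subseteq> eigenvalue_event n p t B"
    proof
      fix G assume "G \<in> - ?B"
      then have G: "\<not> (\<exists>x\<in>dyadic_net n. \<exists>y\<in>dyadic_net n. 56 * s * real n \<le> light_sum n p s G x y)"
        "discrepancy_bounded n s G" "\<not> (\<exists>z<n. r \<le> card {y \<in> hub_set n G (\<delta> * L). adjacent G z y})"
        "\<not> three_common G" "\<not> (\<exists>x<n. \<exists>f\<in>{..<r} \<rightarrow>\<^sub>E {..<n}. \<exists>g\<in>{..<r} \<rightarrow>\<^sub>E {..<n}. hub_spider G x f g)"
        "\<not> K \<le> real (card (hub_set n G (\<delta> * L)))" by blast+
      show "G \<in> eigenvalue_event n p t B"
        unfolding eigenvalue_event_def
      proof (intro CollectI allI impI)
        fix k assume k: "1 \<le> k \<and> real k \<le> t"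
        show "\<bar>eigenvalue_nth (centered_adj_mat n p G) k - sqrt (ordered_degree n G k)\<bar> \<le> B \<and>
          \<bar>eigenvalue_nth (centered_adj_mat n p G) (n + 1 - k) + sqrt (ordered_degree n G k)\<bar> \<le> B"
        proof (rule eigenvalues_of_good_graph[OF p n(1,2) P _ s1 _ _ G(1,2), where r = r and \<tau> = "\<delta> * L" and d = d])
          show "card {y \<in> hub_set n G (\<delta> * L). adjacent G z y} \<le> r" if "z < n" for z
            using G(3) that by (meson nat_le_linear)
          show "card {z. z < n \<and> z \<notin> hub_set n G (\<delta> * L) \<and> adjacent G x z \<and>
              (\<exists>y\<in>hub_set n G (\<delta> * L). y \<noteq> x \<and> adjacent G z y)} \<le> 2 * r" if "x \<in> hub_set n G (\<delta> * L)" for x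
            by (rule few_bad_leaves_of_no_spider[OF G(4,5)]) (use that in \<open>simp add: hub_set_def\<close>)
          show "d * (real (card (hub_set n G (\<delta> * L))) * P) \<le> 1"
          proof -
            have "P \<le> l / real n" using L(3,4) n0 by (simp add: pos_le_divide_eq mult.commute l_def)
            then have "real (card (hub_set n G (\<delta> * L))) * P \<le> K * (l / real n)"
              using G(6) P(2) by (intro mult_mono) auto
            then have "d * (real (card (hub_set n G (\<delta> * L))) * P) \<le> l * (K * (l / real n))"
              by (rule mult_mono[rotated]) (use L(2,3) d(1) P(2) l1 in \<open>simp_all add: l_def\<close>)
            also have "\<dots> = l * l * (real n powr (1 - \<delta> / 4) / real n powr 1)" using n0 by (simp add: K_def)
            also have "real n powr (1 - \<delta> / 4) / real n powr 1 = real n powr (- (\<delta> / 4))"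
              unfolding powr_diff[symmetric] by simp
            finally show ?thesis using few by (simp add: l_def)
          qed
          show "k + card (hub_set n G (\<delta> * L)) \<le> n"
          proof -
            have "real k + real (card (hub_set n G (\<delta> * L))) \<le> real n / 2 + real n / 2"
              using k t G(6) unfolding K_def by linarith
            then show ?thesis by simp
          qed
          show "2661 * s + 3 * real r + 3 + sqrt (\<delta> * L + 3 * real r + 1) \<le> B"
          proof -
            have "s \<le> sqrt (real n * P + \<delta> * L)"
              unfolding s_def using P(2) L(1) by (intro real_sqrt_le_mono) auto
            also have "\<dots> \<le> sqrt (real n * P) + sqrt (\<delta> * L)"
              using P(2) L(1) by (intro sqrt_add_le_add_sqrt) auto
            finally have 1: "s \<le> sqrt (real n * P) + sqrt (\<delta> * L)" .
            have "sqrt (\<delta> * L + (3 * real r + 1)) \<le> sqrt (\<delta> * L) + sqrt (3 * real r + 1)"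
              using L(1) by (intro sqrt_add_le_add_sqrt) auto
            also have "sqrt (3 * real r + 1) \<le> 3 * real r + 1"
              by (rule real_le_lsqrt) (auto simp: power2_eq_square algebra_simps)
            finally have "sqrt (\<delta> * L + 3 * real r + 1) \<le> sqrt (\<delta> * L) + (3 * real r + 1)" by (simp add: add.assoc)
            then show ?thesis using 1 B by linarith
          qed
        qed (use s2 L(1) k d in auto)
      qed
    qed
  qed
qed

text \<open>Order of choices: \<delta> from \<epsilon>, then r from \<delta>, then the required size
  K of L from all three, and only then \<eta> and N, which may also depend on \<kappa> and \<theta>
  but not on p.\<close>

lemma eigenvalue_event_probability:
  fixes \<epsilon> \<kappa> \<theta> :: real
  assumes \<epsilon>: "0 < \<epsilon>" "\<epsilon> < 1" and \<kappa>: "\<kappa> > 0" and \<theta>: "\<theta> > 0"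
  obtains \<eta> N where "\<eta> > 0"
    "\<And>n p. n \<ge> N \<Longrightarrow> edge_probabilities n p \<Longrightarrow> \<kappa> \<le> max_mean_degree n p \<Longrightarrow>
       max_mean_degree n p \<le> \<eta> * ln (real n) \<Longrightarrow>
       1 - \<theta> \<le> measure_pmf.prob (random_graph n p) (eigenvalue_event n p (real n powr (1 - \<epsilon>))
         (5324 * sqrt (real n * p_max n p) + \<epsilon> * sqrt (L_param n (max_mean_degree n p) 1)))"
proof -
  \<comment> \<open>5324 = 2 * 2662, so the error \<open>2662 * sqrt (\<delta> * L)\<close> of the
    hub threshold uses half of the budget \<open>\<epsilon> * sqrt L\<close>.\<close>
  define \<delta> where "\<delta> = (\<epsilon> / 5324)\<^sup>2"
  have \<delta>: "\<delta> > 0" using \<epsilon> by (simp add: \<delta>_def)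
  have sqrt_\<delta>: "2662 * sqrt (\<delta> * L) = \<epsilon> / 2 * sqrt L" for L
    using \<epsilon> by (simp add: \<delta>_def real_sqrt_mult)
  define r where "r = nat \<lceil>4 / \<delta>\<rceil>"
  have "4 / \<delta> \<le> real r" unfolding r_def by (rule real_nat_ceiling_ge)
  moreover have "0 < 4 / \<delta>" using \<delta> by simp
  ultimately have "0 < real r" "4 / \<delta> \<le> real r" by linarith+
  then have r: "1 \<le> r" "4 \<le> \<delta> * real r" using \<delta> by (simp_all add: pos_divide_le_eq mult.commute)
  \<comment> \<open>The summands serve \<open>L >= 1\<close>, \<open>\<delta> * L >= 1\<close>, and
    that the bounded error \<open>6 * r + 4\<close> fits into the other half of
    \<open>\<epsilon> * sqrt L\<close>.\<close>
  define K where "K = 1 + 1 / \<delta> + ((6 * real r + 4) * 2 / \<epsilon>)\<^sup>2"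
  obtain \<eta>1 N1 where L1: "\<eta>1 > 0"
    "\<And>n d. n \<ge> N1 \<Longrightarrow> \<kappa> \<le> d \<Longrightarrow> d \<le> \<eta>1 * ln (real n) \<Longrightarrow> K \<le> L_param n d 1"
    "\<And>n d. n \<ge> N1 \<Longrightarrow> \<kappa> \<le> d \<Longrightarrow> d \<le> \<eta>1 * ln (real n) \<Longrightarrow> L_param n d 1 \<le> ln (real n)"
    "\<And>n d. n \<ge> N1 \<Longrightarrow> \<kappa> \<le> d \<Longrightarrow> d \<le> \<eta>1 * ln (real n) \<Longrightarrow> d \<le> L_param n d 1"
    "\<And>n d. n \<ge> N1 \<Longrightarrow> \<kappa> \<le> d \<Longrightarrow> d \<le> \<eta>1 * ln (real n) \<Longrightarrow>
       L_param n d 1 - ln (L_param n d 1 / d) * (\<delta> * L_param n d 1) \<le> - (\<delta> / 2) * ln (real n)"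
    by (rule L_param_bounds[OF \<kappa> \<delta>, of K]) blast
  \<comment> \<open>The same exponent for the hub threshold \<open>4 * L\<close> of the dense
    case.\<close>
  obtain \<eta>2 N2 where L2: "\<eta>2 > 0"
    "\<And>n d. n \<ge> N2 \<Longrightarrow> \<kappa> \<le> d \<Longrightarrow> d \<le> \<eta>2 * ln (real n) \<Longrightarrow>
       L_param n d 1 - ln (L_param n d 1 / d) * (4 * L_param n d 1) \<le> - (4 / 2) * ln (real n)"
    by (rule L_param_bounds[OF \<kappa>, of 4 0]) auto
  define M where "M = (8 + 2 * r) * r"
  have small: "eventually (\<lambda>n. f n \<le> c) sequentially" if "f \<longlonglongrightarrow> 0" "0 < c" for f :: "nat \<Rightarrow> real" and c
    using order_tendstoD(2)[OF that] by (rule eventually_mono) simp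
  have "eventually (\<lambda>n::nat. 2 + ln (5 * real n) + ln (real n) \<le> real n) sequentially" by real_asymp
  moreover have "eventually (\<lambda>n::nat. 1 \<le> ln (real n)) sequentially" by real_asymp
  moreover have "eventually (\<lambda>n::nat. ln (real n) * ln (real n) * real n powr (- (\<delta> / 4)) \<le> 1) sequentially"
    by (rule small) (use \<delta> in real_asymp, simp)
  moreover have "eventually (\<lambda>n::nat. real n powr (1 - \<epsilon>) / real n \<le> 1 / 2) sequentially"
    by (rule small) (use \<epsilon> in real_asymp, simp)
  moreover have "eventually (\<lambda>n::nat. real n powr (1 - \<delta> / 4) / real n \<le> 1 / 2) sequentially"
    by (rule small) (use \<delta> in real_asymp, simp)
  moreover have "eventually (\<lambda>n::nat. ln (real n) / \<kappa> \<le> (ln (real n))\<^sup>2) sequentially" using \<kappa> by real_asymp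
  moreover have "eventually (\<lambda>n::nat. 1 + ((ln (real n))\<^sup>2 / \<kappa>)\<^sup>2 \<le> ln (real n) ^ 8) sequentially" using \<kappa> by real_asymp
  moreover have "eventually (\<lambda>n::nat. exp (- real n) + 1 / real n \<le> \<theta> / 4) sequentially"
    by (rule small) (real_asymp, use \<theta> in simp)
  moreover have "eventually (\<lambda>n::nat. 2 * (ln (real n) ^ M / real n) \<le> \<theta> / 4) sequentially"
    by (rule small) (real_asymp, use \<theta> in simp)
  moreover have "eventually (\<lambda>n::nat. ln (real n) ^ 6 / real n \<le> \<theta> / 4) sequentially"
    by (rule small) (real_asymp, use \<theta> in simp)
  moreover have "eventually (\<lambda>n::nat. (ln (real n))\<^sup>2 / real n \<le> \<theta> / 4) sequentially"
    by (rule small) (real_asymp, use \<theta> in simp)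
  moreover have "eventually (\<lambda>n::nat. real n powr (- (\<delta> / 4)) * ln (real n) ^ (2 * r) \<le> \<theta> / 4) sequentially"
    by (rule small) (use \<delta> in real_asymp, use \<theta> in simp)
  moreover have "eventually (\<lambda>n. N1 \<le> n) sequentially" by (rule eventually_ge_at_top)
  moreover have "eventually (\<lambda>n. N2 \<le> n) sequentially" by (rule eventually_ge_at_top)
  moreover have "eventually (\<lambda>n::nat. 2 \<le> n) sequentially" by (rule eventually_ge_at_top)
  ultimately have "eventually (\<lambda>n::nat. 2 + ln (5 * real n) + ln (real n) \<le> real n \<and> 1 \<le> ln (real n)
     \<and> ln (real n) * ln (real n) * real n powr (- (\<delta> / 4)) \<le> 1
     \<and> real n powr (1 - \<epsilon>) / real n \<le> 1 / 2 \<and> real n powr (1 - \<delta> / 4) / real n \<le> 1 / 2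
     \<and> ln (real n) / \<kappa> \<le> (ln (real n))\<^sup>2 \<and> 1 + ((ln (real n))\<^sup>2 / \<kappa>)\<^sup>2 \<le> ln (real n) ^ 8
     \<and> exp (- real n) + 1 / real n \<le> \<theta> / 4 \<and> 2 * (ln (real n) ^ M / real n) \<le> \<theta> / 4
     \<and> ln (real n) ^ 6 / real n \<le> \<theta> / 4 \<and> (ln (real n))\<^sup>2 / real n \<le> \<theta> / 4
     \<and> real n powr (- (\<delta> / 4)) * ln (real n) ^ (2 * r) \<le> \<theta> / 4
     \<and> N1 \<le> n \<and> N2 \<le> n \<and> 2 \<le> n) sequentially"
    by (intro eventually_conj)
  then obtain N where N: "\<And>n. n \<ge> N \<Longrightarrow> 2 + ln (5 * real n) + ln (real n) \<le> real n \<and> 1 \<le> ln (real n)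
     \<and> ln (real n) * ln (real n) * real n powr (- (\<delta> / 4)) \<le> 1
     \<and> real n powr (1 - \<epsilon>) / real n \<le> 1 / 2 \<and> real n powr (1 - \<delta> / 4) / real n \<le> 1 / 2
     \<and> ln (real n) / \<kappa> \<le> (ln (real n))\<^sup>2 \<and> 1 + ((ln (real n))\<^sup>2 / \<kappa>)\<^sup>2 \<le> ln (real n) ^ 8
     \<and> exp (- real n) + 1 / real n \<le> \<theta> / 4 \<and> 2 * (ln (real n) ^ M / real n) \<le> \<theta> / 4
     \<and> ln (real n) ^ 6 / real n \<le> \<theta> / 4 \<and> (ln (real n))\<^sup>2 / real n \<le> \<theta> / 4
     \<and> real n powr (- (\<delta> / 4)) * ln (real n) ^ (2 * r) \<le> \<theta> / 4
     \<and> N1 \<le> n \<and> N2 \<le> n \<and> 2 \<le> n"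
    unfolding eventually_sequentially by blast
  show thesis
  proof (rule that[of "min \<eta>1 \<eta>2" N])
    show "min \<eta>1 \<eta>2 > 0" using L1(1) L2(1) by simp
    fix n p
    assume n: "n \<ge> N" and p: "edge_probabilities n p" and d\<kappa>: "\<kappa> \<le> max_mean_degree n p"
      and d\<eta>: "max_mean_degree n p \<le> min \<eta>1 \<eta>2 * ln (real n)"
    define d where "d = max_mean_degree n p"
    define P where "P = p_max n p"
    define L where "L = L_param n d 1"
    define t where "t = real n powr (1 - \<epsilon>)"
    note F = N[OF n]
    have n2: "n \<ge> 2" "n > 0" "N1 \<le> n" "N2 \<le> n" using F by auto
    have ln1: "1 \<le> ln (real n)" using F by blast
    have "min \<eta>1 \<eta>2 * ln (real n) \<le> \<eta>1 * ln (real n)" "min \<eta>1 \<eta>2 * ln (real n) \<le> \<eta>2 * ln (real n)"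
      using ln1 by (auto intro!: mult_right_mono)
    then have d: "\<kappa> \<le> d" "d \<le> \<eta>1 * ln (real n)" "d \<le> \<eta>2 * ln (real n)"
      using d\<kappa> d\<eta> by (auto simp: d_def)
    have L: "K \<le> L" "L \<le> ln (real n)" "d \<le> L"
      "L - ln (L / d) * (\<delta> * L) \<le> - (\<delta> / 2) * ln (real n)"
      "L - ln (L / d) * (4 * L) \<le> - 2 * ln (real n)"
      using L1(2-5)[OF n2(3) d(1,2)] L2(2)[OF n2(4) d(1,3)] by (simp_all add: L_def)
    have d0: "0 < d" using d \<kappa> by linarith
    have dd: "(\<Sum>j<n. p i j) \<le> d" if "i < n" for i unfolding d_def by (rule max_mean_degree_ge[OF that])
    have P: "p i j \<le> P" if "i < n" "j < n" "i \<noteq> j" for i j unfolding P_def by (rule p_max_ge[OF that])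
    have "0 \<le> p 0 1" using p n2 unfolding edge_probabilities_def by simp
    then have P0: "0 \<le> P" using P[of 0 1] n2 by simp
    have K: "1 \<le> K" "1 / \<delta> \<le> K" "((6 * real r + 4) * 2 / \<epsilon>)\<^sup>2 \<le> K" using \<delta> by (simp_all add: K_def)
    have L1': "1 \<le> L" using L(1) K(1) by linarith
    have "1 / \<delta> \<le> L" using L(1) K(2) by linarith
    then have \<delta>L: "1 \<le> \<delta> * L" using \<delta> by (simp add: pos_divide_le_eq mult.commute)
    have big: "6 * real r + 4 \<le> \<epsilon> / 2 * sqrt L"
    proof -
      have "(6 * real r + 4) * 2 / \<epsilon> \<le> sqrt L" using L(1) K(3) by (intro real_le_rsqrt) linarith
      then show ?thesis using \<epsilon> by (simp add: field_simps)
    qed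
    have w: "L / d \<le> ln (real n) / \<kappa>" using L(2) L1' d \<kappa> by (intro frac_le) auto
    then have w2: "L / d \<le> (ln (real n))\<^sup>2" using F by linarith
    have w8: "1 + (L * (L / d))\<^sup>2 \<le> ln (real n) ^ 8"
    proof -
      have "L * (L / d) \<le> ln (real n) * (ln (real n) / \<kappa>)" using w L(2) L1' d0 ln1 by (intro mult_mono) auto
      then have "(L * (L / d))\<^sup>2 \<le> ((ln (real n))\<^sup>2 / \<kappa>)\<^sup>2"
        using L1' d0 by (intro power_mono) (auto simp: power2_eq_square)
      then show ?thesis using F by linarith
    qed
    have t2: "t \<le> real n / 2" "real n powr (1 - \<delta> / 4) \<le> real n / 2"
      using F n2 by (simp_all add: t_def pos_divide_le_eq)
    have "1 - \<theta> \<le> measure_pmf.prob (random_graph n p) (eigenvalue_event n p t (5324 * sqrt (real n * P) + \<epsilon> * sqrt L))"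
    proof (cases "L \<le> real n * P")
      case True
      show ?thesis
      proof (rule eigenvalue_event_dense[OF p n2(2) _ P P0 d0 dd L1' L(3) True L(5) w2])
        show "t \<le> real n" using t2(1) by simp
        have "\<epsilon> / 2 * sqrt L \<le> \<epsilon> * sqrt L" using \<epsilon> L1' by simp
        then show "5324 * sqrt (real n * P) + 4 \<le> 5324 * sqrt (real n * P) + \<epsilon> * sqrt L" using big by linarith
        show "exp (- real n) + 1 / real n + (ln (real n))\<^sup>2 / real n \<le> \<theta>" using F \<theta> by linarith
      qed (use F in blast)
    next
      case False
      then have nPL: "real n * P \<le> L" by simp
      show ?thesis
      proof (rule eigenvalue_event_sparse[OF p n2(2) _ ln1 P P0 d0 dd \<delta> r \<delta>L L(3,2) nPL L(4) w2 w8 t2])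
        show "2661 * sqrt (real n * P) + 2662 * sqrt (\<delta> * L) + 6 * real r + 4 \<le> 5324 * sqrt (real n * P) + \<epsilon> * sqrt L"
        proof -
          have "0 \<le> sqrt (real n * P)" using P0 by simp
          then show ?thesis using big unfolding sqrt_\<delta> by linarith
        qed
        show "exp (- real n) + 1 / real n + 2 * (ln (real n) ^ ((8 + 2 * r) * r) / real n) + ln (real n) ^ 6 / real n
          + real n powr (- (\<delta> / 4)) * ln (real n) ^ (2 * r) \<le> \<theta>"
          using F unfolding M_def by linarith
      qed (use F in blast)+
    qed
    then show "1 - \<theta> \<le> measure_pmf.prob (random_graph n p) (eigenvalue_event n p (real n powr (1 - \<epsilon>))
         (5324 * sqrt (real n * p_max n p) + \<epsilon> * sqrt (L_param n (max_mean_degree n p) 1)))"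
      by (simp only: t_def P_def L_def d_def)
  qed
qed

text \<open>For \<open>n >= 1\<close> the range of k contains 1, so \<open>Max\<close> is a genuine
  maximum over a nonempty set and the pointwise bounds transfer.\<close>

lemma eigenvalue_event_subset_Max:
  assumes n: "n \<ge> 1" and \<epsilon>: "\<epsilon> < 1"
  shows "eigenvalue_event n p (real n powr (1 - \<epsilon>)) B \<subseteq>
    {G. (MAX k\<in>bracket (real n powr (1 - \<epsilon>)).
           \<bar>eigenvalue_nth (centered_adj_mat n p G) k - sqrt (ordered_degree n G k)\<bar>) \<le> B \<and>
        (MAX k\<in>bracket (real n powr (1 - \<epsilon>)).
           \<bar>eigenvalue_nth (centered_adj_mat n p G) (n + 1 - k) + sqrt (ordered_degree n G k)\<bar>) \<le> B}"
proof -
  let ?t = "real n powr (1 - \<epsilon>)"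
  have t: "1 \<le> ?t" using n \<epsilon> by (intro ge_one_powr_ge_zero) auto
  then have "1 \<le> nat \<lfloor>?t\<rfloor>" by linarith
  then have ne: "bracket ?t \<noteq> {}" by (simp add: bracket_def)
  have fin: "finite (bracket ?t)" by (simp add: bracket_def)
  have mem: "1 \<le> k \<and> real k \<le> ?t" if "k \<in> bracket ?t" for k
    using that t unfolding bracket_def by auto linarith
  show ?thesis
    using fin ne mem by (auto simp: eigenvalue_event_def Max_le_iff)
qed

theorem theorem1p2:
  "\<exists>C>0. \<forall>\<epsilon>::real. 0 < \<epsilon> \<and> \<epsilon> < 1 \<longrightarrow>
     (\<exists>\<psi>. admissible_error \<psi> \<and>
       (\<forall>(n::nat) (\<kappa>::real) (\<eta>::real) (p::nat \<Rightarrow> nat \<Rightarrow> real).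
          n \<ge> 1 \<and> \<kappa> > 0 \<and> 0 < \<eta> \<and> \<eta> < 1 \<and> edge_probabilities n p \<and>
          \<kappa> \<le> max_mean_degree n p \<and> max_mean_degree n p \<le> \<eta> * ln (real n) \<and>
          p_max n p \<le> real n powr (-1 + \<eta>) \<longrightarrow>
          measure_pmf.prob (random_graph n p)
            {G. (MAX k\<in>bracket (real n powr (1 - \<epsilon>)).
                   \<bar>eigenvalue_nth (centered_adj_mat n p G) k - sqrt (ordered_degree n G k)\<bar>)
                  \<le> C * sqrt (real n * p_max n p) + \<epsilon> * sqrt (L_param n (max_mean_degree n p) 1) \<and>
                (MAX k\<in>bracket (real n powr (1 - \<epsilon>)).
                   \<bar>eigenvalue_nth (centered_adj_mat n p G) (n + 1 - k) + sqrt (ordered_degree n G k)\<bar>)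
                  \<le> C * sqrt (real n * p_max n p) + \<epsilon> * sqrt (L_param n (max_mean_degree n p) 1)}
            \<ge> 1 - \<psi> n \<kappa> \<eta>))"
proof (intro exI[of _ 5324] conjI allI impI)
  fix \<epsilon> :: real assume \<epsilon>: "0 < \<epsilon> \<and> \<epsilon> < 1"
  define S where "S n p = {G. (MAX k\<in>bracket (real n powr (1 - \<epsilon>)).
         \<bar>eigenvalue_nth (centered_adj_mat n p G) k - sqrt (ordered_degree n G k)\<bar>)
        \<le> 5324 * sqrt (real n * p_max n p) + \<epsilon> * sqrt (L_param n (max_mean_degree n p) 1) \<and>
      (MAX k\<in>bracket (real n powr (1 - \<epsilon>)).
         \<bar>eigenvalue_nth (centered_adj_mat n p G) (n + 1 - k) + sqrt (ordered_degree n G k)\<bar>)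
        \<le> 5324 * sqrt (real n * p_max n p) + \<epsilon> * sqrt (L_param n (max_mean_degree n p) 1)}" for n p
  define admissible where "admissible n \<kappa> \<eta> p \<longleftrightarrow> n \<ge> 1 \<and> edge_probabilities n p \<and>
    \<kappa> \<le> max_mean_degree n p \<and> max_mean_degree n p \<le> \<eta> * ln (real n)" for n \<kappa> \<eta> p
  \<comment> \<open>The error function is the largest failure probability over all admissible p, so
    it depends on n, \<kappa> and \<eta> alone and bounds every failure by construction. Inserting 0
    keeps the supremum meaningful when no p is admissible.\<close>
  define fails where "fails n \<kappa> \<eta> = insert 0 ((\<lambda>p. 1 - measure_pmf.prob (random_graph n p) (S n p)) ` {p. admissible n \<kappa> \<eta> p})" for n \<kappa> \<eta>
  define \<psi> where "\<psi> n \<kappa> \<eta> = Sup (fails n \<kappa> \<eta>)" for n \<kappa> \<eta>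
  have bdd: "bdd_above (fails n \<kappa> \<eta>)" for n \<kappa> \<eta>
    unfolding fails_def by (intro bdd_aboveI[of _ 1]) auto
  have \<psi>0: "0 \<le> \<psi> n \<kappa> \<eta>" for n \<kappa> \<eta>
    unfolding \<psi>_def by (rule cSup_upper[OF _ bdd]) (simp add: fails_def)
  have adm: "admissible_error \<psi>"
    unfolding admissible_error_def
  proof (intro allI impI tendstoI)
    fix \<kappa> e :: real assume \<kappa>: "\<kappa> > 0" and e: "0 < e"
    obtain \<eta> N where \<eta>: "\<eta> > 0" and N: "\<And>n p. n \<ge> N \<Longrightarrow> edge_probabilities n p \<Longrightarrow> \<kappa> \<le> max_mean_degree n p \<Longrightarrow>
       max_mean_degree n p \<le> \<eta> * ln (real n) \<Longrightarrow>
       1 - e / 2 \<le> measure_pmf.prob (random_graph n p) (eigenvalue_event n p (real n powr (1 - \<epsilon>))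
         (5324 * sqrt (real n * p_max n p) + \<epsilon> * sqrt (L_param n (max_mean_degree n p) 1)))"
      by (rule eigenvalue_event_probability[of \<epsilon> \<kappa> "e / 2"]) (use \<epsilon> \<kappa> e in auto)
    \<comment> \<open>Admissibility is monotone in \<eta>, because \<open>ln n\<close> is
      nonnegative; hence the uniform estimate at \<eta> covers all smaller values, as the joint
      limit requires.\<close>
    have small: "\<psi> n \<kappa> \<eta>' \<le> e / 2" if n: "n \<ge> N" and \<eta>': "\<eta>' < \<eta>" for n \<eta>'
      unfolding \<psi>_def
    proof (rule cSup_least)
      fix x assume "x \<in> fails n \<kappa> \<eta>'"
      then consider "x = 0" | p where "admissible n \<kappa> \<eta>' p" "x = 1 - measure_pmf.prob (random_graph n p) (S n p)"
        by (auto simp: fails_def)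
      then show "x \<le> e / 2"
      proof cases
        case 2
        then have a: "n \<ge> 1" "edge_probabilities n p" "\<kappa> \<le> max_mean_degree n p" "max_mean_degree n p \<le> \<eta>' * ln (real n)"
          by (auto simp: admissible_def)
        have "0 \<le> ln (real n)" using a(1) by simp
        then have "\<eta>' * ln (real n) \<le> \<eta> * ln (real n)" using \<eta>' by (intro mult_right_mono) auto
        then have "1 - e / 2 \<le> measure_pmf.prob (random_graph n p) (eigenvalue_event n p (real n powr (1 - \<epsilon>))
         (5324 * sqrt (real n * p_max n p) + \<epsilon> * sqrt (L_param n (max_mean_degree n p) 1)))"
          using a by (intro N[OF n]) auto
        also have "\<dots> \<le> measure_pmf.prob (random_graph n p) (S n p)"
          unfolding S_def by (rule measure_pmf.finite_measure_mono[OF eigenvalue_event_subset_Max]) (use a(1) \<epsilon> in auto)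
        finally show ?thesis using 2(2) by linarith
      qed (use e in simp)
    qed (simp add: fails_def)
    have "eventually (\<lambda>x. dist (case x of (n, \<eta>) \<Rightarrow> \<psi> n \<kappa> \<eta>) 0 < e) (sequentially \<times>\<^sub>F at_right 0)"
    proof (rule eventually_mono[OF eventually_prodI])
      show "eventually (\<lambda>n. n \<ge> N) sequentially" by (rule eventually_ge_at_top)
      show "eventually (\<lambda>\<eta>'. \<eta>' < \<eta>) (at_right 0)" using eventually_at_right_less[of 0] \<eta> by (auto simp: eventually_at_right)
      fix x :: "nat \<times> real" assume x: "fst x \<ge> N \<and> snd x < \<eta>"
      show "dist (case x of (n, \<eta>) \<Rightarrow> \<psi> n \<kappa> \<eta>) 0 < e"
        using small[of "fst x" "snd x"] \<psi>0[of "fst x" \<kappa> "snd x"] x e by (cases x) (simp add: dist_real_def)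
    qed
    then show "eventually (\<lambda>x. dist (case x of (n, \<eta>) \<Rightarrow> \<psi> n \<kappa> \<eta>) 0 < e) (sequentially \<times>\<^sub>F at_right 0)" .
  qed
  have bound: "1 - \<psi> n \<kappa> \<eta> \<le> measure_pmf.prob (random_graph n p) (S n p)" if "admissible n \<kappa> \<eta> p" for n \<kappa> \<eta> p
  proof -
    have "1 - measure_pmf.prob (random_graph n p) (S n p) \<le> \<psi> n \<kappa> \<eta>"
      unfolding \<psi>_def by (rule cSup_upper[OF _ bdd]) (use that in \<open>simp add: fails_def\<close>)
    then show ?thesis by linarith
  qed
  show "\<exists>\<psi>. admissible_error \<psi> \<and>
       (\<forall>(n::nat) (\<kappa>::real) (\<eta>::real) (p::nat \<Rightarrow> nat \<Rightarrow> real).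
          n \<ge> 1 \<and> \<kappa> > 0 \<and> 0 < \<eta> \<and> \<eta> < 1 \<and> edge_probabilities n p \<and>
          \<kappa> \<le> max_mean_degree n p \<and> max_mean_degree n p \<le> \<eta> * ln (real n) \<and>
          p_max n p \<le> real n powr (-1 + \<eta>) \<longrightarrow>
          measure_pmf.prob (random_graph n p)
            {G. (MAX k\<in>bracket (real n powr (1 - \<epsilon>)).
                   \<bar>eigenvalue_nth (centered_adj_mat n p G) k - sqrt (ordered_degree n G k)\<bar>)
                  \<le> 5324 * sqrt (real n * p_max n p) + \<epsilon> * sqrt (L_param n (max_mean_degree n p) 1) \<and>
                (MAX k\<in>bracket (real n powr (1 - \<epsilon>)).
                   \<bar>eigenvalue_nth (centered_adj_mat n p G) (n + 1 - k) + sqrt (ordered_degree n G k)\<bar>)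
                  \<le> 5324 * sqrt (real n * p_max n p) + \<epsilon> * sqrt (L_param n (max_mean_degree n p) 1)}
            \<ge> 1 - \<psi> n \<kappa> \<eta>)"
    using adm bound unfolding S_def admissible_def by (intro exI[of _ \<psi>]) simp
qed simp

end
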